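(* Let $\Omega$ be a domain in a Carnot group $\mathbb{G}$, let $(Y,d)$ be a metric space, and let $1\le q<\infty$. Suppose that a homeomorphism $\varphi:\Omega\to Y$ with $\varphi(\Omega)=Y$ induces the bounded composition operator $$\varphi^*:\mathrm{Lip}(Y)\to L^1_q(\Omega),\qquad \varphi^*u=u\circ\varphi .$$ Then $\varphi\in L^1_q(\Omega;Y)$. Moreover, $$\int_U |\nabla_0\varphi|(x)^q\,dx=\Phi(\varphi(U))$$ for every open set $U\subset\Omega$, where for open $V\subset Y$ $$\Phi(V)=\sup\Big\{\int_\Omega|\nabla_h(u\circ\varphi)(x)|^q\,dx \;\Big|\; u\in\mathrm{Lip}(Y),\ \mathrm{Lip}(u)\le 1,\ \mathrm{dist}(\operatorname{spt}u,Y\setminus V)>0\Big\}.$$ In particular, $|\nabla_0\varphi|^q=(\Phi\circ\varphi)'$ a.e. in $\Omega$, and $$\big\|\,|\nabla_0\varphi|\mid L_q(\Omega)\big\|=\|\varphi^*\|.$$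
   Context: Carnot group: a connected simply-connected Lie group $\mathbb{G}$ whose Lie algebra $\mathfrak g$ of left-invariant vector fields decomposes as $\mathfrak g=\mathfrak g_1\oplus\dots\oplus\mathfrak g_m$ with $[\mathfrak g_1,\mathfrak g_i]=\mathfrak g_{i+1}$ for $1\le i\le m-1$ and $[\mathfrak g_1,\mathfrak g_m]=\{0\}$. An inner product on $\mathfrak g$ is fixed, and $X_1,\dots,X_n$ is an orthonormal basis of the horizontal space $\mathfrak g_1$. Via the exponential map $\mathbb G$ is identified with $\mathbb R^N$, $N=\dim\mathfrak g$; $dx$ and $|\cdot|$ denote Lebesgue measure (a bi-invariant Haar measure). The Carnot--Carathéodory distance $d_{cc}(x,y)$ is the infimum of lengths of horizontal curves (absolutely continuous curves tangent to $\mathfrak g_1$ a.e.) joining $x$ and $y$; $dx$ is normalized so that the unit $d_{cc}$-ball has measure $1$. A domain is a nonempty connected open set. $L^1_q(\Omega)$, $1\le q\le\infty$: the functions $u\in L_{1,\mathrm{loc}}(\Omega)$ having generalized (weak) derivatives $X_ju\in L_q(\Omega)$, $j=1,\dots,n$, meaning $\int_\Omega (X_ju)v\,dx=-\int_\Omega uX_jv\,dx$ for all $v\in C_0^\infty(\Omega)$. Put $\nabla_hu=(X_1u,\dots,X_nu)$, with Euclidean norm $|\nabla_hu|$; the seminorm is $\|u\mid L^1_q(\Omega)\|=\||\nabla_hu|\mid L_q(\Omega)\|$. $\mathrm{Lip}(Y)$: all Lipschitz functions $u:Y\to\mathbb R$, with seminorm $\mathrm{Lip}(u)=\sup_{y_1\ne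 y_2}|u(y_1)-u(y_2)|/d(y_1,y_2)$. The mapping $\varphi$ induces the bounded composition operator if $u\circ\varphi\in L^1_q(\Omega)$ for all $u\in\mathrm{Lip}(Y)$ and there is a constant $C$ with $\|u\circ\varphi\mid L^1_q(\Omega)\|\le C\,\mathrm{Lip}(u)$ for all $u$; $\|\varphi^*\|$ is the least such $C$. Reshetnyak class $L^1_q(\Omega;Y)$: measurable mappings $\varphi:\Omega\to Y$ (preimages of Borel sets are Lebesgue measurable) such that (1) $u\circ\varphi\in L^1_q(\Omega)$ for all $u\in\mathrm{Lip}(Y)$; (2) there is $g\in L_q(\Omega)$ with $|\nabla_h(u\circ\varphi)|\le\mathrm{Lip}(u)\,g$ a.e. in $\Omega$ for every $u\in\mathrm{Lip}(Y)$. For $\varphi\in L^1_q(\Omega;Y)$, $|\nabla_0\varphi|$ denotes the a.e.-minimal function $g$ satisfying (2) (it is known to exist). $\operatorname{spt}u=\overline{\{y\in Y\mid u(y)\ne0\}}$; the distance between two sets is $+\infty$ if one of them is empty. $\Phi\circ\varphi$ denotes the set function $U\mapsto\Phi(\varphi(U))$ on open subsets $U$ of $\Omega$. For a set function $\Psi$ on open subsets of $\Omega$, its derivative at $x$ is $\Psi'(x)=\lim_{\delta\to0,\,B_\delta\ni x}\Psi(B_\delta)/|B_\delta|$, where $B_\delta$ is an arbitrary $d_{cc}$-ball of radius $\delta$ containing $x$. *)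

theory Defs
  imports "HOL-Analysis.Analysis"
begin

section \<open>Carnot groups in exponential coordinates\<close>

primrec k_smooth :: "nat \<Rightarrow> ('a::euclidean_space \<Rightarrow> 'b::real_normed_vector) \<Rightarrow> bool" where
  "k_smooth 0 f \<longleftrightarrow> continuous_on UNIV f"
| "k_smooth (Suc k) f \<longleftrightarrow>
     f differentiable_on UNIV \<and> (\<forall>b\<in>Basis. k_smooth k (\<lambda>x. frechet_derivative f (at x) b))"

definition smooth :: "('a::euclidean_space \<Rightarrow> 'b::real_normed_vector) \<Rightarrow> bool" where
  "smooth f \<longleftrightarrow> (\<forall>k. k_smooth k f)"

text \<open>The type \<^typ>\<open>'a\<close> is at the same time the group \<open>G\<close>, identified with \<open>R\<^sup>N\<close> by the
  exponential map, and its Lie algebra: \<^term>\<open>v :: 'a\<close> stands for the left-invariant vector field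
  whose value at the identity \<open>0\<close> is \<open>v\<close>.  The sets \<open>layer G i\<close>, \<open>1 \<le> i \<le> step G\<close>, are the
  strata, \<open>ip G\<close> is the inner product fixed on the Lie algebra (it need not be the one of
  \<^typ>\<open>'a\<close>), and \<open>frame G j\<close>, \<open>j < hdim G\<close>, is the horizontal basis \<open>X\<^sub>1, \<dots>, X\<^sub>n\<close>, counted
  from \<open>0\<close>.\<close>

record 'a carnot_data =
  gmul :: "'a \<Rightarrow> 'a \<Rightarrow> 'a"
  step :: nat
  layer :: "nat \<Rightarrow> 'a set"
  ip :: "'a \<Rightarrow> 'a \<Rightarrow> real"
  hdim :: nat
  frame :: "nat \<Rightarrow> 'a"

definition lfield :: "'a::euclidean_space carnot_data \<Rightarrow> 'a \<Rightarrow> 'a \<Rightarrow> 'a" where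
  "lfield G v x = vector_derivative (\<lambda>t. gmul G x (t *\<^sub>R v)) (at 0)"

definition vf_bracket ::
  "('a::euclidean_space \<Rightarrow> 'a) \<Rightarrow> ('a \<Rightarrow> 'a) \<Rightarrow> 'a \<Rightarrow> 'a" where
  "vf_bracket E F x = frechet_derivative F (at x) (E x) - frechet_derivative E (at x) (F x)"

definition lie :: "'a::euclidean_space carnot_data \<Rightarrow> 'a \<Rightarrow> 'a \<Rightarrow> 'a" where
  "lie G v w = vf_bracket (lfield G v) (lfield G w) 0"

text \<open>Connectedness and simple connectedness are automatic, the manifold being \<open>R\<^sup>N\<close>.
  Assumption \<open>exp_coords\<close> says that \<open>t \<mapsto> t v\<close> is the one-parameter subgroup with velocity \<open>v\<close>,
  i.e. that the exponential map is the identity.\<close>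

locale carnot_group =
  fixes G :: "'a::euclidean_space carnot_data"
  assumes group_law: "Groups.group (gmul G) 0 uminus"
    and smooth_mul: "smooth (\<lambda>(x, y). gmul G x y)"
    and exp_coords: "gmul G (s *\<^sub>R v) (t *\<^sub>R v) = (s + t) *\<^sub>R v"
    and step_pos: "1 \<le> step G"
    and subspace_layer: "i \<in> {1..step G} \<Longrightarrow> subspace (layer G i)"
    and direct_sum: "\<exists>!v. v \<in> (\<Pi>\<^sub>E i\<in>{1..step G}. layer G i) \<and> x = (\<Sum>i=1..step G. v i)"
    and bracket_layer: "1 \<le> i \<Longrightarrow> i < step G \<Longrightarrow>
      span {lie G v w |v w. v \<in> layer G 1 \<and> w \<in> layer G i} = layer G (Suc i)"
    and bracket_last: "v \<in> layer G 1 \<Longrightarrow> w \<in> layer G (step G) \<Longrightarrow> lie G v w = 0"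
    and ip_bilinear: "bilinear (ip G)"
    and ip_sym: "ip G v w = ip G w v"
    and ip_pos: "v \<noteq> 0 \<Longrightarrow> 0 < ip G v v"
    and frame_orthonormal: "i < hdim G \<Longrightarrow> j < hdim G \<Longrightarrow>
      ip G (frame G i) (frame G j) = (if i = j then 1 else 0)"
    and frame_span: "span (frame G ` {..<hdim G}) = layer G 1"

section \<open>Carnot--Caratheodory distance and Haar measure\<close>

definition abs_cont_on :: "real set \<Rightarrow> (real \<Rightarrow> 'a::real_normed_vector) \<Rightarrow> bool" where
  "abs_cont_on I c \<longleftrightarrow> (\<forall>\<epsilon>>0. \<exists>\<delta>>0. \<forall>D S. D division_of S \<longrightarrow> S \<subseteq> I \<longrightarrow>
     (\<Sum>k\<in>D. Sup k - Inf k) < \<delta> \<longrightarrow> (\<Sum>k\<in>D. norm (c (Sup k) - c (Inf k))) < \<epsilon>)"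

text \<open>The horizontal curve is \<open>c\<close>, and \<open>w t\<close> is the horizontal vector whose left-invariant field has the value \<open>c'(t)\<close> at
  \<open>c t\<close>; hence the length of \<open>c\<close> is the integral of \<open>|w|\<close>, the norm being that of \<open>ip G\<close>.\<close>

definition horizontal_curve ::
  "'a::euclidean_space carnot_data \<Rightarrow> (real \<Rightarrow> 'a) \<Rightarrow> (real \<Rightarrow> 'a) \<Rightarrow> bool" where
  "horizontal_curve G c w \<longleftrightarrow> abs_cont_on {0..1} c \<and>
     (AE t\<in>{0..1} in lebesgue. w t \<in> layer G 1 \<and>
        (c has_vector_derivative lfield G (w t) (c t)) (at t within {0..1}))"

definition cc_dist :: "'a::euclidean_space carnot_data \<Rightarrow> 'a \<Rightarrow> 'a \<Rightarrow> ennreal" where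
  "cc_dist G x y = (INF (c, w)\<in>{(c, w). horizontal_curve G c w \<and> c 0 = x \<and> c 1 = y}.
     \<integral>\<^sup>+t\<in>{0..1}. ennreal (sqrt (ip G (w t) (w t))) \<partial>lebesgue)"

definition cc_ball :: "'a::euclidean_space carnot_data \<Rightarrow> 'a \<Rightarrow> real \<Rightarrow> 'a set" where
  "cc_ball G x r = {y. cc_dist G x y < ennreal r}"

definition haar :: "'a::euclidean_space carnot_data \<Rightarrow> 'a measure" where
  "haar G = density lebesgue (\<lambda>_. inverse (emeasure lebesgue (cc_ball G 0 1)))"

section \<open>Sobolev functions\<close>

text \<open>All functions are total; only their values on \<open>\<Omega>\<close> matter.\<close>

definition Lq :: "'a::euclidean_space carnot_data \<Rightarrow> real \<Rightarrow> 'a set \<Rightarrow> ('a \<Rightarrow> real) set" where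
  "Lq G q \<Omega> = {f. f \<in> borel_measurable (lebesgue_on \<Omega>) \<and>
     set_integrable (haar G) \<Omega> (\<lambda>x. \<bar>f x\<bar> powr q)}"

definition Lq_norm :: "'a::euclidean_space carnot_data \<Rightarrow> real \<Rightarrow> 'a set \<Rightarrow> ('a \<Rightarrow> real) \<Rightarrow> real" where
  "Lq_norm G q \<Omega> f = (LINT x:\<Omega>|haar G. \<bar>f x\<bar> powr q) powr (1 / q)"

definition L1_loc :: "'a::euclidean_space carnot_data \<Rightarrow> 'a set \<Rightarrow> ('a \<Rightarrow> real) set" where
  "L1_loc G \<Omega> = {f. \<forall>K. compact K \<longrightarrow> K \<subseteq> \<Omega> \<longrightarrow> set_integrable (haar G) K f}"

definition test_functions :: "'a::euclidean_space set \<Rightarrow> ('a \<Rightarrow> real) set" where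
  "test_functions \<Omega> = {\<eta>. smooth \<eta> \<and> compact (closure {x. \<eta> x \<noteq> 0}) \<and> closure {x. \<eta> x \<noteq> 0} \<subseteq> \<Omega>}"

definition weak_deriv ::
  "'a::euclidean_space carnot_data \<Rightarrow> 'a set \<Rightarrow> 'a \<Rightarrow> ('a \<Rightarrow> real) \<Rightarrow> ('a \<Rightarrow> real) \<Rightarrow> bool" where
  "weak_deriv G \<Omega> v u g \<longleftrightarrow> g \<in> L1_loc G \<Omega> \<and> (\<forall>\<eta>\<in>test_functions \<Omega>.
     (LINT x:\<Omega>|haar G. g x * \<eta> x) =
     - (LINT x:\<Omega>|haar G. u x * frechet_derivative \<eta> (at x) (lfield G v x)))"

definition L1q :: "'a::euclidean_space carnot_data \<Rightarrow> real \<Rightarrow> 'a set \<Rightarrow> ('a \<Rightarrow> real) set" where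
  "L1q G q \<Omega> = {u. u \<in> L1_loc G \<Omega> \<and>
     (\<forall>j<hdim G. \<exists>g\<in>Lq G q \<Omega>. weak_deriv G \<Omega> (frame G j) u g)}"

text \<open>Weak derivatives are unique up to null sets, so the choice of a representative is
  immaterial below.\<close>

definition the_weak_deriv ::
  "'a::euclidean_space carnot_data \<Rightarrow> 'a set \<Rightarrow> 'a \<Rightarrow> ('a \<Rightarrow> real) \<Rightarrow> 'a \<Rightarrow> real" where
  "the_weak_deriv G \<Omega> v u = (SOME g. weak_deriv G \<Omega> v u g)"

definition hgrad_norm ::
  "'a::euclidean_space carnot_data \<Rightarrow> 'a set \<Rightarrow> ('a \<Rightarrow> real) \<Rightarrow> 'a \<Rightarrow> real" where
  "hgrad_norm G \<Omega> u x = sqrt (\<Sum>j<hdim G. (the_weak_deriv G \<Omega> (frame G j) u x)\<^sup>2)"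

definition L1q_seminorm ::
  "'a::euclidean_space carnot_data \<Rightarrow> real \<Rightarrow> 'a set \<Rightarrow> ('a \<Rightarrow> real) \<Rightarrow> real" where
  "L1q_seminorm G q \<Omega> u = Lq_norm G q \<Omega> (hgrad_norm G \<Omega> u)"

section \<open>Lipschitz functions and the composition operator\<close>

definition Lip :: "('y::metric_space \<Rightarrow> real) set" where
  "Lip = {u. \<exists>C. C-lipschitz_on UNIV u}"

text \<open>The pairs \<open>y\<^sub>1 = y\<^sub>2\<close> contribute the value \<open>0 / 0 = 0\<close>.\<close>

definition lip_const :: "('y::metric_space \<Rightarrow> real) \<Rightarrow> real" where
  "lip_const u = (SUP (y1, y2). \<bar>u y1 - u y2\<bar> / dist y1 y2)"

definition bounded_composition ::
  "'a::euclidean_space carnot_data \<Rightarrow> real \<Rightarrow> 'a set \<Rightarrow> ('a \<Rightarrow> 'y::metric_space) \<Rightarrow> bool" where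
  "bounded_composition G q \<Omega> \<phi> \<longleftrightarrow> (\<forall>u\<in>Lip. u \<circ> \<phi> \<in> L1q G q \<Omega>) \<and>
     (\<exists>C. \<forall>u\<in>Lip. L1q_seminorm G q \<Omega> (u \<circ> \<phi>) \<le> C * lip_const u)"

definition composition_norm ::
  "'a::euclidean_space carnot_data \<Rightarrow> real \<Rightarrow> 'a set \<Rightarrow> ('a \<Rightarrow> 'y::metric_space) \<Rightarrow> real" where
  "composition_norm G q \<Omega> \<phi> =
     Inf {C. 0 \<le> C \<and> (\<forall>u\<in>Lip. L1q_seminorm G q \<Omega> (u \<circ> \<phi>) \<le> C * lip_const u)}"

section \<open>The Reshetnyak class\<close>

definition admissible ::
  "'a::euclidean_space carnot_data \<Rightarrow> real \<Rightarrow> 'a set \<Rightarrow> ('a \<Rightarrow> 'y::metric_space) \<Rightarrow> ('a \<Rightarrow> real) \<Rightarrow> bool" where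
  "admissible G q \<Omega> \<phi> g \<longleftrightarrow> g \<in> Lq G q \<Omega> \<and>
     (\<forall>u\<in>Lip. AE x\<in>\<Omega> in haar G. hgrad_norm G \<Omega> (u \<circ> \<phi>) x \<le> lip_const u * g x)"

definition reshetnyak ::
  "'a::euclidean_space carnot_data \<Rightarrow> real \<Rightarrow> 'a set \<Rightarrow> ('a \<Rightarrow> 'y::metric_space) set" where
  "reshetnyak G q \<Omega> = {\<phi>. \<phi> \<in> measurable (lebesgue_on \<Omega>) borel \<and>
     (\<forall>u\<in>Lip. u \<circ> \<phi> \<in> L1q G q \<Omega>) \<and> (\<exists>g. admissible G q \<Omega> \<phi> g)}"

definition min_grad ::
  "'a::euclidean_space carnot_data \<Rightarrow> real \<Rightarrow> 'a set \<Rightarrow> ('a \<Rightarrow> 'y::metric_space) \<Rightarrow> 'a \<Rightarrow> real" where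
  "min_grad G q \<Omega> \<phi> = (SOME g. admissible G q \<Omega> \<phi> g \<and>
     (\<forall>h. admissible G q \<Omega> \<phi> h \<longrightarrow> (AE x\<in>\<Omega> in haar G. g x \<le> h x)))"

section \<open>The set function and its derivative\<close>

text \<open>Unlike \<^const>\<open>setdist\<close>, this is \<open>\<infinity>\<close> if one of the sets is empty.\<close>

definition set_edist :: "'y::metric_space set \<Rightarrow> 'y set \<Rightarrow> ennreal" where
  "set_edist A B = (INF (a, b)\<in>A \<times> B. ennreal (dist a b))"

definition spt :: "('y::metric_space \<Rightarrow> real) \<Rightarrow> 'y set" where
  "spt u = closure {y. u y \<noteq> 0}"

definition energy ::
  "'a::euclidean_space carnot_data \<Rightarrow> real \<Rightarrow> 'a set \<Rightarrow> ('a \<Rightarrow> 'y::metric_space) \<Rightarrow> 'y set \<Rightarrow> ennreal" where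
  "energy G q \<Omega> \<phi> V =
     (SUP u\<in>{u. u \<in> Lip \<and> lip_const u \<le> 1 \<and> 0 < set_edist (spt u) (UNIV - V)}.
        \<integral>\<^sup>+x\<in>\<Omega>. ennreal (hgrad_norm G \<Omega> (u \<circ> \<phi>) x powr q) \<partial>haar G)"

text \<open>The filter of balls of radius \<open>\<delta> \<rightarrow> 0\<close> in \<open>\<Omega>\<close> containing \<open>x\<close>, not necessarily as centre.\<close>

definition balls_at :: "'a::euclidean_space carnot_data \<Rightarrow> 'a set \<Rightarrow> 'a \<Rightarrow> 'a set filter" where
  "balls_at G \<Omega> x = (INF r\<in>{0<..}.
     principal {cc_ball G z \<delta> |z \<delta>. 0 < \<delta> \<and> \<delta> < r \<and> x \<in> cc_ball G z \<delta> \<and> cc_ball G z \<delta> \<subseteq> \<Omega>})"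

definition has_set_derivative ::
  "'a::euclidean_space carnot_data \<Rightarrow> 'a set \<Rightarrow> ('a set \<Rightarrow> ennreal) \<Rightarrow> ennreal \<Rightarrow> 'a \<Rightarrow> bool" where
  "has_set_derivative G \<Omega> \<Psi> l x \<longleftrightarrow>
     ((\<lambda>B. \<Psi> B / emeasure (haar G) B) \<longlongrightarrow> l) (balls_at G \<Omega> x)"

end

theory Submission
  imports Defs
begin

text \<open>The compositions of \<open>\<phi>\<close> with 1-Lipschitz functions have a smallest common majorant \<open>g\<close> of their
  horizontal gradients, the supremum of countably many of them; it is the minimal gradient. To see that
  \<open>\<integral>\<^sub>U g\<^sup>q\<close> does not exceed the energy of \<open>\<phi>(U)\<close>, exhaust \<open>U\<close> up to small measure by disjoint compact
  sets on which \<open>g\<close> is almost attained by single functions \<open>u\<^sub>k \<circ> \<phi>\<close>. Their images are compact, hence a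
  positive distance apart. Folding each \<open>u\<^sub>k\<close> by a saw tooth of small amplitude does not change the modulus of the
  gradient and leaves room for cutting off near the images, so that the pieces add up to a single
  1-Lipschitz competitor.

  The derivative of the energy is then obtained from Lebesgue's differentiation theorem for \<open>d\<^sub>c\<^sub>c\<close>-balls,
  which rests on a Vitali covering argument. This needs the invariance of Lebesgue measure under left
  translations and its scaling under dilations: dilations are automorphisms because the Lie bracket
  determines the group law in exponential coordinates.\<close>

section \<open>Smooth maps\<close>

text \<open>The normalisation of \<open>haar\<close> divides by the measure of the unit ball, about
  which nothing is known at the outset. Were it zero, \<open>haar\<close> would be infinite on
  Euclidean balls and constants would not be locally integrable, against
  \<open>bounded_composition\<close>. Were it infinite, \<open>haar\<close> would be the zero
  measure and every claim trivial. Otherwise it is positive and finite, and the properties of small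
  balls are extracted from this fact.

  \<open>Lip1\<close> is uncountable, so the supremum of its gradients is taken along a countable
  family that maximises the integral of the supremum. The maximisation needs these integrals to be
  bounded, and the bound is itself a result of gluing: suprema of gradients integrate to no more
  than the energy, which is a supremum over single competitors.

  A cut-off alone could not isolate \<open>u\<^sub>k\<close> near its image, because a descent from
  large values to 0 inside a gap between two images costs more slope than 1. Hence the folding into
  \<open>[0, h]\<close>, where \<open>h\<close> is at most a sixth of every gap.\<close>

lemma k_smooth_SucI:
  fixes f :: "'a::euclidean_space \<Rightarrow> 'b::real_normed_vector"
  assumes "\<And>x. (f has_derivative f' x) (at x)" and "\<And>b. b \<in> Basis \<Longrightarrow> k_smooth k (\<lambda>x. f' x b)"
  shows "k_smooth (Suc k) f"
proof -
  have "frechet_derivative f (at x) = f' x" for x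
    using frechet_derivative_at[OF assms(1)] by simp
  moreover have "f differentiable_on UNIV"
    using assms(1) unfolding differentiable_on_def differentiable_def by blast
  ultimately show ?thesis
    using assms(2) by simp
qed

lemma k_smooth_Suc_has_derivative:
  "k_smooth (Suc k) f \<Longrightarrow> (f has_derivative frechet_derivative f (at x)) (at x)"
  unfolding k_smooth.simps differentiable_on_def frechet_derivative_works[symmetric] by simp

lemma k_smooth_Suc_imp: "k_smooth (Suc k) f \<Longrightarrow> k_smooth k f"
proof (induction k arbitrary: f)
  case 0
  then show ?case
    by (simp add: differentiable_imp_continuous_on)
next
  case (Suc k)
  have "k_smooth (Suc k) (\<lambda>x. frechet_derivative f (at x) b)" if "b \<in> Basis" for b
    using Suc.prems that unfolding k_smooth.simps(2)[of "Suc k"] by blast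
  then show ?case
    by (intro k_smooth_SucI[OF k_smooth_Suc_has_derivative[OF Suc.prems]] Suc.IH)
qed

lemma k_smooth_const [simp]: "k_smooth k (\<lambda>_. c)"
proof (induction k arbitrary: c)
  case (Suc k)
  show ?case
    by (rule k_smooth_SucI[where f' = "\<lambda>_ _. 0"]) (auto intro: Suc)
qed simp

lemma k_smooth_add:
  "k_smooth k f \<Longrightarrow> k_smooth k g \<Longrightarrow> k_smooth k (\<lambda>x. f x + g x)"
proof (induction k arbitrary: f g)
  case 0
  then show ?case by (simp add: continuous_on_add)
next
  case (Suc k)
  show ?case
    using Suc.IH Suc.prems k_smooth_Suc_has_derivative[OF Suc.prems(1)]
      k_smooth_Suc_has_derivative[OF Suc.prems(2)]
    by (intro k_smooth_SucI[where
          f' = "\<lambda>x v. frechet_derivative f (at x) v + frechet_derivative g (at x) v"])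
       (auto intro: has_derivative_add)
qed

lemma k_smooth_bounded_linear:
  "bounded_linear L \<Longrightarrow> k_smooth k f \<Longrightarrow> k_smooth k (\<lambda>x. L (f x))"
proof (induction k arbitrary: f)
  case 0
  then show ?case
    by (simp add: bounded_linear.continuous_on)
next
  case (Suc k)
  show ?case
    using Suc.IH Suc.prems k_smooth_Suc_has_derivative[OF Suc.prems(2)]
    by (intro k_smooth_SucI[where f' = "\<lambda>x v. L (frechet_derivative f (at x) v)"])
       (auto intro: bounded_linear.has_derivative)
qed

lemma k_smooth_sum:
  "(\<And>i. i \<in> I \<Longrightarrow> k_smooth k (f i)) \<Longrightarrow> k_smooth k (\<lambda>x. \<Sum>i\<in>I. f i x)"
  by (induction I rule: infinite_finite_induct) (auto intro: k_smooth_add)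

text \<open>\<open>k_smooth\<close> mentions derivatives along \<open>Basis\<close> only; linearity
  of the derivative expands any other direction in that basis.\<close>

lemma k_smooth_directional:
  fixes f :: "'a::euclidean_space \<Rightarrow> 'b::real_normed_vector"
  assumes "k_smooth (Suc k) f"
  shows "k_smooth k (\<lambda>x. frechet_derivative f (at x) v)"
proof -
  have "frechet_derivative f (at x) v = (\<Sum>b\<in>Basis. (v \<bullet> b) *\<^sub>R frechet_derivative f (at x) b)" for x
  proof -
    have lin: "linear (frechet_derivative f (at x))"
      using has_derivative_linear[OF k_smooth_Suc_has_derivative[OF assms]] .
    have "frechet_derivative f (at x) (\<Sum>b\<in>Basis. (v \<bullet> b) *\<^sub>R b) =
        (\<Sum>b\<in>Basis. (v \<bullet> b) *\<^sub>R frechet_derivative f (at x) b)"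
      by (simp add: linear_sum[OF lin] linear_cmul[OF lin])
    then show ?thesis
      by (simp add: euclidean_representation)
  qed
  then show ?thesis
    using assms
    by (auto intro!: k_smooth_sum k_smooth_bounded_linear[OF bounded_linear_scaleR_right])
qed

lemma k_smooth_affine:
  fixes f :: "'a::euclidean_space \<Rightarrow> 'b::real_normed_vector"
    and A :: "'c::euclidean_space \<Rightarrow> 'a"
  assumes A: "bounded_linear A"
  shows "k_smooth k f \<Longrightarrow> k_smooth k (\<lambda>x. f (A x + c))"
proof (induction k arbitrary: f)
  case 0
  then have f: "continuous_on UNIV f" by simp
  have "continuous_on UNIV (\<lambda>x. A x + c)"
    using bounded_linear.continuous_on[OF A continuous_on_id] by (intro continuous_intros) auto
  then show ?case
    using continuous_on_compose2[OF f, of UNIV] by simp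
next
  case (Suc k)
  have "((\<lambda>x. f (A x + c)) has_derivative (\<lambda>v. frechet_derivative f (at (A x + c)) (A v))) (at x)" for x
  proof -
    have "((\<lambda>x. A x + c) has_derivative A) (at x)"
      using bounded_linear.has_derivative[OF A has_derivative_ident]
      by (auto intro!: derivative_eq_intros)
    then show ?thesis
      using has_derivative_compose[OF _ k_smooth_Suc_has_derivative[OF Suc.prems]] by fast
  qed
  then show ?case
    by (intro k_smooth_SucI[where f' = "\<lambda>x v. frechet_derivative f (at (A x + c)) (A v)"])
       (auto intro!: Suc.IH k_smooth_directional Suc.prems)
qed

lemma k_smooth_mult:
  fixes f g :: "'a::euclidean_space \<Rightarrow> real"
  shows "k_smooth k f \<Longrightarrow> k_smooth k g \<Longrightarrow> k_smooth k (\<lambda>x. f x * g x)"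
proof (induction k arbitrary: f g)
  case 0
  then show ?case by (simp add: continuous_on_mult)
next
  case (Suc k)
  show ?case
    using Suc.IH Suc.prems k_smooth_Suc_has_derivative[OF Suc.prems(1)]
      k_smooth_Suc_has_derivative[OF Suc.prems(2)]
      k_smooth_Suc_imp[OF Suc.prems(1)] k_smooth_Suc_imp[OF Suc.prems(2)]
    by (intro k_smooth_SucI[where
          f' = "\<lambda>x v. f x * frechet_derivative g (at x) v + frechet_derivative f (at x) v * g x"])
       (auto intro!: has_derivative_mult k_smooth_add)
qed

lemma k_smooth_prod:
  fixes f :: "'i \<Rightarrow> 'a::euclidean_space \<Rightarrow> real"
  shows "(\<And>i. i \<in> I \<Longrightarrow> k_smooth k (f i)) \<Longrightarrow> k_smooth k (\<lambda>x. \<Prod>i\<in>I. f i x)"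
  by (induction I rule: infinite_finite_induct) (auto intro: k_smooth_mult)

lemma smooth_has_derivative:
  "smooth f \<Longrightarrow> (f has_derivative frechet_derivative f (at x)) (at x)"
  using k_smooth_Suc_has_derivative unfolding smooth_def by blast

lemma smooth_directional: "smooth f \<Longrightarrow> smooth (\<lambda>x. frechet_derivative f (at x) v)"
  using k_smooth_directional unfolding smooth_def by blast

lemma smooth_continuous_on: "smooth f \<Longrightarrow> continuous_on S f"
  unfolding smooth_def by (metis continuous_on_subset k_smooth.simps(1) subset_UNIV)

lemma smooth_affine: "bounded_linear A \<Longrightarrow> smooth f \<Longrightarrow> smooth (\<lambda>x. f (A x + c))"
  using k_smooth_affine unfolding smooth_def by blast

lemma smooth_bounded_linear: "bounded_linear L \<Longrightarrow> smooth f \<Longrightarrow> smooth (\<lambda>x. L (f x))"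
  using k_smooth_bounded_linear unfolding smooth_def by blast

lemma smooth_linear_frechet: "smooth f \<Longrightarrow> linear (frechet_derivative f (at x))"
  using has_derivative_linear smooth_has_derivative by blast

section \<open>Symmetry of second derivatives\<close>

lemma second_difference_mean_value:
  fixes f :: "'a::euclidean_space \<Rightarrow> real"
  assumes f: "smooth f" and h: "0 < h"
  obtains s t where "0 < s" "s < h" "0 < t" "t < h"
    "f (x + h *\<^sub>R v + h *\<^sub>R w) - f (x + h *\<^sub>R v) - f (x + h *\<^sub>R w) + f x =
      h * h * frechet_derivative (\<lambda>y. frechet_derivative f (at y) v) (at (x + s *\<^sub>R v + t *\<^sub>R w)) w"
proof -
  let ?D = "\<lambda>y. frechet_derivative f (at y) v"
  have lin1: "frechet_derivative f (at y) (r *\<^sub>R v) = r * ?D y" for r y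
    using linear_cmul[OF smooth_linear_frechet[OF f]] by simp
  have lin2: "frechet_derivative ?D (at y) (r *\<^sub>R w) = r * frechet_derivative ?D (at y) w" for r y
    using linear_cmul[OF smooth_linear_frechet[OF smooth_directional[OF f]]] by simp
  have d1: "((\<lambda>s. f (z + s *\<^sub>R v)) has_real_derivative ?D (z + s *\<^sub>R v)) (at s)" for z s
  proof -
    have "((\<lambda>s. f (z + s *\<^sub>R v)) has_derivative (\<lambda>r. frechet_derivative f (at (z + s *\<^sub>R v)) (r *\<^sub>R v))) (at s)"
      by (rule has_derivative_compose[OF _ smooth_has_derivative[OF f]])
         (auto intro!: derivative_eq_intros)
    then show ?thesis
      unfolding has_field_derivative_def lin1 by (simp add: mult_commute_abs)
  qed
  have d2: "((\<lambda>t. ?D (z + t *\<^sub>R w)) has_real_derivative frechet_derivative ?D (at (z + t *\<^sub>R w)) w) (at t)" for z t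
  proof -
    have "((\<lambda>s. ?D (z + s *\<^sub>R w)) has_derivative (\<lambda>r. frechet_derivative ?D (at (z + t *\<^sub>R w)) (r *\<^sub>R w))) (at t)"
      by (rule has_derivative_compose[OF _ smooth_has_derivative[OF smooth_directional[OF f]]])
         (auto intro!: derivative_eq_intros)
    then show ?thesis
      unfolding has_field_derivative_def lin2 by (simp add: mult_commute_abs)
  qed
  define p where "p s = f ((x + h *\<^sub>R w) + s *\<^sub>R v) - f (x + s *\<^sub>R v)" for s
  have p': "(p has_real_derivative ?D ((x + h *\<^sub>R w) + s *\<^sub>R v) - ?D (x + s *\<^sub>R v)) (at s)" for s
    unfolding p_def by (intro DERIV_diff d1)
  obtain s where s: "0 < s" "s < h" "p h - p 0 = (h - 0) * (?D ((x + h *\<^sub>R w) + s *\<^sub>R v) - ?D (x + s *\<^sub>R v))"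
    using MVT2[OF h p'] by metis
  obtain t where t: "0 < t" "t < h"
    "?D ((x + s *\<^sub>R v) + h *\<^sub>R w) - ?D ((x + s *\<^sub>R v) + 0 *\<^sub>R w) =
      (h - 0) * frechet_derivative ?D (at ((x + s *\<^sub>R v) + t *\<^sub>R w)) w"
    using MVT2[OF h d2] by metis
  have "?D ((x + h *\<^sub>R w) + s *\<^sub>R v) - ?D (x + s *\<^sub>R v) =
      h * frechet_derivative ?D (at (x + s *\<^sub>R v + t *\<^sub>R w)) w"
    using t(3) by (simp add: add_ac)
  then have "p h - p 0 = h * h * frechet_derivative ?D (at (x + s *\<^sub>R v + t *\<^sub>R w)) w"
    using s(3) by simp
  then show ?thesis
    using that[OF s(1,2) t(1,2)] by (simp add: p_def algebra_simps)
qed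

text \<open>The second difference of \<open>second_difference_mean_value\<close>, evaluated there by
  the mean value theorem first along \<open>v\<close> and then along \<open>w\<close>, is symmetric
  in \<open>v\<close> and \<open>w\<close>. Cancelling \<open>h n * h n\<close> and letting
  \<open>h n\<close> tend to 0 identifies the two mixed derivatives by their continuity.\<close>

lemma second_derivative_symmetric_real:
  fixes f :: "'a::euclidean_space \<Rightarrow> real"
  assumes f: "smooth f"
  shows "frechet_derivative (\<lambda>y. frechet_derivative f (at y) v) (at x) w =
    frechet_derivative (\<lambda>y. frechet_derivative f (at y) w) (at x) v"
proof -
  define A where "A v w y = frechet_derivative (\<lambda>y. frechet_derivative f (at y) v) (at y) w" for v w y
  have cont: "isCont (A v w) x" for v w
  proof -
    have "continuous_on UNIV (A v w)"
      unfolding A_def by (intro smooth_continuous_on smooth_directional f)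
    then show ?thesis
      by (simp add: continuous_on_eq_continuous_at)
  qed
  define h where "h n = inverse (real (Suc n))" for n
  have h: "0 < h n" for n by (simp add: h_def)
  have h0: "h \<longlonglongrightarrow> 0"
    unfolding h_def by (rule LIMSEQ_inverse_real_of_nat)
  have lim: "(\<lambda>n. A v w (x + s n *\<^sub>R v + t n *\<^sub>R w)) \<longlonglongrightarrow> A v w x"
    if "\<And>n. 0 < s n \<and> s n < h n \<and> 0 < t n \<and> t n < h n" for s t v w
  proof -
    have "s \<longlonglongrightarrow> 0" "t \<longlonglongrightarrow> 0"
      by (rule tendsto_sandwich[OF _ _ tendsto_const h0];
          use that in \<open>auto intro!: always_eventually less_imp_le\<close>)+
    then have "(\<lambda>n. x + s n *\<^sub>R v + t n *\<^sub>R w) \<longlonglongrightarrow> x + 0 *\<^sub>R v + 0 *\<^sub>R w"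
      by (intro tendsto_intros)
    then show ?thesis
      using isCont_tendsto_compose[OF cont] by simp
  qed
  have "\<exists>s t. 0 < s \<and> s < h n \<and> 0 < t \<and> t < h n \<and>
      f (x + h n *\<^sub>R v + h n *\<^sub>R w) - f (x + h n *\<^sub>R v) - f (x + h n *\<^sub>R w) + f x =
      h n * h n * A v w (x + s *\<^sub>R v + t *\<^sub>R w)" for n v w
    using second_difference_mean_value[OF f h] unfolding A_def by metis
  then obtain s t where st: "\<And>n v w. 0 < s n v w \<and> s n v w < h n \<and> 0 < t n v w \<and> t n v w < h n"
    and eq: "\<And>n v w. f (x + h n *\<^sub>R v + h n *\<^sub>R w) - f (x + h n *\<^sub>R v) - f (x + h n *\<^sub>R w) + f x =
      h n * h n * A v w (x + s n v w *\<^sub>R v + t n v w *\<^sub>R w)"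
    by metis
  have "h n * h n * A v w (x + s n v w *\<^sub>R v + t n v w *\<^sub>R w) =
      h n * h n * A w v (x + s n w v *\<^sub>R w + t n w v *\<^sub>R v)" for n
    unfolding eq[symmetric] by (simp add: algebra_simps)
  then have "A v w (x + s n v w *\<^sub>R v + t n v w *\<^sub>R w) = A w v (x + s n w v *\<^sub>R w + t n w v *\<^sub>R v)" for n
    using h[of n] by (metis less_irrefl mult_left_cancel mult_eq_0_iff)
  then have "(\<lambda>n. A w v (x + s n w v *\<^sub>R w + t n w v *\<^sub>R v)) \<longlonglongrightarrow> A v w x"
    using lim[of "\<lambda>n. s n v w" "\<lambda>n. t n v w" v w] st by simp
  moreover have "(\<lambda>n. A w v (x + s n w v *\<^sub>R w + t n w v *\<^sub>R v)) \<longlonglongrightarrow> A w v x"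
    using lim[of "\<lambda>n. s n w v" "\<lambda>n. t n w v" w v] st by simp
  ultimately show ?thesis
    using LIMSEQ_unique unfolding A_def by blast
qed

lemma second_derivative_symmetric:
  fixes f :: "'a::euclidean_space \<Rightarrow> 'b::euclidean_space"
  assumes f: "smooth f"
  shows "frechet_derivative (\<lambda>y. frechet_derivative f (at y) v) (at x) w =
    frechet_derivative (\<lambda>y. frechet_derivative f (at y) w) (at x) v"
proof (rule euclidean_eqI)
  fix b :: 'b
  assume "b \<in> Basis"
  have inner: "frechet_derivative (\<lambda>x. g x \<bullet> b) (at y) u = frechet_derivative g (at y) u \<bullet> b"
    if "smooth g" for g :: "'a \<Rightarrow> 'b" and y u
  proof -
    have "((\<lambda>x. g x \<bullet> b) has_derivative (\<lambda>u. frechet_derivative g (at y) u \<bullet> b)) (at y)"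
      by (intro has_derivative_inner_left smooth_has_derivative that)
    then show ?thesis
      using frechet_derivative_at by metis
  qed
  have "frechet_derivative (\<lambda>y. frechet_derivative (\<lambda>x. f x \<bullet> b) (at y) v) (at x) w =
      frechet_derivative (\<lambda>y. frechet_derivative (\<lambda>x. f x \<bullet> b) (at y) w) (at x) v"
    by (intro second_derivative_symmetric_real smooth_bounded_linear[OF bounded_linear_inner_left f])
  then show "frechet_derivative (\<lambda>y. frechet_derivative f (at y) v) (at x) w \<bullet> b =
      frechet_derivative (\<lambda>y. frechet_derivative f (at y) w) (at x) v \<bullet> b"
    by (simp add: inner f smooth_directional)
qed

section \<open>Uniqueness for differential inequalities\<close>

text \<open>Gronwall's argument: the squared norm of \<open>e\<close>, damped by the factor
  \<open>exp (- (2 * K * t))\<close>, has nonpositive derivative and starts at 0. It serves as the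
  uniqueness theorem for the differential equations below.\<close>

lemma vector_derivative_bound_imp_zero:
  fixes e :: "real \<Rightarrow> 'a::euclidean_space"
  assumes der: "\<And>t. 0 \<le> t \<Longrightarrow> t \<le> T \<Longrightarrow> (e has_vector_derivative e' t) (at t)"
    and bound: "\<And>t. 0 \<le> t \<Longrightarrow> t \<le> T \<Longrightarrow> norm (e' t) \<le> K * norm (e t)"
    and "e 0 = 0" and "0 \<le> T"
  shows "e T = 0"
proof -
  let ?h = "\<lambda>t. exp (- (2 * K * t)) * (e t \<bullet> e t)"
  have "?h T \<le> ?h 0"
  proof (rule DERIV_nonpos_imp_nonincreasing[OF \<open>0 \<le> T\<close>])
    fix t :: real
    assume t: "0 \<le> t" "t \<le> T"
    have "((\<lambda>t. e t \<bullet> e t) has_real_derivative 2 * (e t \<bullet> e' t)) (at t)"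
      using der[OF t] unfolding has_vector_derivative_def has_field_derivative_def
      by (auto intro!: derivative_eq_intros simp: inner_commute algebra_simps)
    then have "(?h has_real_derivative
        exp (- (2 * K * t)) * (2 * (e t \<bullet> e' t)) + (exp (- (2 * K * t)) * (- (2 * K))) * (e t \<bullet> e t)) (at t)"
      by (auto intro!: derivative_eq_intros)
    moreover have "e t \<bullet> e' t \<le> K * (e t \<bullet> e t)"
    proof -
      have "e t \<bullet> e' t \<le> norm (e t) * norm (e' t)" by (rule norm_cauchy_schwarz)
      also have "\<dots> \<le> norm (e t) * (K * norm (e t))"
        by (intro mult_left_mono bound t) auto
      finally show ?thesis by (simp add: dot_square_norm power2_eq_square algebra_simps)
    qed
    then have "exp (- (2 * K * t)) * (2 * (e t \<bullet> e' t)) + (exp (- (2 * K * t)) * (- (2 * K))) * (e t \<bullet> e t) \<le> 0"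
      by (simp add: algebra_simps)
    ultimately show "\<exists>y. (?h has_real_derivative y) (at t) \<and> y \<le> 0" by blast
  qed
  then have "e T \<bullet> e T \<le> 0"
    using \<open>e 0 = 0\<close> by (simp add: mult_le_0_iff)
  then show ?thesis by (simp add: antisym_conv)
qed

section \<open>Left-invariant fields in exponential coordinates\<close>

lemma has_vector_derivative_compose_derivative:
  assumes f: "(f has_vector_derivative f') (at t within S)" and g: "(g has_derivative g') (at (f t))"
  shows "((\<lambda>t. g (f t)) has_vector_derivative g' f') (at t within S)"
proof -
  have "((\<lambda>t. g (f t)) has_derivative (\<lambda>r. g' (r *\<^sub>R f'))) (at t within S)"
    by (rule has_derivative_compose[OF f[unfolded has_vector_derivative_def] g])
  then show ?thesis
    unfolding has_vector_derivative_def by (simp add: linear_cmul[OF has_derivative_linear[OF g]])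
qed

text \<open>Product rule for a variable linear map applied to a variable vector. Expanding the
  vector in the basis reduces it to finitely many products with scalar factors, so differentiability
  of \<open>A\<close> is needed only for each fixed vector.\<close>

lemma has_derivative_linear_apply:
  fixes A :: "'a::euclidean_space \<Rightarrow> 'b::euclidean_space \<Rightarrow> 'c::euclidean_space"
  assumes lin: "\<And>y. linear (A y)"
    and A: "\<And>v. ((\<lambda>y. A y v) has_derivative A' v) (at x)"
    and V: "(V has_derivative V') (at x)"
  shows "((\<lambda>y. A y (V y)) has_derivative (\<lambda>u. A' (V x) u + A x (V' u))) (at x)"
proof -
  have expand: "A y v = (\<Sum>b\<in>Basis. (v \<bullet> b) *\<^sub>R A y b)" for y v
    by (subst (1) euclidean_representation[of v, symmetric])
       (simp add: linear_sum[OF lin] linear_cmul[OF lin])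
  have A'_expand: "A' v u = (\<Sum>b\<in>Basis. (v \<bullet> b) *\<^sub>R A' b u)" for v u
  proof -
    have "((\<lambda>y. \<Sum>b\<in>Basis. (v \<bullet> b) *\<^sub>R A y b) has_derivative (\<lambda>u. \<Sum>b\<in>Basis. (v \<bullet> b) *\<^sub>R A' b u)) (at x)"
      by (intro has_derivative_sum has_derivative_scaleR_right A)
    then have "((\<lambda>y. A y v) has_derivative (\<lambda>u. \<Sum>b\<in>Basis. (v \<bullet> b) *\<^sub>R A' b u)) (at x)"
      by (simp add: expand[symmetric])
    then show ?thesis
      using has_derivative_unique[OF A[of v]] by metis
  qed
  have "((\<lambda>y. \<Sum>b\<in>Basis. (V y \<bullet> b) *\<^sub>R A y b) has_derivative
      (\<lambda>u. \<Sum>b\<in>Basis. (V x \<bullet> b) *\<^sub>R A' b u + (V' u \<bullet> b) *\<^sub>R A x b)) (at x)"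
    by (intro has_derivative_sum has_derivative_scaleR has_derivative_inner_left V A)
  then show ?thesis
    by (simp add: expand[symmetric] A'_expand[symmetric] sum.distrib)
qed

lemma has_derivative_frechet_apply:
  fixes f :: "'a::euclidean_space \<Rightarrow> 'b::euclidean_space"
  assumes f: "smooth f" and V: "(V has_derivative V') (at x)"
  shows "((\<lambda>y. frechet_derivative f (at y) (V y)) has_derivative
    (\<lambda>u. frechet_derivative (\<lambda>y. frechet_derivative f (at y) (V x)) (at x) u +
      frechet_derivative f (at x) (V' u))) (at x)"
  by (intro has_derivative_linear_apply[OF smooth_linear_frechet[OF f] _ V]
      smooth_has_derivative smooth_directional f)

text \<open>In the cyclic sum the terms with two first derivatives cancel in pairs, and those with a
  second derivative cancel by its symmetry.\<close>

lemma vf_bracket_Jacobi: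
  fixes E F H :: "'a::euclidean_space \<Rightarrow> 'a"
  assumes E: "smooth E" and F: "smooth F" and H: "smooth H"
  shows "vf_bracket E (vf_bracket F H) x + vf_bracket F (vf_bracket H E) x +
    vf_bracket H (vf_bracket E F) x = 0"
proof -
  have bracket: "frechet_derivative (vf_bracket F H) (at x) =
    (\<lambda>u. frechet_derivative (\<lambda>y. frechet_derivative H (at y) (F x)) (at x) u +
      frechet_derivative H (at x) (frechet_derivative F (at x) u) -
      (frechet_derivative (\<lambda>y. frechet_derivative F (at y) (H x)) (at x) u +
      frechet_derivative F (at x) (frechet_derivative H (at x) u)))"
    if F: "smooth F" and H: "smooth H" for F H :: "'a \<Rightarrow> 'a"
    unfolding vf_bracket_def
    by (rule frechet_derivative_at[symmetric])
       (intro has_derivative_diff has_derivative_frechet_apply smooth_has_derivative F H)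
  have sym: "frechet_derivative (\<lambda>y. frechet_derivative F (at y) v) (at x) w =
      frechet_derivative (\<lambda>y. frechet_derivative F (at y) w) (at x) v"
    if "smooth F" for F :: "'a \<Rightarrow> 'a" and v w
    by (rule second_derivative_symmetric[OF that])
  have lin: "frechet_derivative F (at x) (v - w) = frechet_derivative F (at x) v - frechet_derivative F (at x) w"
    if "smooth F" for F :: "'a \<Rightarrow> 'a" and v w
    by (rule linear_diff[OF smooth_linear_frechet[OF that]])
  show ?thesis
    unfolding vf_bracket_def[of E "vf_bracket F H"] vf_bracket_def[of F "vf_bracket H E"]
      vf_bracket_def[of H "vf_bracket E F"] bracket[OF F H] bracket[OF H E] bracket[OF E F]
    \<comment> \<open>Just the three instances of \<open>sym\<close> that bring matching terms to
      the same form are used; as an unrestricted rewrite rule it would loop.\<close>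
    unfolding vf_bracket_def lin[OF E] lin[OF F] lin[OF H]
      sym[OF E, of "F x" "H x"] sym[OF F, of "H x" "E x"] sym[OF H, of "E x" "F x"]
    by simp
qed

text \<open>Partial derivatives are bounded on the compact ball, and the ball is convex, so the mean
  value inequality applies.\<close>

lemma smooth_Lipschitz_on_ball:
  fixes f :: "'a::euclidean_space \<Rightarrow> 'b::euclidean_space"
  assumes f: "smooth f"
  obtains K where "\<And>x y. x \<in> cball 0 R \<Longrightarrow> y \<in> cball 0 R \<Longrightarrow> norm (f x - f y) \<le> K * norm (x - y)"
proof -
  let ?D = "\<lambda>x. frechet_derivative f (at x)"
  have "\<exists>B. \<forall>x\<in>cball 0 R. norm (?D x b) \<le> B" for b
  proof -
    have "compact ((\<lambda>x. ?D x b) ` cball 0 R)"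
      by (intro compact_continuous_image smooth_continuous_on smooth_directional f compact_cball)
    then show ?thesis
      using compact_imp_bounded bounded_iff by (metis (no_types, lifting) imageI)
  qed
  then obtain B where B: "\<And>b x. x \<in> cball 0 R \<Longrightarrow> norm (?D x b) \<le> B b" by metis
  have "onorm (?D x) \<le> (\<Sum>b\<in>Basis. \<bar>B b\<bar>)" if x: "x \<in> cball 0 R" for x
  proof (rule onorm_le)
    fix v
    have "?D x v = (\<Sum>b\<in>Basis. (v \<bullet> b) *\<^sub>R ?D x b)"
      by (subst (1) euclidean_representation[of v, symmetric])
         (simp add: linear_sum[OF smooth_linear_frechet[OF f]] linear_cmul[OF smooth_linear_frechet[OF f]])
    also have "norm \<dots> \<le> (\<Sum>b\<in>Basis. norm v * \<bar>B b\<bar>)"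
    proof (intro sum_norm_le)
      fix b :: 'a assume "b \<in> Basis"
      have "\<bar>v \<bullet> b\<bar> * norm (?D x b) \<le> norm v * \<bar>B b\<bar>"
        using B[OF x, of b] Basis_le_norm[OF \<open>b \<in> Basis\<close>, of v] by (intro mult_mono) auto
      then show "norm ((v \<bullet> b) *\<^sub>R ?D x b) \<le> norm v * \<bar>B b\<bar>" by simp
    qed
    finally show "norm (?D x v) \<le> (\<Sum>b\<in>Basis. \<bar>B b\<bar>) * norm v"
      by (simp add: sum_distrib_left mult.commute)
  qed
  then have "norm (f x - f y) \<le> (\<Sum>b\<in>Basis. \<bar>B b\<bar>) * norm (x - y)"
    if "x \<in> cball 0 R" "y \<in> cball 0 R" for x y
    using that
    by (intro differentiable_bound[where f' = ?D, OF convex_cball[of 0 R]])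
       (auto intro: has_derivative_at_withinI smooth_has_derivative[OF f])
  then show ?thesis using that by blast
qed

text \<open>A left translation is a slice of the joint product. Writing its derivative as one of the
  joint product also displays the smooth dependence on the translating point
  \<open>x\<close>.\<close>

lemma smooth_lmul':
  fixes g :: "'a::euclidean_space \<Rightarrow> 'a \<Rightarrow> 'a"
  assumes "smooth (\<lambda>(x, y). g x y)"
  shows "smooth (g x)" "frechet_derivative (g x) (at z) v = frechet_derivative (\<lambda>(x, y). g x y) (at (x, z)) (0, v)"
proof -
  let ?m = "\<lambda>(x, y). g x y"
  have bl: "bounded_linear (\<lambda>z::'a. (0::'a, z))"
    by (intro bounded_linear_Pair bounded_linear_zero bounded_linear_ident)
  show "smooth (g x)"
    using smooth_affine[OF bl assms, of "(x, 0)"] by simp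
  have "((\<lambda>z. (x, z)) has_derivative (\<lambda>v. (0, v))) (at z)"
    by (auto intro!: derivative_eq_intros)
  from has_derivative_compose[OF this smooth_has_derivative[OF assms]]
  have "(g x has_derivative (\<lambda>v. frechet_derivative ?m (at (x, z)) (0, v))) (at z)"
    by simp
  then show "frechet_derivative (g x) (at z) v = frechet_derivative ?m (at (x, z)) (0, v)"
    using frechet_derivative_at by metis
qed

context carnot_group
begin

interpretation grp: Groups.group "gmul G" 0 uminus
  by (rule group_law)

abbreviation mul (infixl "\<odot>" 70) where "x \<odot> y \<equiv> gmul G x y"

abbreviation DL :: "'a \<Rightarrow> 'a \<Rightarrow> 'a \<Rightarrow> 'a" where
  "DL x z \<equiv> frechet_derivative (gmul G x) (at z)"

lemmas smooth_lmul = smooth_lmul'(1)[OF smooth_mul]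

lemma DL_has_derivative: "(gmul G x has_derivative DL x z) (at z)"
  by (rule smooth_has_derivative[OF smooth_lmul])

lemma DL_chain: "DL y (x \<odot> z) (DL x z v) = DL (y \<odot> x) z v"
proof -
  have "((\<lambda>z. y \<odot> (x \<odot> z)) has_derivative (\<lambda>v. DL y (x \<odot> z) (DL x z v))) (at z)"
    by (rule has_derivative_compose[OF DL_has_derivative DL_has_derivative])
  then have "(gmul G (y \<odot> x) has_derivative (\<lambda>v. DL y (x \<odot> z) (DL x z v))) (at z)"
    by (simp add: grp.assoc[symmetric])
  then show ?thesis
    using frechet_derivative_at by metis
qed

lemma DL_zero [simp]: "DL 0 z v = v"
proof -
  have "gmul G 0 = (\<lambda>x. x)" by (simp add: fun_eq_iff)
  then have "(gmul G 0 has_derivative (\<lambda>v. v)) (at z)" by simp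
  then show ?thesis
    using frechet_derivative_at by metis
qed

lemma linear_DL: "linear (DL x z)"
  by (rule smooth_linear_frechet[OF smooth_lmul])

lemma lfield_eq_DL: "lfield G v x = DL x 0 v"
proof -
  have "((\<lambda>t. t *\<^sub>R v) has_vector_derivative v) (at 0)"
    by (auto intro!: derivative_eq_intros)
  moreover have "(gmul G x has_derivative DL x 0) (at (0 *\<^sub>R v))"
    using DL_has_derivative by simp
  ultimately have "((\<lambda>t. x \<odot> (t *\<^sub>R v)) has_vector_derivative DL x 0 v) (at 0)"
    by (rule has_vector_derivative_compose_derivative)
  then show ?thesis
    unfolding lfield_def by (rule vector_derivative_at)
qed

lemma lfield_zero [simp]: "lfield G v 0 = v"
  by (simp add: lfield_eq_DL)

lemma linear_lfield: "linear (\<lambda>v. lfield G v x)"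
  unfolding lfield_eq_DL by (rule linear_DL)

text \<open>Left invariance of the field: associativity differentiated in the right factor at the
  identity.\<close>

lemma DL_lfield: "DL y x (lfield G v x) = lfield G v (y \<odot> x)"
  using DL_chain[of y x 0 v] by (simp add: lfield_eq_DL)

lemma smooth_lfield: "smooth (lfield G v)"
proof -
  have "bounded_linear (\<lambda>x::'a. (x, 0::'a))"
    by (intro bounded_linear_Pair bounded_linear_zero bounded_linear_ident)
  from smooth_affine[OF this smooth_directional[OF smooth_mul], of "0" "(0, v)"]
  have "smooth (\<lambda>x. DL x 0 v)"
    unfolding smooth_lmul'(2)[OF smooth_mul] by simp
  then show ?thesis
    by (simp add: lfield_eq_DL[abs_def])
qed

text \<open>By \<open>exp_coords\<close> the point at time \<open>t + s\<close> is the point at time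
  \<open>t\<close> multiplied by \<open>s *\<^sub>R v\<close>, so the velocity at \<open>t\<close>
  is the one at \<open>s = 0\<close> of the curve starting there.\<close>

lemma curve_has_vector_derivative:
  "((\<lambda>t. y \<odot> (t *\<^sub>R v)) has_vector_derivative lfield G v (y \<odot> (t *\<^sub>R v))) (at t)"
proof -
  have "((\<lambda>s. s *\<^sub>R v) has_vector_derivative v) (at 0)"
    by (auto intro!: derivative_eq_intros)
  moreover have "(gmul G (y \<odot> (t *\<^sub>R v)) has_derivative DL (y \<odot> (t *\<^sub>R v)) 0) (at (0 *\<^sub>R v))"
    using DL_has_derivative by simp
  ultimately have "((\<lambda>s. y \<odot> (t *\<^sub>R v) \<odot> (s *\<^sub>R v)) has_vector_derivative lfield G v (y \<odot> (t *\<^sub>R v))) (at 0)"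
    unfolding lfield_eq_DL by (rule has_vector_derivative_compose_derivative)
  then have 1: "((\<lambda>s. y \<odot> ((t + s) *\<^sub>R v)) has_vector_derivative lfield G v (y \<odot> (t *\<^sub>R v))) (at 0)"
    by (simp add: grp.assoc exp_coords)
  have 2: "((\<lambda>s. s - t) has_vector_derivative 1) (at t)"
    by (auto intro!: derivative_eq_intros)
  show ?thesis
    using vector_diff_chain_at[OF 2, of "\<lambda>s. y \<odot> ((t + s) *\<^sub>R v)" "lfield G v (y \<odot> (t *\<^sub>R v))"] 1
    by (simp add: o_def)
qed

text \<open>The ray through \<open>x\<close> is an integral curve of the field of \<open>x\<close>,
  and its velocity is visibly \<open>x\<close>.\<close>

lemma lfield_radial: "lfield G x (t *\<^sub>R x) = x"
proof -
  have "((\<lambda>t. 0 \<odot> (t *\<^sub>R x)) has_vector_derivative lfield G x (0 \<odot> (t *\<^sub>R x))) (at t)"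
    by (rule curve_has_vector_derivative)
  moreover have "((\<lambda>t. t *\<^sub>R x) has_vector_derivative x) (at t)"
    by (auto intro!: derivative_eq_intros)
  ultimately show ?thesis
    using vector_derivative_unique_at[of "\<lambda>t. t *\<^sub>R x" "lfield G x (t *\<^sub>R x)" t x] by simp
qed

text \<open>Left invariance \<open>DL_lfield\<close> differentiated at the identity in direction
  \<open>w\<close>. The first summand is a second derivative of the translation by \<open>y\<close>,
  hence symmetric in \<open>v\<close> and \<open>w\<close>, and drops out of the bracket; this makes
  the bracket left-invariant.\<close>

lemma lfield_derivative_sym:
  "frechet_derivative (lfield G v) (at y) (lfield G w y) =
    frechet_derivative (\<lambda>x. DL y x v) (at 0) w + DL y 0 (frechet_derivative (lfield G v) (at 0) w)"
proof -
  have "((\<lambda>x. lfield G v (y \<odot> x)) has_derivative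
      (\<lambda>w. frechet_derivative (lfield G v) (at (y \<odot> 0)) (DL y 0 w))) (at 0)"
    by (rule has_derivative_compose[OF DL_has_derivative smooth_has_derivative[OF smooth_lfield]])
  then have 1: "((\<lambda>x. lfield G v (y \<odot> x)) has_derivative
      (\<lambda>w. frechet_derivative (lfield G v) (at y) (lfield G w y))) (at 0)"
    by (simp add: lfield_eq_DL)
  have 2: "((\<lambda>x. lfield G v (y \<odot> x)) has_derivative (\<lambda>w. frechet_derivative (\<lambda>x. DL y x v) (at 0) w +
      DL y 0 (frechet_derivative (lfield G v) (at 0) w))) (at 0)"
    using has_derivative_frechet_apply[OF smooth_lmul[of y] smooth_has_derivative[OF smooth_lfield[of v], of 0]]
    by (simp add: DL_lfield)
  show ?thesis
    using has_derivative_unique[OF 1 2] by metis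
qed

lemma vf_bracket_lfield: "vf_bracket (lfield G v) (lfield G w) y = lfield G (lie G v w) y"
proof -
  have "vf_bracket (lfield G v) (lfield G w) y = DL y 0 (frechet_derivative (lfield G w) (at 0) v) -
      DL y 0 (frechet_derivative (lfield G v) (at 0) w)"
    unfolding vf_bracket_def lfield_derivative_sym
    using second_derivative_symmetric[OF smooth_lmul, of y v 0 w] by simp
  also have "\<dots> = lfield G (lie G v w) y"
    unfolding lie_def vf_bracket_def lfield_eq_DL[of _ y] by (simp add: linear_diff[OF linear_DL])
  finally show ?thesis .
qed

lemma lie_antisym: "lie G v w = - lie G w v"
  by (simp add: lie_def vf_bracket_def)

lemma frechet_lfield_linear: "linear (\<lambda>v. frechet_derivative (lfield G v) (at x) u)"
proof
  have h: "(lfield G v has_derivative frechet_derivative (lfield G v) (at x)) (at x)" for v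
    by (rule smooth_has_derivative[OF smooth_lfield])
  fix v w r
  have "lfield G (v + w) = (\<lambda>x. lfield G v x + lfield G w x)"
    by (simp add: fun_eq_iff linear_add[OF linear_lfield])
  then show "frechet_derivative (lfield G (v + w)) (at x) u =
      frechet_derivative (lfield G v) (at x) u + frechet_derivative (lfield G w) (at x) u"
    using frechet_derivative_at[OF has_derivative_add[OF h h]] by metis
  have "lfield G (r *\<^sub>R v) = (\<lambda>x. r *\<^sub>R lfield G v x)"
    by (simp add: fun_eq_iff linear_cmul[OF linear_lfield])
  then show "frechet_derivative (lfield G (r *\<^sub>R v)) (at x) u = r *\<^sub>R frechet_derivative (lfield G v) (at x) u"
    using frechet_derivative_at[OF has_derivative_scaleR_right[OF h]] by metis
qed

lemma linear_lie_right: "linear (lie G v)"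
  unfolding lie_def[abs_def] vf_bracket_def lfield_zero
  by (intro linear_compose_sub frechet_lfield_linear smooth_linear_frechet smooth_lfield)

lemma linear_lie_left: "linear (\<lambda>v. lie G v w)"
  by (subst lie_antisym) (intro linear_compose_neg linear_lie_right)

lemma lie_Jacobi: "lie G u (lie G v w) + lie G v (lie G w u) + lie G w (lie G u v) = 0"
proof -
  have eq: "lie G u (lie G v w) = vf_bracket (lfield G u) (vf_bracket (lfield G v) (lfield G w)) 0" for u v w
    unfolding vf_bracket_lfield[abs_def] by (simp add: lie_def[of _ u] eta_contract_eq)
  show ?thesis
    unfolding eq by (intro vf_bracket_Jacobi smooth_lfield)
qed

text \<open>The Maurer-Cartan form: a tangent vector at \<open>y\<close> is translated back to the
  identity. For fixed \<open>y\<close> it inverts the map taking \<open>v\<close> to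
  \<open>lfield G v y\<close>.\<close>

definition inv_lfield :: "'a \<Rightarrow> 'a \<Rightarrow> 'a" where
  "inv_lfield w y = DL (- y) y w"

lemma inv_lfield_lfield: "inv_lfield (lfield G v y) y = v"
  by (simp add: inv_lfield_def DL_lfield)

lemma lfield_inv_lfield: "lfield G (inv_lfield w y) y = w"
proof -
  have "DL y (- y \<odot> y) (DL (- y) y w) = DL (y \<odot> - y) y w"
    by (rule DL_chain)
  then show ?thesis
    by (simp add: inv_lfield_def lfield_eq_DL)
qed

lemma smooth_inv_lfield: "smooth (inv_lfield w)"
proof -
  have "bounded_linear (\<lambda>x::'a. (- x, x))"
    by (intro bounded_linear_Pair bounded_linear_minus bounded_linear_ident)
  from smooth_affine[OF this smooth_directional[OF smooth_mul], of 0 "(0, w)"]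
  show ?thesis
    unfolding inv_lfield_def[abs_def] smooth_lmul'(2)[OF smooth_mul] by simp
qed

text \<open>Differentiating \<open>lfield y y = y\<close>.\<close>

lemma frechet_lfield_radial:
  "t *\<^sub>R frechet_derivative (lfield G x) (at (t *\<^sub>R x)) h = h - lfield G h (t *\<^sub>R x)"
proof -
  let ?y = "t *\<^sub>R x"
  have "((\<lambda>y. lfield G y y) has_derivative
      (\<lambda>u. frechet_derivative (lfield G ?y) (at ?y) u + lfield G u ?y)) (at ?y)"
    by (rule has_derivative_linear_apply[where V = "\<lambda>y. y"])
       (auto intro: linear_lfield smooth_has_derivative smooth_lfield)
  moreover have "lfield G y y = y" for y
    using lfield_radial[of y 1] by simp
  ultimately have "((\<lambda>y. y) has_derivative
      (\<lambda>u. frechet_derivative (lfield G ?y) (at ?y) u + lfield G u ?y)) (at ?y)"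
    by simp
  then have "(\<lambda>u. frechet_derivative (lfield G ?y) (at ?y) u + lfield G u ?y) = (\<lambda>u. u)"
    using has_derivative_unique[OF _ has_derivative_ident] by blast
  then have "frechet_derivative (lfield G ?y) (at ?y) h + lfield G h ?y = h"
    by (rule fun_cong)
  then show ?thesis
    by (simp add: linear_cmul[OF frechet_lfield_linear] algebra_simps)
qed

text \<open>The coordinate expression of \<open>lfield\<close> is determined by the Lie bracket: this linear
  differential equation along rays is the formula for the derivative of the exponential map.\<close>

lemma inv_lfield_ode:
  "((\<lambda>t. t *\<^sub>R inv_lfield w (t *\<^sub>R x)) has_vector_derivative
    w - lie G x (t *\<^sub>R inv_lfield w (t *\<^sub>R x))) (at t)"
proof -
  let ?c = "\<lambda>t. t *\<^sub>R inv_lfield w (t *\<^sub>R x)" and ?y = "t *\<^sub>R x"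
  have ray: "((\<lambda>t. t *\<^sub>R x) has_derivative (\<lambda>r. r *\<^sub>R x)) (at t)"
    by (auto intro!: derivative_eq_intros)
  have "((\<lambda>t. inv_lfield w (t *\<^sub>R x)) has_derivative
      (\<lambda>r. frechet_derivative (inv_lfield w) (at ?y) (r *\<^sub>R x))) (at t)"
    by (rule has_derivative_compose[OF ray smooth_has_derivative[OF smooth_inv_lfield]])
  then have "\<exists>c'. (?c has_derivative c') (at t)"
    using has_derivative_scaleR[OF has_derivative_ident] by blast
  then obtain c' where c': "(?c has_derivative c') (at t)" by blast
  \<comment> \<open>The curve \<open>?c\<close> is characterised by
    \<open>lfield G (?c t) (t *\<^sub>R x) = t *\<^sub>R w\<close>; differentiating both sides in
    \<open>t\<close> gives an equation for its velocity.\<close>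
  have "((\<lambda>t. lfield G (?c t) (t *\<^sub>R x)) has_derivative
      (\<lambda>r. frechet_derivative (lfield G (?c t)) (at ?y) (r *\<^sub>R x) + lfield G (c' r) ?y)) (at t)"
    by (rule has_derivative_linear_apply[OF linear_lfield
          has_derivative_compose[OF ray smooth_has_derivative[OF smooth_lfield]] c'])
  moreover have "lfield G (?c t) (t *\<^sub>R x) = t *\<^sub>R w" for t
    by (simp add: linear_cmul[OF linear_lfield] lfield_inv_lfield)
  ultimately have "((\<lambda>t. t *\<^sub>R w) has_derivative
      (\<lambda>r. frechet_derivative (lfield G (?c t)) (at ?y) (r *\<^sub>R x) + lfield G (c' r) ?y)) (at t)"
    by simp
  moreover have "((\<lambda>t. t *\<^sub>R w) has_derivative (\<lambda>r. r *\<^sub>R w)) (at t)"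
    by (auto intro!: derivative_eq_intros)
  ultimately have "(\<lambda>r. frechet_derivative (lfield G (?c t)) (at ?y) (r *\<^sub>R x) + lfield G (c' r) ?y) = (\<lambda>r. r *\<^sub>R w)"
    using has_derivative_unique by blast
  from fun_cong[OF this, of 1]
  have 1: "frechet_derivative (lfield G (?c t)) (at ?y) x + lfield G (c' 1) ?y = w"
    by simp
  \<comment> \<open>The equation still contains the derivative of the field of \<open>?c t\<close>
    along the ray. The bracket with the field of \<open>x\<close> trades it for the derivative of
    the field of \<open>x\<close>, which \<open>frechet_lfield_radial\<close> computes.\<close>
  have "vf_bracket (lfield G x) (lfield G (?c t)) ?y = lfield G (lie G x (?c t)) ?y"
    by (rule vf_bracket_lfield)
  then have "frechet_derivative (lfield G (?c t)) (at ?y) x -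
      frechet_derivative (lfield G x) (at ?y) (t *\<^sub>R w) = lfield G (lie G x (?c t)) ?y"
    unfolding vf_bracket_def
    by (simp add: lfield_radial linear_cmul[OF linear_lfield] lfield_inv_lfield)
  moreover have "frechet_derivative (lfield G x) (at ?y) (t *\<^sub>R w) = w - lfield G w ?y"
    using frechet_lfield_radial[of t x w]
    by (simp add: linear_cmul[OF smooth_linear_frechet[OF smooth_lfield]])
  ultimately have "frechet_derivative (lfield G (?c t)) (at ?y) x = w - lfield G w ?y + lfield G (lie G x (?c t)) ?y"
    by (simp add: algebra_simps)
  with 1 have "w - lfield G w ?y + lfield G (lie G x (?c t)) ?y + lfield G (c' 1) ?y = w"
    by simp
  then have "lfield G (c' 1) ?y = lfield G (w - lie G x (?c t)) ?y"
    by (simp add: linear_diff[OF linear_lfield] algebra_simps)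
  then have c'_1: "c' 1 = w - lie G x (?c t)"
    by (metis inv_lfield_lfield)
  have "c' r = r *\<^sub>R c' 1" for r
    using linear_cmul[OF has_derivative_linear[OF c'], of r 1] by simp
  then have "c' = (\<lambda>r. r *\<^sub>R c' 1)" by blast
  from has_derivative_eq_rhs[OF c' this] show ?thesis
    unfolding has_vector_derivative_def c'_1 .
qed

text \<open>Since \<open>D\<close> respects the bracket, it carries a solution of
  \<open>inv_lfield_ode\<close> for \<open>w\<close>, \<open>x\<close> to one for
  \<open>D w\<close>, \<open>D x\<close>. Both curves vanish at 0 and the equation is linear, so
  they agree at time 1.\<close>

lemma inv_lfield_hom:
  assumes D: "linear D" and hom: "\<And>v w. lie G (D v) (D w) = D (lie G v w)"
  shows "D (inv_lfield w x) = inv_lfield (D w) (D x)"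
proof -
  have bl: "bounded_linear D"
    using D linear_conv_bounded_linear by blast
  let ?c = "\<lambda>t. t *\<^sub>R inv_lfield w (t *\<^sub>R x)" and ?d = "\<lambda>t. t *\<^sub>R inv_lfield (D w) (t *\<^sub>R D x)"
  define e where "e t = D (?c t) - ?d t" for t
  obtain K where K: "\<And>v. norm (lie G (D x) v) \<le> K * norm v"
    using linear_bounded[OF linear_lie_right] by metis
  have "e 1 = 0"
  proof (rule vector_derivative_bound_imp_zero[where T = 1 and e' = "\<lambda>t. - lie G (D x) (e t)" and K = K])
    fix t :: real
    have "(e has_vector_derivative D (w - lie G x (?c t)) - (D w - lie G (D x) (?d t))) (at t)"
      unfolding e_def
      by (intro has_vector_derivative_diff bounded_linear.has_vector_derivative[OF bl] inv_lfield_ode)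
    moreover have "D (w - lie G x (?c t)) - (D w - lie G (D x) (?d t)) = - lie G (D x) (e t)"
      by (simp add: e_def linear_diff[OF D] linear_diff[OF linear_lie_right] hom)
    ultimately show "(e has_vector_derivative - lie G (D x) (e t)) (at t)" by simp
  qed (use K in \<open>auto simp: e_def linear_0[OF D]\<close>)
  then show ?thesis
    by (simp add: e_def)
qed

lemma lfield_hom:
  assumes D: "linear D" and hom: "\<And>v w. lie G (D v) (D w) = D (lie G v w)"
  shows "D (lfield G v x) = lfield G (D v) (D x)"
  using inv_lfield_hom[OF assms, of "lfield G v x" x] by (simp add: inv_lfield_lfield lfield_inv_lfield)

text \<open>As functions of the time \<open>t\<close>, \<open>D (y \<odot> (t *\<^sub>R v))\<close>
  and \<open>D y \<odot> (t *\<^sub>R D v)\<close> are integral curves of the same field starting at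
  \<open>D y\<close>. On a ball containing both up to time 1 the field is Lipschitz, so they
  coincide.\<close>

lemma lie_hom_imp_group_hom:
  assumes D: "linear D" and hom: "\<And>v w. lie G (D v) (D w) = D (lie G v w)"
  shows "D (y \<odot> v) = D y \<odot> D v"
proof -
  have bl: "bounded_linear D"
    using D linear_conv_bounded_linear by blast
  let ?a = "\<lambda>t. D (y \<odot> (t *\<^sub>R v))" and ?b = "\<lambda>t. D y \<odot> (t *\<^sub>R D v)"
  have a': "(?a has_vector_derivative lfield G (D v) (?a t)) (at t)" for t
    using bounded_linear.has_vector_derivative[OF bl curve_has_vector_derivative] 
    by (simp add: lfield_hom[OF assms])
  have b': "(?b has_vector_derivative lfield G (D v) (?b t)) (at t)" for t
    by (rule curve_has_vector_derivative)
  have "continuous_on UNIV ?a" "continuous_on UNIV ?b"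
    using a' b' by (meson continuous_on_eq_continuous_at open_UNIV has_vector_derivative_continuous)+
  then have "compact (?a ` {0..1} \<union> ?b ` {0..1})"
    by (intro compact_Un compact_continuous_image) (auto intro: continuous_on_subset)
  then have "bounded (?a ` {0..1} \<union> ?b ` {0..1})"
    by (rule compact_imp_bounded)
  then obtain R where R: "?a ` {0..1} \<union> ?b ` {0..1} \<subseteq> cball 0 R"
    unfolding bounded_iff by (auto simp: subset_iff)
  obtain K where K: "\<And>x y. x \<in> cball 0 R \<Longrightarrow> y \<in> cball 0 R \<Longrightarrow>
      norm (lfield G (D v) x - lfield G (D v) y) \<le> K * norm (x - y)"
    using smooth_Lipschitz_on_ball[OF smooth_lfield] by metis
  have "?a 1 - ?b 1 = 0"
  proof (rule vector_derivative_bound_imp_zero[where e = "\<lambda>t. ?a t - ?b t"])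
    show "((\<lambda>t. ?a t - ?b t) has_vector_derivative lfield G (D v) (?a t) - lfield G (D v) (?b t)) (at t)" for t
      by (intro has_vector_derivative_diff a' b')
    show "norm (lfield G (D v) (?a t) - lfield G (D v) (?b t)) \<le> K * norm (?a t - ?b t)"
      if "0 \<le> t" "t \<le> 1" for t
      using R that by (intro K) (simp_all add: image_subset_iff)
  qed auto
  then show ?thesis by simp
qed

end

section \<open>Dilations\<close>

context carnot_group
begin

text \<open>Continued by the zero space beyond the step, so that the grading rule for brackets holds
  with the index \<open>i + j\<close> whatever its size.\<close>

definition stratum :: "nat \<Rightarrow> 'a set" where
  "stratum k = (if k \<in> {1..step G} then layer G k else {0})"

lemma subspace_stratum: "subspace (stratum k)"
  by (simp add: stratum_def subspace_layer subspace_single_0)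

lemma lie_stratum_1:
  assumes "v \<in> stratum 1" "w \<in> stratum j" "1 \<le> j"
  shows "lie G v w \<in> stratum (Suc j)"
proof -
  consider "j < step G" | "j = step G" | "j > step G" by linarith
  then show ?thesis
  proof cases
    case 1
    then have "lie G v w \<in> span {lie G v w |v w. v \<in> layer G 1 \<and> w \<in> layer G j}"
      using assms step_pos by (intro span_base) (auto simp: stratum_def)
    then show ?thesis
      using 1 bracket_layer[of j] \<open>1 \<le> j\<close> by (simp add: stratum_def)
  next
    case 2
    then show ?thesis
      using assms step_pos bracket_last[of v w] by (simp add: stratum_def)
  next
    case 3
    then show ?thesis
      using assms linear_0[OF linear_lie_right, of v] by (simp add: stratum_def)
  qed
qed

text \<open>The axioms speak only of brackets with the first layer. Elements of layer
  \<open>i + 1\<close> are spanned by brackets of \<open>a\<close> in the first and \<open>b\<close>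
  in the \<open>i\<close>-th layer, and Jacobi's identity turns \<open>[[a, b], w]\<close> into
  \<open>[a, [b, w]] - [b, [a, w]]\<close>, to which the induction hypothesis applies.\<close>

lemma lie_stratum:
  assumes "1 \<le> i"
  shows "v \<in> stratum i \<Longrightarrow> w \<in> stratum j \<Longrightarrow> 1 \<le> j \<Longrightarrow> lie G v w \<in> stratum (i + j)"
  using assms
proof (induction i arbitrary: v w j rule: nat_induct_at_least)
  case base
  then show ?case
    using lie_stratum_1[of v w j] by simp
next
  case (Suc i)
  show ?case
  proof (cases "Suc i \<le> step G")
    case False
    then have "v = 0"
      using Suc.prems by (simp add: stratum_def)
    then show ?thesis
      using linear_0[OF linear_lie_left] subspace_0[OF subspace_stratum] by simp
  next
    case True
    then have "v \<in> span {lie G v w |v w. v \<in> layer G 1 \<and> w \<in> layer G i}"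
      using Suc.prems(1) Suc.hyps bracket_layer[of i] by (simp add: stratum_def)
    then show ?thesis
    proof (rule span_induct[where P = "\<lambda>v. lie G v w \<in> stratum (Suc i + j)"])
      show "subspace {v. lie G v w \<in> stratum (Suc i + j)}"
        using linear_subspace_vimage[OF linear_lie_left[of w] subspace_stratum, of "Suc i + j"]
        by (simp add: vimage_def)
    next
      fix u
      assume "u \<in> {lie G v w |v w. v \<in> layer G 1 \<and> w \<in> layer G i}"
      then obtain a b where u: "u = lie G a b" and "a \<in> layer G 1" "b \<in> layer G i" by blast
      then have a: "a \<in> stratum 1" and b: "b \<in> stratum i"
        using True Suc.hyps by (auto simp: stratum_def)
      have "lie G a (lie G b w) \<in> stratum (Suc (i + j))"
        using Suc.IH[OF b Suc.prems(2,3)] Suc.hyps by (intro lie_stratum_1 a) auto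
      moreover have "lie G b (lie G a w) \<in> stratum (i + Suc j)"
        by (intro Suc.IH b lie_stratum_1 a Suc.prems) auto
      moreover have "lie G u w = lie G a (lie G b w) - lie G b (lie G a w)"
        using lie_Jacobi[of a b w] lie_antisym[of u w] lie_antisym[of w a]
          linear_neg[OF linear_lie_right, of b "lie G a w"]
        by (simp add: u algebra_simps add_eq_0_iff)
      ultimately show "lie G u w \<in> stratum (Suc i + j)"
        using subspace_diff[OF subspace_stratum] by simp
    qed
  qed
qed

section \<open>Components with respect to the strata and dilations\<close>

definition comp :: "'a \<Rightarrow> nat \<Rightarrow> 'a" where
  "comp x = (THE v. v \<in> (\<Pi>\<^sub>E i\<in>{1..step G}. layer G i) \<and> x = (\<Sum>i=1..step G. v i))"

lemma comp_layer: "i \<in> {1..step G} \<Longrightarrow> comp x i \<in> layer G i"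
  and sum_comp: "(\<Sum>i=1..step G. comp x i) = x"
proof -
  have "comp x \<in> (\<Pi>\<^sub>E i\<in>{1..step G}. layer G i) \<and> x = (\<Sum>i=1..step G. comp x i)"
    using theI'[OF direct_sum[of x]] unfolding comp_def[symmetric] .
  then show "i \<in> {1..step G} \<Longrightarrow> comp x i \<in> layer G i" "(\<Sum>i=1..step G. comp x i) = x"
    by (auto dest: PiE_mem)
qed

lemma comp_unique:
  assumes v: "\<And>i. i \<in> {1..step G} \<Longrightarrow> v i \<in> layer G i" and "x = (\<Sum>i=1..step G. v i)"
    and i: "i \<in> {1..step G}"
  shows "comp x i = v i"
proof -
  let ?v = "restrict v {1..step G}"
  have "comp x = ?v"
    unfolding comp_def
  proof (rule the1_equality)
    show "\<exists>!v. v \<in> (\<Pi>\<^sub>E i\<in>{1..step G}. layer G i) \<and> x = (\<Sum>i=1..step G. v i)"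
      by (rule direct_sum)
    show "?v \<in> (\<Pi>\<^sub>E i\<in>{1..step G}. layer G i) \<and> x = (\<Sum>i=1..step G. ?v i)"
      using assms by (auto simp: restrict_PiE_iff)
  qed
  then show ?thesis
    using i by simp
qed

lemma linear_comp:
  assumes "i \<in> {1..step G}"
  shows "linear (\<lambda>x. comp x i)"
proof
  fix x y r
  show "comp (x + y) i = comp x i + comp y i"
    using assms by (intro comp_unique)
      (auto simp: sum.distrib sum_comp[simplified] intro!: subspace_add subspace_layer comp_layer)
  show "comp (r *\<^sub>R x) i = r *\<^sub>R comp x i"
    using assms by (intro comp_unique)
      (auto simp: scaleR_sum_right[symmetric] sum_comp[simplified] intro!: subspace_scale subspace_layer comp_layer)
qed

definition dil :: "real \<Rightarrow> 'a \<Rightarrow> 'a" where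
  "dil r x = (\<Sum>i=1..step G. r ^ i *\<^sub>R comp x i)"

lemma linear_dil: "linear (dil r)"
  unfolding dil_def[abs_def]
  by (intro linear_compose_sum ballI linear_compose_scale_right linear_comp)

lemma dil_stratum:
  assumes "x \<in> stratum i"
  shows "dil r x = r ^ i *\<^sub>R x"
proof (cases "i \<in> {1..step G}")
  case True
  have "comp x j = (if j = i then x else 0)" if "j \<in> {1..step G}" for j
    using True assms that
    by (intro comp_unique) (auto simp: stratum_def subspace_0 subspace_layer)
  then have "dil r x = (\<Sum>j=1..step G. if j = i then r ^ i *\<^sub>R x else 0)"
    unfolding dil_def by (intro sum.cong) auto
  then show ?thesis
    using True by simp
next
  case False
  then show ?thesis
    using assms linear_0[OF linear_dil] unfolding stratum_def by (simp only: if_False singleton_iff scaleR_zero_right)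
qed

lemma comp_dil: "i \<in> {1..step G} \<Longrightarrow> comp (dil r x) i = r ^ i *\<^sub>R comp x i"
  unfolding dil_def by (intro comp_unique) (auto intro!: subspace_scale subspace_layer comp_layer)

lemma dil_dil: "dil r (dil s x) = dil (r * s) x"
  unfolding dil_def[of r] dil_def[of "r * s"] by (intro sum.cong) (auto simp: comp_dil power_mult_distrib)

lemma dil_1 [simp]: "dil 1 x = x"
  by (simp add: dil_def sum_comp[simplified])

lemma dil_inverse: "r \<noteq> 0 \<Longrightarrow> dil r (dil (inverse r) x) = x" "r \<noteq> 0 \<Longrightarrow> dil (inverse r) (dil r x) = x"
  by (simp_all add: dil_dil)

text \<open>By \<open>lie_stratum\<close> the bracket of components of degree \<open>i\<close> and
  \<open>j\<close> has degree \<open>i + j\<close>, and the weights multiply accordingly.\<close>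

lemma lie_dil: "lie G (dil r v) (dil r w) = dil r (lie G v w)"
proof -
  have lie_sum: "lie G (\<Sum>i=1..step G. a i) (\<Sum>j=1..step G. b j) =
      (\<Sum>i=1..step G. \<Sum>j=1..step G. lie G (a i) (b j))" for a b :: "nat \<Rightarrow> 'a"
    using linear_sum[OF linear_lie_left, of a "{1..step G}"]
    by (simp add: linear_sum[OF linear_lie_right]) (rule sum.swap)
  have "dil r (lie G v w) = dil r (\<Sum>i=1..step G. \<Sum>j=1..step G. lie G (comp v i) (comp w j))"
    using lie_sum[of "comp v" "comp w"] by (simp only: sum_comp)
  also have "\<dots> = (\<Sum>i=1..step G. \<Sum>j=1..step G. dil r (lie G (comp v i) (comp w j)))"
    by (simp add: linear_sum[OF linear_dil])
  also have "\<dots> = (\<Sum>i=1..step G. \<Sum>j=1..step G. lie G (r ^ i *\<^sub>R comp v i) (r ^ j *\<^sub>R comp w j))"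
  proof (intro sum.cong refl)
    fix i j
    assume ij: "i \<in> {1..step G}" "j \<in> {1..step G}"
    then have "lie G (comp v i) (comp w j) \<in> stratum (i + j)"
      by (intro lie_stratum) (auto simp: stratum_def comp_layer)
    then show "dil r (lie G (comp v i) (comp w j)) = lie G (r ^ i *\<^sub>R comp v i) (r ^ j *\<^sub>R comp w j)"
      using linear_cmul[OF linear_lie_left, of "r ^ i" "comp v i"]
      by (simp add: dil_stratum linear_cmul[OF linear_lie_right] power_add mult.commute)
  qed
  also have "\<dots> = lie G (dil r v) (dil r w)"
    unfolding dil_def by (rule lie_sum[symmetric])
  finally show ?thesis by simp
qed

lemma dil_mul: "dil r (x \<odot> y) = dil r x \<odot> dil r y"
  by (rule lie_hom_imp_group_hom[OF linear_dil lie_dil])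

lemma dil_lfield: "dil r (lfield G v x) = lfield G (dil r v) (dil r x)"
  by (rule lfield_hom[OF linear_dil lie_dil])

lemma dil_tendsto_0: "((\<lambda>r. dil r x) \<longlongrightarrow> 0) (at 0)"
proof -
  have "((\<lambda>r. \<Sum>i=1..step G. r ^ i *\<^sub>R comp x i) \<longlongrightarrow> (\<Sum>i=1..step G. 0 ^ i *\<^sub>R comp x i)) (at 0)"
    by (intro tendsto_intros)
  also have "(\<Sum>i=1..step G. (0::real) ^ i *\<^sub>R comp x i) = 0"
    by (intro sum.neutral) auto
  finally show ?thesis
    by (simp add: dil_def)
qed

end

section \<open>Change of variables on Euclidean spaces\<close>

text \<open>The change of variables theorem of the library is about \<open>real ^ 'n\<close>; the type of basis vectors
  serves as index type.\<close>

typedef (overloaded) ('a::euclidean_space) basis_index = "Basis :: 'a set"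
  using nonempty_Basis by blast

text \<open>An arbitrary enumeration of the basis. It supplies the well-order on the index type
  under which the change of variables theorem is stated.\<close>

definition basis_enum :: "'a::euclidean_space \<Rightarrow> nat" where
  "basis_enum = (SOME f. inj_on f Basis)"

lemma inj_basis_enum: "inj_on (basis_enum :: 'a::euclidean_space \<Rightarrow> nat) Basis"
proof -
  have "\<exists>f :: 'a \<Rightarrow> nat. inj_on f Basis"
    using finite_imp_inj_to_nat_seg[OF finite_Basis] by blast
  then show ?thesis
    unfolding basis_enum_def by (rule someI_ex)
qed

lemma range_Rep_basis_index: "range (Rep_basis_index :: 'a::euclidean_space basis_index \<Rightarrow> 'a) = Basis"
  by (rule type_definition.Rep_range[OF type_definition_basis_index])

instance basis_index :: (euclidean_space) finite
proof
  show "finite (UNIV :: 'a basis_index set)"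
    using finite_imageI[OF finite_Basis, of "Abs_basis_index :: 'a \<Rightarrow> _"]
      type_definition.Abs_image[OF type_definition_basis_index[where 'a='a]]
    by metis
qed

instantiation basis_index :: (euclidean_space) wellorder
begin

definition "i \<le> j \<longleftrightarrow> basis_enum (Rep_basis_index i) \<le> basis_enum (Rep_basis_index j)"
definition "i < j \<longleftrightarrow> basis_enum (Rep_basis_index i) < basis_enum (Rep_basis_index j)"

instance
proof
  fix i j k :: "'a basis_index"
  show "i < j \<longleftrightarrow> i \<le> j \<and> \<not> j \<le> i"
    unfolding less_eq_basis_index_def less_basis_index_def by auto
  show "i \<le> i" "i \<le> j \<Longrightarrow> j \<le> k \<Longrightarrow> i \<le> k" "i \<le> j \<or> j \<le> i"
    unfolding less_eq_basis_index_def by auto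
  show "i \<le> j \<Longrightarrow> j \<le> i \<Longrightarrow> i = j"
    unfolding less_eq_basis_index_def
    using inj_onD[OF inj_basis_enum, of "Rep_basis_index i" "Rep_basis_index j"]
      Rep_basis_index[of i] Rep_basis_index[of j] Rep_basis_index_inject[of i j]
    by auto
next
  fix P :: "'a basis_index \<Rightarrow> bool" and i
  assume step: "\<And>i. (\<And>j. j < i \<Longrightarrow> P j) \<Longrightarrow> P i"
  show "P i"
    by (induction "basis_enum (Rep_basis_index i)" arbitrary: i rule: less_induct)
      (auto intro: step simp: less_basis_index_def)
qed

end

definition to_cart :: "'a::euclidean_space \<Rightarrow> real ^ 'a basis_index" where
  "to_cart x = (\<chi> i. x \<bullet> Rep_basis_index i)"

definition of_cart :: "real ^ 'a basis_index \<Rightarrow> 'a::euclidean_space" where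
  "of_cart y = (\<Sum>i\<in>UNIV. (y $ i) *\<^sub>R Rep_basis_index i)"

lemma sum_Rep_basis_index:
  "(\<Sum>i\<in>UNIV. f (Rep_basis_index i :: 'a::euclidean_space)) = (\<Sum>b\<in>Basis. f b)"
  using sum.reindex[of Rep_basis_index "UNIV :: 'a basis_index set" f]
  by (simp add: range_Rep_basis_index inj_def Rep_basis_index_inject o_def)

lemma prod_Rep_basis_index:
  "(\<Prod>i\<in>UNIV. f (Rep_basis_index i :: 'a::euclidean_space)) = (\<Prod>b\<in>Basis. f b)"
  using prod.reindex[of Rep_basis_index "UNIV :: 'a basis_index set" f]
  by (simp add: range_Rep_basis_index inj_def Rep_basis_index_inject o_def)

lemma of_cart_to_cart [simp]: "of_cart (to_cart x) = x"
  using sum_Rep_basis_index[of "\<lambda>b. (x \<bullet> b) *\<^sub>R b"]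
  by (simp add: of_cart_def to_cart_def euclidean_representation)

lemma Rep_basis_index_inner:
  "Rep_basis_index i \<bullet> (Rep_basis_index j :: 'a::euclidean_space) = (if i = j then 1 else 0)"
  using inner_Basis[OF Rep_basis_index Rep_basis_index, of i j] by (simp add: Rep_basis_index_inject)

lemma to_cart_of_cart [simp]: "to_cart (of_cart y) = y"
  by (simp add: vec_eq_iff to_cart_def of_cart_def inner_sum_left Rep_basis_index_inner if_distrib cong: if_cong)

lemma linear_to_cart: "linear to_cart"
  by (rule linearI) (simp_all add: to_cart_def vec_eq_iff inner_add_left)

lemma linear_of_cart: "linear of_cart"
  by (rule linearI) (simp_all add: of_cart_def scaleR_add_left sum.distrib scaleR_sum_right)

lemma to_cart_image: "to_cart ` S = of_cart -` S"
proof (rule set_eqI)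
  show "y \<in> to_cart ` S \<longleftrightarrow> y \<in> of_cart -` S" for y
    using imageI[of "of_cart y" S to_cart] by auto
qed

lemma of_cart_image: "of_cart ` S = to_cart -` S"
proof (rule set_eqI)
  show "y \<in> of_cart ` S \<longleftrightarrow> y \<in> to_cart -` S" for y
    using imageI[of "to_cart y" S of_cart] by auto
qed

lemma of_cart_vimage_box: "of_cart -` box l u = box (to_cart l) (to_cart u)"
proof -
  have "y \<in> of_cart -` box l u \<longleftrightarrow> y \<in> box (to_cart l) (to_cart u)" for y
  proof -
    have "y \<in> of_cart -` box l u \<longleftrightarrow> (\<forall>b\<in>range Rep_basis_index. l \<bullet> b < of_cart y \<bullet> b \<and> of_cart y \<bullet> b < u \<bullet> b)"
      by (simp add: mem_box range_Rep_basis_index)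
    also have "\<dots> \<longleftrightarrow> (\<forall>i. to_cart l $ i < to_cart (of_cart y) $ i \<and> to_cart (of_cart y) $ i < to_cart u $ i)"
      by (simp add: to_cart_def)
    finally show ?thesis
      by (simp add: mem_box_cart)
  qed
  then show ?thesis by blast
qed

lemma borel_measurable_of_cart: "of_cart \<in> borel_measurable borel"
  by (intro borel_measurable_continuous_onI linear_continuous_on)
     (use linear_of_cart linear_conv_bounded_linear in blast)

text \<open>Coordinates in an orthonormal basis preserve the side lengths of boxes, and the measure
  of boxes characterises \<open>lborel\<close>.\<close>

lemma lborel_distr_of_cart: "lborel = distr lborel borel (of_cart :: real ^ 'a basis_index \<Rightarrow> 'a::euclidean_space)"
proof (rule lborel_eqI)
  fix l u :: 'a
  assume le: "\<And>b. b \<in> Basis \<Longrightarrow> l \<bullet> b \<le> u \<bullet> b"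
  have "emeasure (distr lborel borel of_cart) (box l u) = emeasure lborel (box (to_cart l) (to_cart u))"
    by (simp add: emeasure_distr borel_measurable_of_cart of_cart_vimage_box)
  also have "\<dots> = ennreal (\<Prod>b\<in>Basis. (to_cart u - to_cart l) \<bullet> b)"
  proof (rule emeasure_lborel_box)
    fix b :: "real ^ 'a basis_index"
    assume "b \<in> Basis"
    then obtain i where b: "b = axis i 1"
      by (auto simp: Basis_vec_def)
    show "to_cart l \<bullet> b \<le> to_cart u \<bullet> b"
      using le[OF Rep_basis_index[of i]] by (simp add: b inner_axis to_cart_def)
  qed
  also have "(\<Prod>b\<in>Basis. (to_cart u - to_cart l) \<bullet> b) = (\<Prod>i\<in>UNIV. (to_cart u - to_cart l) \<bullet> axis i 1)"
    by (simp add: Basis_vec_def image_def[symmetric] UNION_singleton_eq_range)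
       (rule prod.reindex_cong[of "\<lambda>i. axis i 1"], auto simp: inj_on_def axis_eq_axis)
  also have "\<dots> = (\<Prod>i\<in>UNIV. (u - l) \<bullet> Rep_basis_index i)"
    by (simp add: inner_axis to_cart_def inner_diff_left)
  also have "\<dots> = (\<Prod>b\<in>Basis. (u - l) \<bullet> b)"
    by (rule prod_Rep_basis_index)
  finally show "emeasure (distr lborel borel of_cart) (box l u) = ennreal (\<Prod>b\<in>Basis. (u - l) \<bullet> b)" .
qed simp

lemma to_cart_image_borel:
  assumes "S \<in> sets borel"
  shows "to_cart ` S \<in> sets borel" "emeasure lborel (to_cart ` S) = emeasure lborel S"
proof -
  show "to_cart ` S \<in> sets borel"
    using measurable_sets[OF borel_measurable_of_cart assms] by (simp add: to_cart_image)
  show "emeasure lborel (to_cart ` S) = emeasure lborel S"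
    using assms by (subst (2) lborel_distr_of_cart)
      (simp add: emeasure_distr borel_measurable_of_cart to_cart_image)
qed

text \<open>The Borel case passes to the completion, a Lebesgue set being the union of a Borel set
  and a subset of a Borel null set.\<close>

lemma to_cart_image_lebesgue:
  assumes "S \<in> sets lebesgue"
  shows "to_cart ` S \<in> sets lebesgue" "emeasure lebesgue (to_cart ` S) = emeasure lebesgue S"
proof -
  from assms obtain A N N' where S: "S = A \<union> N" "N \<subseteq> N'" "N' \<in> null_sets lborel" "A \<in> sets lborel"
    by (rule sets_completionE)
  have "to_cart ` N' \<in> null_sets lborel"
    using S(3) to_cart_image_borel[of N'] by (simp add: null_sets_def)
  then have N: "to_cart ` N \<in> null_sets lebesgue"
    using S(2) by (meson image_mono null_sets_completion_subset null_sets_completionI)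
  have A: "to_cart ` A \<in> sets lborel"
    using to_cart_image_borel(1) S(4) by simp
  have eq: "to_cart ` S = to_cart ` A \<union> to_cart ` N"
    using S(1) by blast
  show "to_cart ` S \<in> sets lebesgue"
    unfolding eq using A N by auto
  have N0: "N \<in> null_sets lebesgue"
    using S(2,3) by (meson null_sets_completion_subset null_sets_completionI)
  have "emeasure lebesgue (to_cart ` S) = emeasure lebesgue (to_cart ` A)"
    unfolding eq using A N by (intro emeasure_Un_null_set) auto
  also have "\<dots> = emeasure lebesgue A"
    using A S(4) to_cart_image_borel(2)[of A] by simp
  also have "\<dots> = emeasure lebesgue S"
    unfolding S(1) using S(4) N0 by (intro emeasure_Un_null_set[symmetric]) auto
  finally show "emeasure lebesgue (to_cart ` S) = emeasure lebesgue S" .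
qed

lemma of_cart_image_lmeasurable:
  assumes "to_cart ` S \<in> lmeasurable"
  shows "S \<in> lmeasurable" "measure lebesgue S = measure lebesgue (to_cart ` S)"
proof -
  have bl: "bounded_linear (of_cart :: real ^ 'a basis_index \<Rightarrow> 'a)"
    using linear_of_cart linear_conv_bounded_linear by blast
  from fmeasurableD[OF assms] obtain A N N' where
    S: "to_cart ` S = A \<union> N" "N \<subseteq> N'" "N' \<in> null_sets lborel" "A \<in> sets lborel"
    by (rule sets_completionE)
  have meas: "of_cart ` B \<in> sets borel" if "B \<in> sets borel" for B :: "(real ^ 'a basis_index) set"
  proof -
    have "to_cart \<in> borel_measurable (borel :: 'a measure)"
      by (intro borel_measurable_continuous_onI linear_continuous_on)
         (use linear_to_cart linear_conv_bounded_linear in blast)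
    then show ?thesis
      using measurable_sets[of to_cart borel borel B] that by (simp add: of_cart_image)
  qed
  have inverse_image: "to_cart ` of_cart ` B = B" for B :: "(real ^ 'a basis_index) set"
    by (simp add: image_image)
  have "of_cart ` N' \<in> null_sets lborel"
    using S(3) meas[of N'] to_cart_image_borel(2)[of "of_cart ` N'"] by (auto simp: null_sets_def inverse_image)
  then have "of_cart ` N \<in> null_sets lebesgue"
    using S(2) by (meson image_mono null_sets_completion_subset null_sets_completionI)
  moreover have "of_cart ` A \<in> sets lebesgue"
    using meas S(4) by simp
  moreover have "S = of_cart ` A \<union> of_cart ` N"
    using arg_cong[OF S(1), of "image of_cart"] by (simp add: image_image image_Un)
  ultimately have *: "S \<in> sets lebesgue"
    by auto
  show "S \<in> lmeasurable" "measure lebesgue S = measure lebesgue (to_cart ` S)"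
    using assms to_cart_image_lebesgue(2)[OF *] * by (auto simp: fmeasurable_def measure_def)
qed

definition jacobian :: "('a::euclidean_space \<Rightarrow> 'a) \<Rightarrow> real" where
  "jacobian A = det (matrix (\<lambda>y. to_cart (A (of_cart y))))"

lemma jacobian_compose:
  assumes "linear A" "linear B"
  shows "jacobian (\<lambda>x. A (B x)) = jacobian A * jacobian B"
proof -
  have lin: "linear (\<lambda>y. to_cart (C (of_cart y)))" if "linear C" for C :: "'a \<Rightarrow> 'a"
    using linear_compose[OF linear_compose[OF linear_of_cart that] linear_to_cart] by (simp add: o_def)
  have "matrix (\<lambda>y. to_cart (A (B (of_cart y)))) =
      matrix (\<lambda>y. to_cart (A (of_cart y))) ** matrix (\<lambda>y. to_cart (B (of_cart y)))"
    using matrix_compose[OF lin[OF assms(2)] lin[OF assms(1)]] by (simp add: o_def)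
  then show ?thesis
    by (simp add: jacobian_def det_mul)
qed

lemma jacobian_ident: "jacobian (\<lambda>x. x) = 1"
  using matrix_id by (simp add: jacobian_def id_def)

text \<open>The determinant is a polynomial in the matrix entries, so convergence on each single
  vector suffices.\<close>

lemma tendsto_jacobian:
  assumes "\<And>b. ((\<lambda>x. A x b) \<longlongrightarrow> B b) F"
  shows "((\<lambda>x. jacobian (A x)) \<longlongrightarrow> jacobian B) F"
  unfolding jacobian_def det_def matrix_def to_cart_def
  by (auto intro!: tendsto_intros assms)

text \<open>With a Jacobian of constant modulus the integral in the change of variables formula is a
  multiple of the measure. Left translations and dilations are of this kind.\<close>

lemma measure_image_jacobian_const:
  fixes f :: "'a::euclidean_space \<Rightarrow> 'a"
  assumes S: "S \<in> lmeasurable" and der: "\<And>x. (f has_derivative f' x) (at x)"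
    and inj: "inj f" and jac: "\<And>x. \<bar>jacobian (f' x)\<bar> = k"
  shows "f ` S \<in> lmeasurable" "measure lebesgue (f ` S) = k * measure lebesgue S"
proof -
  let ?g = "\<lambda>y. to_cart (f (of_cart y))" and ?S = "to_cart ` S"
  have S': "?S \<in> lmeasurable" "measure lebesgue ?S = measure lebesgue S"
    using S to_cart_image_lebesgue[of S] by (auto simp: fmeasurable_def measure_def)
  have bl: "bounded_linear (of_cart :: _ \<Rightarrow> 'a)" "bounded_linear (to_cart :: 'a \<Rightarrow> _)"
    using linear_of_cart linear_to_cart linear_conv_bounded_linear by blast+
  have der': "(?g has_derivative (\<lambda>v. to_cart (f' (of_cart y) (of_cart v)))) (at y within ?S)" for y
    by (rule bounded_linear.has_derivative[OF bl(2)],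
        rule has_derivative_compose[OF bounded_linear.has_derivative[OF bl(1) has_derivative_ident] der])
  have inj': "inj_on ?g ?S"
    using inj by (auto simp: inj_on_def inj_def) (metis of_cart_to_cart)
  have int: "((\<lambda>y. \<bar>det (matrix (\<lambda>v. to_cart (f' (of_cart y) (of_cart v))))\<bar>) has_integral k * measure lebesgue S) ?S"
    using has_integral_mult_right[OF S'(1)[THEN lmeasurable_iff_has_integral[THEN iffD1]], of k]
    by (subst has_integral_restrict_UNIV[symmetric])
       (simp add: jac[unfolded jacobian_def] S'(2) indicator_def of_bool_def if_distrib cong: if_cong)
  have "?g ` ?S \<in> lmeasurable \<and> measure lebesgue (?g ` ?S) = k * measure lebesgue S"
    by (rule has_measure_differentiable_image[OF fmeasurableD[OF S'(1)] der' inj', THEN iffD2, OF int])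
  moreover have "?g ` ?S = to_cart ` f ` S"
    by (simp add: image_image)
  ultimately show "f ` S \<in> lmeasurable" "measure lebesgue (f ` S) = k * measure lebesgue S"
    using of_cart_image_lmeasurable[of "f ` S"] by simp_all
qed

section \<open>Invariance of Lebesgue measure\<close>

context carnot_group
begin

interpretation grp: Groups.group "gmul G" 0 uminus
  by (rule group_law)

lemma jacobian_dil: "r \<noteq> 0 \<Longrightarrow> jacobian (dil r) \<noteq> 0"
  using jacobian_compose[OF linear_dil linear_dil, of r "inverse r"] jacobian_ident[where 'a = 'a]
  by (auto simp: dil_inverse)

lemma dil_has_derivative: "(dil r has_derivative dil r) (at x)"
  using linear_dil linear_imp_has_derivative by blast

lemma dil_DL: "dil r (DL x y v) = DL (dil r x) (dil r y) (dil r v)"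
proof -
  have "((\<lambda>y. dil r (x \<odot> y)) has_derivative (\<lambda>v. dil r (DL x y v))) (at y)"
    by (rule has_derivative_compose[OF DL_has_derivative dil_has_derivative])
  moreover have "((\<lambda>y. dil r x \<odot> dil r y) has_derivative (\<lambda>v. DL (dil r x) (dil r y) (dil r v))) (at y)"
    by (rule has_derivative_compose[OF dil_has_derivative DL_has_derivative])
  ultimately show ?thesis
    unfolding dil_mul using has_derivative_unique by metis
qed

text \<open>By dilation invariance and continuity it suffices to know the Jacobian at the identity.\<close>

lemma jacobian_DL: "jacobian (DL x y) = 1"
proof -
  \<comment> \<open>Differentiating \<open>dil_mul\<close> conjugates \<open>DL x y\<close> into the
    derivative at the dilated points, and the determinant of the dilation cancels.\<close>
  have const: "jacobian (DL (dil r x) (dil r y)) = jacobian (DL x y)" if "r \<noteq> 0" for r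
  proof -
    have "jacobian (\<lambda>v. dil r (DL x y v)) = jacobian (\<lambda>v. DL (dil r x) (dil r y) (dil r v))"
      by (simp add: dil_DL)
    then show ?thesis
      using jacobian_dil[OF that]
      by (simp add: jacobian_compose[OF linear_dil linear_DL] jacobian_compose[OF linear_DL linear_dil])
  qed
  have lim0: "((\<lambda>r. jacobian (DL (dil r x) (dil r y))) \<longlongrightarrow> jacobian (DL 0 0)) (at 0)"
  proof (rule tendsto_jacobian)
    fix b
    let ?D = "\<lambda>p. frechet_derivative (\<lambda>(x, y). gmul G x y) (at p) (0, b)"
    have "isCont ?D (0, 0)"
      using smooth_continuous_on[OF smooth_directional[OF smooth_mul], of UNIV]
      by (simp add: continuous_on_eq_continuous_at)
    moreover have "((\<lambda>r. (dil r x, dil r y)) \<longlongrightarrow> (0, 0)) (at 0)"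
      by (intro tendsto_Pair dil_tendsto_0)
    ultimately have "((\<lambda>r. ?D (dil r x, dil r y)) \<longlongrightarrow> ?D (0, 0)) (at 0)"
      by (rule isCont_tendsto_compose)
    then show "((\<lambda>r. DL (dil r x) (dil r y) b) \<longlongrightarrow> DL 0 0 b) (at 0)"
      by (simp add: smooth_lmul'(2)[OF smooth_mul])
  qed
  have lim: "((\<lambda>r. jacobian (DL (dil r x) (dil r y))) \<longlongrightarrow> jacobian (DL x y)) (at 0)"
    by (rule tendsto_eventually) (auto simp: eventually_at_filter const intro: always_eventually)
  have "jacobian (DL 0 0) = 1"
    using jacobian_ident by (simp add: jacobian_def)
  then show ?thesis
    using tendsto_unique[OF trivial_limit_at lim lim0] by simp
qed

lemma measure_lmul:
  assumes "S \<in> lmeasurable"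
  shows "gmul G x ` S \<in> lmeasurable" "measure lebesgue (gmul G x ` S) = measure lebesgue S"
proof -
  have "inj (gmul G x)"
    by (rule injI) (metis grp.left_cancel)
  from measure_image_jacobian_const[OF assms DL_has_derivative this, of 1]
  show "gmul G x ` S \<in> lmeasurable" "measure lebesgue (gmul G x ` S) = measure lebesgue S"
    by (simp_all add: jacobian_DL)
qed

lemma measure_dil:
  assumes "S \<in> lmeasurable" "r \<noteq> 0"
  shows "dil r ` S \<in> lmeasurable" "measure lebesgue (dil r ` S) = \<bar>jacobian (dil r)\<bar> * measure lebesgue S"
proof -
  have "inj (dil r)"
    by (metis dil_inverse(2)[OF assms(2)] injI)
  from measure_image_jacobian_const[OF assms(1) dil_has_derivative this]
  show "dil r ` S \<in> lmeasurable" "measure lebesgue (dil r ` S) = \<bar>jacobian (dil r)\<bar> * measure lebesgue S"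
    by simp_all
qed

end

section \<open>Horizontal curves\<close>

lemma nn_integral_lower_measurable:
  fixes f :: "'x \<Rightarrow> ennreal"
  obtains h where "h \<in> borel_measurable M" "h \<le> f" "integral\<^sup>N M h = integral\<^sup>N M f"
proof -
  let ?A = "{g. simple_function M g \<and> g \<le> f}"
  have "(\<lambda>_. 0) \<in> ?A"
    by (auto simp: le_fun_def)
  then obtain F :: "nat \<Rightarrow> ennreal" where
    F: "range F \<subseteq> integral\<^sup>S M ` ?A" "Sup (integral\<^sup>S M ` ?A) = Sup (range F)"
    using ennreal_SUP_countable_SUP[of ?A "integral\<^sup>S M"] by blast
  then have "\<forall>n. \<exists>g\<in>?A. F n = integral\<^sup>S M g"
    by blast
  then obtain g where g: "\<And>n. simple_function M (g n)" "\<And>n. g n \<le> f" "\<And>n. F n = integral\<^sup>S M (g n)"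
    by (metis (mono_tags, lifting) mem_Collect_eq)
  define h where "h x = (SUP n. g n x)" for x
  have h_meas: "h \<in> borel_measurable M"
    unfolding h_def[abs_def] using g(1) by (intro borel_measurable_SUP borel_measurable_simple_function) auto
  have h_le: "h \<le> f"
    unfolding h_def le_fun_def using g(2) by (auto intro!: SUP_least simp: le_fun_def)
  have "integral\<^sup>N M f = (SUP n. integral\<^sup>S M (g n))"
    unfolding nn_integral_def F(2) using g(3) by simp
  also have "\<dots> \<le> integral\<^sup>N M h"
    unfolding h_def
    by (intro SUP_least) (auto simp: nn_integral_eq_simple_integral[symmetric] g(1) intro!: nn_integral_mono SUP_upper)
  finally have "integral\<^sup>N M f \<le> integral\<^sup>N M h" .
  moreover have "integral\<^sup>N M h \<le> integral\<^sup>N M f"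
    using h_le by (intro nn_integral_mono) (auto simp: le_fun_def)
  ultimately show ?thesis
    using that h_meas h_le by (simp add: antisym)
qed

text \<open>\<open>F\<close> may fail to be measurable. A measurable minorant of the left integrand
  is carried back by the inverse affine map, divided by the modulus of \<open>m\<close>, to a
  function below \<open>F\<close>; the substitution rule is applied to that function.\<close>

lemma nn_integral_affine_le:
  fixes F :: "real \<Rightarrow> ennreal"
  assumes "m \<noteq> 0"
  shows "(\<integral>\<^sup>+t. ennreal \<bar>m\<bar> * F (m * t + b) \<partial>lebesgue) \<le> (\<integral>\<^sup>+t. F t \<partial>lebesgue)"
proof -
  obtain h where h: "h \<in> borel_measurable lebesgue" "h \<le> (\<lambda>t. ennreal \<bar>m\<bar> * F (m * t + b))"
    "(\<integral>\<^sup>+t. h t \<partial>lebesgue) = (\<integral>\<^sup>+t. ennreal \<bar>m\<bar> * F (m * t + b) \<partial>lebesgue)"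
    using nn_integral_lower_measurable by blast
  have "h ((- b / m) + (1 / m) * s) / ennreal \<bar>m\<bar> \<le> F s" for s
  proof -
    have "h ((- b / m) + (1 / m) * s) \<le> ennreal \<bar>m\<bar> * F s"
      using le_funD[OF h(2), of "(- b / m) + (1 / m) * s"] assms by (simp add: field_simps)
    then have "h ((- b / m) + (1 / m) * s) / ennreal \<bar>m\<bar> \<le> (ennreal \<bar>m\<bar> * F s) / ennreal \<bar>m\<bar>"
      by (rule divide_right_mono_ennreal)
    also have "\<dots> = F s"
      using assms by (simp add: ennreal_mult_divide_eq mult.commute)
    finally show ?thesis .
  qed
  then have "(\<integral>\<^sup>+s. h ((- b / m) + (1 / m) * s) * ennreal (1 / \<bar>m\<bar>) \<partial>lebesgue) \<le> (\<integral>\<^sup>+s. F s \<partial>lebesgue)"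
    using assms by (intro nn_integral_mono) (simp add: divide_ennreal_def inverse_ennreal inverse_eq_divide)
  moreover have "(\<lambda>s. h ((- b / m) + (1 / m) * s)) \<in> borel_measurable lebesgue"
    using measurable_compose[OF lebesgue_affine_measurable[where c = "\<lambda>_::real. 1 / m" and t = "- b / m"] h(1)] assms
    by simp
  then have "(\<integral>\<^sup>+s. h ((- b / m) + (1 / m) * s) * ennreal (1 / \<bar>m\<bar>) \<partial>lebesgue) =
      ennreal (1 / \<bar>m\<bar>) * (\<integral>\<^sup>+s. h ((- b / m) + (1 / m) * s) \<partial>lebesgue)"
    by (simp add: nn_integral_cmult mult.commute)
  moreover have "(\<integral>\<^sup>+t. h t \<partial>lebesgue) = ennreal \<bar>1 / m\<bar> * (\<integral>\<^sup>+s. h ((- b / m) + (1 / m) * s) \<partial>lebesgue)"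
    using assms by (intro nn_integral_real_affine_lebesgue h(1)) auto
  ultimately show ?thesis
    using h(3) by simp
qed

lemma AE_lebesgue_affine:
  fixes P :: "real \<Rightarrow> bool"
  assumes "AE t in lebesgue. P t" "m \<noteq> 0"
  shows "AE t in lebesgue. P (m * t + b)"
proof -
  from assms(1) obtain N where N: "N \<in> null_sets lebesgue" "{t. \<not> P t} \<subseteq> N"
    by (auto simp: eventually_ae_filter)
  have "((\<lambda>s. (s - b) / m) has_real_derivative 1 / m) (at s within N)" for s
    using assms(2) by (auto intro!: derivative_eq_intros)
  then have "(\<lambda>s. (s - b) / m) differentiable_on N"
    unfolding differentiable_on_def real_differentiable_def by blast
  then have "negligible ((\<lambda>s. (s - b) / m) ` N)"
    using N(1) by (intro negligible_differentiable_image_negligible) (auto simp: negligible_iff_null_sets)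
  moreover have "{t. \<not> P (m * t + b)} \<subseteq> (\<lambda>s. (s - b) / m) ` N"
  proof
    fix t
    assume "t \<in> {t. \<not> P (m * t + b)}"
    then have "m * t + b \<in> N"
      using N(2) by blast
    then show "t \<in> (\<lambda>s. (s - b) / m) ` N"
      using assms(2) by (intro image_eqI[of _ _ "m * t + b"]) auto
  qed
  ultimately show ?thesis
    unfolding eventually_ae_filter negligible_iff_null_sets by auto
qed

text \<open>Absolute continuity on an interval, stated with pairs of endpoints instead of divisions; this
  form is stable under monotone Lipschitz reparametrizations.\<close>

definition nonoverlapping :: "(real \<times> real) set \<Rightarrow> bool" where
  "nonoverlapping P \<longleftrightarrow> finite P \<and> (\<forall>(a, b)\<in>P. a < b) \<and>
     (\<forall>(a, b)\<in>P. \<forall>(a', b')\<in>P. (a, b) \<noteq> (a', b') \<longrightarrow> b \<le> a' \<or> b' \<le> a)"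

lemma nonoverlappingD:
  assumes "nonoverlapping P" "(a, b) \<in> P" "(a', b') \<in> P" "(a, b) \<noteq> (a', b')"
  shows "b \<le> a' \<or> b' \<le> a"
  using assms unfolding nonoverlapping_def by fastforce

definition pair_sum :: "(real \<times> real) set \<Rightarrow> real" where
  "pair_sum P = (\<Sum>(a, b)\<in>P. b - a)"

definition pair_variation :: "(real \<Rightarrow> 'a::real_normed_vector) \<Rightarrow> (real \<times> real) set \<Rightarrow> real" where
  "pair_variation c P = (\<Sum>(a, b)\<in>P. norm (c b - c a))"

lemma abs_cont_on_pairs:
  "abs_cont_on {l..u} c \<longleftrightarrow> (\<forall>\<epsilon>>0. \<exists>\<delta>>0. \<forall>P. nonoverlapping P \<longrightarrow> P \<subseteq> {l..u} \<times> {l..u} \<longrightarrow>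
     pair_sum P < \<delta> \<longrightarrow> pair_variation c P < \<epsilon>)" (is "_ \<longleftrightarrow> ?R")
proof
  assume ac: "abs_cont_on {l..u} c"
  show ?R
  proof (intro allI impI)
    fix \<epsilon> :: real
    assume "0 < \<epsilon>"
    with ac obtain \<delta> where "0 < \<delta>" and \<delta>: "\<And>D S. D division_of S \<Longrightarrow> S \<subseteq> {l..u} \<Longrightarrow>
        (\<Sum>k\<in>D. Sup k - Inf k) < \<delta> \<Longrightarrow> (\<Sum>k\<in>D. norm (c (Sup k) - c (Inf k))) < \<epsilon>"
      unfolding abs_cont_on_def by blast
    have "pair_variation c P < \<epsilon>"
      if P: "nonoverlapping P" "P \<subseteq> {l..u} \<times> {l..u}" "pair_sum P < \<delta>" for P
    proof -
      let ?f = "\<lambda>(a, b). {a..b :: real}"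
      have lt: "a < b" if "(a, b) \<in> P" for a b
        using P(1) that by (auto simp: nonoverlapping_def)
      have inj: "inj_on ?f P"
        by (rule inj_onI) (use lt in \<open>force simp: Icc_eq_Icc dest: less_imp_le\<close>)
      have "?f ` P division_of \<Union>(?f ` P)"
      proof (rule division_ofI)
        show "finite (?f ` P)"
          using P(1) by (simp add: nonoverlapping_def)
        fix k assume k: "k \<in> ?f ` P"
        then obtain a b where ab: "(a, b) \<in> P" "k = {a..b}" by auto
        show "k \<subseteq> \<Union> (?f ` P)" using k by blast
        show "k \<noteq> {}" using ab lt by force
        show "\<exists>a b. k = cbox a b" using ab by auto
        fix k' assume k': "k' \<in> ?f ` P" "k \<noteq> k'"
        then obtain a' b' where ab': "(a', b') \<in> P" "k' = {a'..b'}" by auto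
        have "b \<le> a' \<or> b' \<le> a"
          by (rule nonoverlappingD[OF P(1) ab(1) ab'(1)]) (use ab(2) ab'(2) k'(2) in auto)
        then show "interior k \<inter> interior k' = {}"
          unfolding ab(2) ab'(2) by auto
      qed simp
      moreover have "\<Union>(?f ` P) \<subseteq> {l..u}"
        using P(2) by force
      moreover have "(\<Sum>k\<in>?f ` P. Sup k - Inf k) = pair_sum P"
        unfolding pair_sum_def sum.reindex[OF inj] by (rule sum.cong) (use lt in \<open>force+\<close>)
      moreover have "(\<Sum>k\<in>?f ` P. norm (c (Sup k) - c (Inf k))) = pair_variation c P"
        unfolding pair_variation_def sum.reindex[OF inj] by (rule sum.cong) (use lt in \<open>force+\<close>)
      ultimately show ?thesis
        using \<delta>[of "?f ` P" "\<Union>(?f ` P)"] P(3) by simp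
    qed
    with \<open>0 < \<delta>\<close> show "\<exists>\<delta>>0. \<forall>P. nonoverlapping P \<longrightarrow> P \<subseteq> {l..u} \<times> {l..u} \<longrightarrow>
     pair_sum P < \<delta> \<longrightarrow> pair_variation c P < \<epsilon>" by blast
  qed
next
  assume R: ?R
  show "abs_cont_on {l..u} c"
    unfolding abs_cont_on_def
  proof (intro allI impI)
    fix \<epsilon> :: real
    assume "0 < \<epsilon>"
    from R[rule_format, OF this]
    obtain \<delta> where "0 < \<delta>" and \<delta>: "\<And>P. nonoverlapping P \<Longrightarrow> P \<subseteq> {l..u} \<times> {l..u} \<Longrightarrow>
        pair_sum P < \<delta> \<Longrightarrow> pair_variation c P < \<epsilon>"
      by blast
    have "(\<Sum>k\<in>D. norm (c (Sup k) - c (Inf k))) < \<epsilon>"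
      if D: "D division_of S" "S \<subseteq> {l..u}" "(\<Sum>k\<in>D. Sup k - Inf k) < \<delta>" for D S
    proof -
      \<comment> \<open>Degenerate intervals of the division are dropped: they violate the strict
        order of endpoints asked of pairs, and add nothing to either sum.\<close>
      let ?D = "{k \<in> D. Inf k < Sup k}" and ?f = "\<lambda>k :: real set. (Inf k, Sup k)"
      have fin: "finite D"
        using D(1) by blast
      have k: "k = {Inf k..Sup k} \<and> Inf k \<le> Sup k \<and> k \<subseteq> {l..u}" if kD: "k \<in> D" for k
      proof -
        obtain a b where ab: "k = cbox a b"
          using division_ofD(4)[OF D(1) kD] by blast
        moreover have "k \<noteq> {}" "k \<subseteq> S"
          using division_ofD(2,3)[OF D(1) kD] by blast+
        ultimately show ?thesis
          using D(2) by (simp add: subset_iff)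
      qed
      have inj: "inj_on ?f ?D"
      proof (rule inj_onI)
        fix k k'
        assume kk: "k \<in> ?D" "k' \<in> ?D" and eq: "?f k = ?f k'"
        have "k = {Inf k..Sup k}" using k kk(1) by blast
        also have "\<dots> = {Inf k'..Sup k'}" using eq by simp
        also have "\<dots> = k'" using k kk(2) by blast
        finally show "k = k'" .
      qed
      have "nonoverlapping (?f ` ?D)"
        unfolding nonoverlapping_def
      proof (intro conjI)
        show "finite (?f ` ?D)" using fin by simp
        show "\<forall>(a, b)\<in>?f ` ?D. a < b" by auto
        have "Sup k \<le> Inf k' \<or> Sup k' \<le> Inf k" if kk: "k \<in> ?D" "k' \<in> ?D" "k \<noteq> k'" for k k'
        proof (rule ccontr)
          assume "\<not> ?thesis"
          then have lt: "max (Inf k) (Inf k') < min (Sup k) (Sup k')"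
            using kk by auto
          have int: "interior j = {Inf j<..<Sup j}" if "j \<in> D" for j
            using k[OF that] interior_atLeastAtMost_real[of "Inf j" "Sup j"] by argo
          have "interior k = {Inf k<..<Sup k}" "interior k' = {Inf k'<..<Sup k'}"
            using kk by (auto intro!: int)
          moreover have "interior k \<inter> interior k' = {}"
            using division_ofD(5)[OF D(1)] kk by blast
          moreover obtain x where "max (Inf k) (Inf k') < x" "x < min (Sup k) (Sup k')"
            using lt dense by blast
          ultimately show False by auto
        qed
        then show "\<forall>(a, b)\<in>?f ` ?D. \<forall>(a', b')\<in>?f ` ?D. (a, b) \<noteq> (a', b') \<longrightarrow> b \<le> a' \<or> b' \<le> a"
          by fastforce
      qed
      moreover have "?f ` ?D \<subseteq> {l..u} \<times> {l..u}"
      proof -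
        have "Inf k \<in> {l..u} \<and> Sup k \<in> {l..u}" if "k \<in> ?D" for k
        proof -
          have "Inf k \<in> {Inf k..Sup k}" "Sup k \<in> {Inf k..Sup k}"
            using that by auto
          then show ?thesis
            using k[of k] that by blast
        qed
        then show ?thesis by blast
      qed
      moreover have "pair_sum (?f ` ?D) = (\<Sum>k\<in>D. Sup k - Inf k)"
        unfolding pair_sum_def sum.reindex[OF inj] using k
        by (simp add: o_def) (rule sum.mono_neutral_left[OF fin], auto intro: antisym)
      moreover have "pair_variation c (?f ` ?D) = (\<Sum>k\<in>D. norm (c (Sup k) - c (Inf k)))"
      proof -
        have "(\<Sum>k\<in>?D. norm (c (Sup k) - c (Inf k))) = (\<Sum>k\<in>D. norm (c (Sup k) - c (Inf k)))"
        proof (rule sum.mono_neutral_left[OF fin])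
          show "\<forall>k\<in>D - ?D. norm (c (Sup k) - c (Inf k)) = 0"
          proof
            fix i assume i: "i \<in> D - ?D"
            then have "Inf i = Sup i"
              using k[of i] by auto
            then show "norm (c (Sup i) - c (Inf i)) = 0" by simp
          qed
        qed auto
        then show ?thesis
          unfolding pair_variation_def sum.reindex[OF inj] by (simp add: o_def)
      qed
      ultimately show ?thesis
        using \<delta>[of "?f ` ?D"] D(3) by simp
    qed
    with \<open>0 < \<delta>\<close> show "\<exists>\<delta>>0. \<forall>D S. D division_of S \<longrightarrow> S \<subseteq> {l..u} \<longrightarrow>
        (\<Sum>k\<in>D. Sup k - Inf k) < \<delta> \<longrightarrow> (\<Sum>k\<in>D. norm (c (Sup k) - c (Inf k))) < \<epsilon>"
      by blast
  qed
qed

lemma abs_cont_onD: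
  assumes "abs_cont_on {l..u} c" "0 < \<epsilon>"
  shows "\<exists>\<delta>>0. \<forall>P. nonoverlapping P \<longrightarrow> P \<subseteq> {l..u} \<times> {l..u} \<longrightarrow>
     pair_sum P < \<delta> \<longrightarrow> pair_variation c P < \<epsilon>"
  using assms(1)[unfolded abs_cont_on_pairs, rule_format, OF assms(2)] by blast

lemma abs_cont_on_dominated:
  assumes ac: "abs_cont_on {l..u} c"
    and le: "\<And>s t. s \<in> {l..u} \<Longrightarrow> t \<in> {l..u} \<Longrightarrow> norm (g t - g s) \<le> K * norm (c t - c s)"
  shows "abs_cont_on {l..u} g"
  unfolding abs_cont_on_pairs
proof (intro allI impI)
  fix \<epsilon> :: real
  assume "0 < \<epsilon>"
  \<comment> \<open>\<open>K\<close> itself may be zero or negative and could not serve as a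
    divisor.\<close>
  define L where "L = max K 1"
  have L: "0 < L" "K \<le> L" by (auto simp: L_def)
  obtain \<delta> where "0 < \<delta>" and \<delta>: "\<And>P. nonoverlapping P \<Longrightarrow> P \<subseteq> {l..u} \<times> {l..u} \<Longrightarrow>
      pair_sum P < \<delta> \<Longrightarrow> pair_variation c P < \<epsilon> / L"
    using abs_cont_onD[OF ac divide_pos_pos[OF \<open>0 < \<epsilon>\<close> L(1)]] by blast
  have "pair_variation g P < \<epsilon>"
    if P: "nonoverlapping P" "P \<subseteq> {l..u} \<times> {l..u}" "pair_sum P < \<delta>" for P
  proof -
    have "pair_variation g P \<le> L * pair_variation c P"
      unfolding pair_variation_def sum_distrib_left
    proof (rule sum_mono)
      fix p assume "p \<in> P"
      then obtain a b where p: "p = (a, b)" "a \<in> {l..u}" "b \<in> {l..u}"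
        using P(2) by force
      have "norm (g b - g a) \<le> K * norm (c b - c a)"
        by (rule le) (use p in auto)
      also have "\<dots> \<le> L * norm (c b - c a)"
        using L by (intro mult_right_mono) auto
      finally show "(case p of (a, b) \<Rightarrow> norm (g b - g a)) \<le> L * (case p of (a, b) \<Rightarrow> norm (c b - c a))"
        by (simp add: p)
    qed
    also have "\<dots> < L * (\<epsilon> / L)"
      using \<delta>[OF P] L by (intro mult_strict_left_mono) auto
    finally show ?thesis using L by simp
  qed
  with \<open>0 < \<delta>\<close> show "\<exists>\<delta>>0. \<forall>P. nonoverlapping P \<longrightarrow> P \<subseteq> {l..u} \<times> {l..u} \<longrightarrow>
     pair_sum P < \<delta> \<longrightarrow> pair_variation g P < \<epsilon>" by blast
qed

lemma abs_cont_on_add: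
  assumes "abs_cont_on {l..u} c" "abs_cont_on {l..u} d"
  shows "abs_cont_on {l..u} (\<lambda>t. c t + d t)"
  unfolding abs_cont_on_pairs
proof (intro allI impI)
  fix \<epsilon> :: real
  assume "0 < \<epsilon>"
  then have "0 < \<epsilon> / 2" by simp
  obtain \<delta>1 where "0 < \<delta>1" and \<delta>1: "\<And>P. nonoverlapping P \<Longrightarrow> P \<subseteq> {l..u} \<times> {l..u} \<Longrightarrow>
      pair_sum P < \<delta>1 \<Longrightarrow> pair_variation c P < \<epsilon> / 2"
    using abs_cont_onD[OF assms(1) \<open>0 < \<epsilon> / 2\<close>] by blast
  obtain \<delta>2 where "0 < \<delta>2" and \<delta>2: "\<And>P. nonoverlapping P \<Longrightarrow> P \<subseteq> {l..u} \<times> {l..u} \<Longrightarrow>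
      pair_sum P < \<delta>2 \<Longrightarrow> pair_variation d P < \<epsilon> / 2"
    using abs_cont_onD[OF assms(2) \<open>0 < \<epsilon> / 2\<close>] by blast
  have "pair_variation (\<lambda>t. c t + d t) P < \<epsilon>"
    if P: "nonoverlapping P" "P \<subseteq> {l..u} \<times> {l..u}" "pair_sum P < min \<delta>1 \<delta>2" for P
  proof -
    have "pair_variation (\<lambda>t. c t + d t) P \<le> pair_variation c P + pair_variation d P"
      unfolding pair_variation_def sum.distrib[symmetric]
      by (rule sum_mono) (auto intro: norm_diff_triangle_ineq)
    then show ?thesis
      using \<delta>1[OF P(1,2)] \<delta>2[OF P(1,2)] P(3) by simp
  qed
  moreover have "0 < min \<delta>1 \<delta>2"
    using \<open>0 < \<delta>1\<close> \<open>0 < \<delta>2\<close> by simp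
  ultimately show "\<exists>\<delta>>0. \<forall>P. nonoverlapping P \<longrightarrow> P \<subseteq> {l..u} \<times> {l..u} \<longrightarrow>
     pair_sum P < \<delta> \<longrightarrow> pair_variation (\<lambda>t. c t + d t) P < \<epsilon>" by blast
qed

text \<open>Applied to time reversal and to the maps \<open>min 1 (2 * t)\<close> and
  \<open>max 0 (2 * t - 1)\<close> of concatenation. Hence \<open>T\<close> may reverse the order,
  which \<open>min\<close> and \<open>max\<close> of the image endpoints repair, and may be constant
  on intervals.\<close>

lemma abs_cont_on_reparam:
  assumes ac: "abs_cont_on {l..u} c"
    and range: "\<And>t. t \<in> {l'..u'} \<Longrightarrow> T t \<in> {l..u}"
    and mono: "mono T \<or> antimono T" and "0 < K"
    and lip: "\<And>s t. \<bar>T t - T s\<bar> \<le> K * \<bar>t - s\<bar>"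
  shows "abs_cont_on {l'..u'} (\<lambda>t. c (T t))"
  unfolding abs_cont_on_pairs
proof (intro allI impI)
  fix \<epsilon> :: real
  assume "0 < \<epsilon>"
  obtain \<delta> where "0 < \<delta>" and \<delta>: "\<And>P. nonoverlapping P \<Longrightarrow> P \<subseteq> {l..u} \<times> {l..u} \<Longrightarrow>
      pair_sum P < \<delta> \<Longrightarrow> pair_variation c P < \<epsilon>"
    using abs_cont_onD[OF ac \<open>0 < \<epsilon>\<close>] by blast
  let ?f = "\<lambda>(a, b). (min (T a) (T b), max (T a) (T b))"
  have "pair_variation (\<lambda>t. c (T t)) P < \<epsilon>"
    if P: "nonoverlapping P" "P \<subseteq> {l'..u'} \<times> {l'..u'}" "pair_sum P < \<delta> / K" for P
  proof -
    \<comment> \<open>Pairs collapsed by \<open>T\<close> are removed, as their images would be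
      degenerate; they carry no variation.\<close>
    let ?Q = "{p \<in> P. T (fst p) \<noteq> T (snd p)}"
    have fin: "finite P" and lt: "\<And>a b. (a, b) \<in> P \<Longrightarrow> a < b"
      using P(1) by (auto simp: nonoverlapping_def)
    have no: "max (T a) (T b) \<le> min (T a') (T b') \<or> max (T a') (T b') \<le> min (T a) (T b)"
      if "(a, b) \<in> P" "(a', b') \<in> P" "(a, b) \<noteq> (a', b')" for a b a' b'
    proof -
      have "b \<le> a' \<or> b' \<le> a"
        by (rule nonoverlappingD[OF P(1) that])
      then show ?thesis
        using mono lt[OF that(1)] lt[OF that(2)]
          monoD[of T a b] monoD[of T a' b'] monoD[of T b a'] monoD[of T b' a]
          antimonoD[of T a b] antimonoD[of T a' b'] antimonoD[of T b a'] antimonoD[of T b' a]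
        by (elim disjE) (simp_all add: min_def max_def)
    qed
    have inj: "inj_on ?f ?Q"
    proof (rule inj_onI)
      fix p q
      assume pq: "p \<in> ?Q" "q \<in> ?Q" "?f p = ?f q"
      obtain a b a' b' where ab: "p = (a, b)" "q = (a', b')" by force
      show "p = q"
        using no[of a b a' b'] pq unfolding ab by (auto simp: min_def max_def split: if_splits)
    qed
    have "nonoverlapping (?f ` ?Q)"
      unfolding nonoverlapping_def
    proof (intro conjI)
      show "finite (?f ` ?Q)" using fin by simp
      show "\<forall>(a, b)\<in>?f ` ?Q. a < b" by auto
      show "\<forall>(a, b)\<in>?f ` ?Q. \<forall>(a', b')\<in>?f ` ?Q. (a, b) \<noteq> (a', b') \<longrightarrow> b \<le> a' \<or> b' \<le> a"
        using no by fastforce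
    qed
    moreover have "?f ` ?Q \<subseteq> {l..u} \<times> {l..u}"
    proof -
      have "?f p \<in> {l..u} \<times> {l..u}" if pP: "p \<in> P" for p
      proof -
        obtain a b where "p = (a, b)" "a \<in> {l'..u'}" "b \<in> {l'..u'}"
          using subsetD[OF P(2) pP] by auto
        then show ?thesis
          using range[of a] range[of b] by (auto simp: min_def max_def)
      qed
      then show ?thesis by blast
    qed
    moreover have "pair_sum (?f ` ?Q) < \<delta>"
    proof -
      have "pair_sum (?f ` ?Q) = (\<Sum>p\<in>?Q. \<bar>T (snd p) - T (fst p)\<bar>)"
        unfolding pair_sum_def sum.reindex[OF inj] by (rule sum.cong) (auto simp: min_def max_def)
      also have "\<dots> \<le> (\<Sum>p\<in>P. \<bar>T (snd p) - T (fst p)\<bar>)"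
        using fin by (intro sum_mono2) auto
      also have "\<dots> \<le> (\<Sum>p\<in>P. K * (snd p - fst p))"
      proof (rule sum_mono)
        fix p assume "p \<in> P"
        then show "\<bar>T (snd p) - T (fst p)\<bar> \<le> K * (snd p - fst p)"
          using lip[of "snd p" "fst p"] lt[of "fst p" "snd p"] by simp
      qed
      also have "\<dots> = K * pair_sum P"
        by (simp add: pair_sum_def sum_distrib_left case_prod_beta)
      also have "\<dots> < \<delta>"
        using P(3) \<open>0 < K\<close> by (simp add: field_simps)
      finally show ?thesis .
    qed
    ultimately have "pair_variation c (?f ` ?Q) < \<epsilon>"
      by (rule \<delta>)
    moreover have "pair_variation c (?f ` ?Q) = (\<Sum>p\<in>?Q. norm (c (T (snd p)) - c (T (fst p))))"
      unfolding pair_variation_def sum.reindex[OF inj]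
      by (rule sum.cong) (auto simp: min_def max_def norm_minus_commute)
    moreover have "\<dots> = (\<Sum>p\<in>P. norm (c (T (snd p)) - c (T (fst p))))"
      by (rule sum.mono_neutral_left[OF fin]) auto
    ultimately show ?thesis
      by (simp add: pair_variation_def case_prod_beta)
  qed
  then show "\<exists>\<delta>>0. \<forall>P. nonoverlapping P \<longrightarrow> P \<subseteq> {l'..u'} \<times> {l'..u'} \<longrightarrow>
     pair_sum P < \<delta> \<longrightarrow> pair_variation (\<lambda>t. c (T t)) P < \<epsilon>"
    using \<open>0 < \<delta>\<close> \<open>0 < K\<close> by (intro exI[of _ "\<delta> / K"]) auto
qed

lemma abs_cont_on_imp_continuous_on:
  assumes "abs_cont_on {l..u} c"
  shows "continuous_on {l..u} c"
  unfolding continuous_on_iff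
proof (intro ballI allI impI)
  fix x \<epsilon> :: real
  assume x: "x \<in> {l..u}" and "0 < \<epsilon>"
  obtain \<delta> where "0 < \<delta>" and \<delta>: "\<And>P. nonoverlapping P \<Longrightarrow> P \<subseteq> {l..u} \<times> {l..u} \<Longrightarrow>
      pair_sum P < \<delta> \<Longrightarrow> pair_variation c P < \<epsilon>"
    using abs_cont_onD[OF assms \<open>0 < \<epsilon>\<close>] by blast
  have "dist (c y) (c x) < \<epsilon>" if y: "y \<in> {l..u}" "dist y x < \<delta>" for y
  proof (cases "x = y")
    case False
    have "pair_variation c {(min x y, max x y)} < \<epsilon>"
      by (rule \<delta>) (use False x y in \<open>auto simp: nonoverlapping_def pair_sum_def dist_real_def\<close>)
    then show ?thesis
      by (cases "x \<le> y") (auto simp: pair_variation_def dist_norm norm_minus_commute)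
  qed (use \<open>0 < \<epsilon>\<close> in simp)
  then show "\<exists>\<delta>>0. \<forall>y\<in>{l..u}. dist y x < \<delta> \<longrightarrow> dist (c y) (c x) < \<epsilon>"
    using \<open>0 < \<delta>\<close> by blast
qed

lemma abs_cont_on_smooth:
  fixes c :: "real \<Rightarrow> 'a::euclidean_space" and f :: "'a \<Rightarrow> 'b::euclidean_space"
  assumes ac: "abs_cont_on {l..u} c" and f: "smooth f"
  shows "abs_cont_on {l..u} (\<lambda>t. f (c t))"
proof -
  have "bounded (c ` {l..u})"
    by (intro compact_imp_bounded compact_continuous_image abs_cont_on_imp_continuous_on ac compact_Icc)
  then obtain R where "\<forall>x\<in>c ` {l..u}. norm x \<le> R"
    unfolding bounded_iff by blast
  then have R: "\<And>t. t \<in> {l..u} \<Longrightarrow> c t \<in> cball 0 R"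
    by simp
  obtain K where "\<And>x y. x \<in> cball 0 R \<Longrightarrow> y \<in> cball 0 R \<Longrightarrow> norm (f x - f y) \<le> K * norm (x - y)"
    using smooth_Lipschitz_on_ball[OF f] by metis
  then show ?thesis
    using R by (intro abs_cont_on_dominated[OF ac, where K = K]) blast
qed

section \<open>The Carnot--Caratheodory distance\<close>

text \<open>Again \<open>f\<close> may fail to be measurable, and a measurable minorant of the left
  integrand does the scaling.\<close>

lemma nn_integral_cmult_le:
  fixes f :: "'x \<Rightarrow> ennreal"
  assumes "0 < r"
  shows "(\<integral>\<^sup>+x. ennreal r * f x \<partial>M) \<le> ennreal r * (\<integral>\<^sup>+x. f x \<partial>M)"
proof -
  obtain h where h: "h \<in> borel_measurable M" "h \<le> (\<lambda>x. ennreal r * f x)"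
    "integral\<^sup>N M h = (\<integral>\<^sup>+x. ennreal r * f x \<partial>M)"
    using nn_integral_lower_measurable[of M "\<lambda>x. ennreal r * f x"] by blast
  have one: "ennreal r * ennreal (1 / r) = 1"
    using assms by (simp add: ennreal_mult[symmetric])
  have "ennreal (1 / r) * h x \<le> f x" for x
  proof -
    have "ennreal (1 / r) * h x \<le> ennreal (1 / r) * (ennreal r * f x)"
      using le_funD[OF h(2), of x] by (intro mult_left_mono) auto
    also have "\<dots> = f x"
      using one by (simp add: mult.assoc[symmetric] mult.commute)
    finally show ?thesis .
  qed
  then have "(\<integral>\<^sup>+x. ennreal (1 / r) * h x \<partial>M) \<le> (\<integral>\<^sup>+x. f x \<partial>M)"
    by (intro nn_integral_mono)
  then have "ennreal r * (ennreal (1 / r) * integral\<^sup>N M h) \<le> ennreal r * (\<integral>\<^sup>+x. f x \<partial>M)"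
    using h(1) by (intro mult_left_mono) (auto simp: nn_integral_cmult)
  then show ?thesis
    using one h(3) by (simp add: mult.assoc[symmetric])
qed

context carnot_group
begin

interpretation grp: Groups.group "gmul G" 0 uminus
  by (rule group_law)

definition hnorm :: "'a \<Rightarrow> real" where
  "hnorm v = sqrt (ip G v v)"

definition hlength :: "(real \<Rightarrow> 'a) \<Rightarrow> ennreal" where
  "hlength w = (\<integral>\<^sup>+t. ennreal (hnorm (w t)) * indicator {0..1} t \<partial>lebesgue)"

lemma hnorm_scaleR: "hnorm (r *\<^sub>R v) = \<bar>r\<bar> * hnorm v"
proof -
  have "ip G (r *\<^sub>R v) (r *\<^sub>R v) = r\<^sup>2 * ip G v v"
    using bilinear_lmul[OF ip_bilinear] bilinear_rmul[OF ip_bilinear] by (simp add: power2_eq_square)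
  then show ?thesis
    by (simp add: hnorm_def real_sqrt_mult)
qed

lemma cc_dist_le: "horizontal_curve G c w \<Longrightarrow> cc_dist G (c 0) (c 1) \<le> hlength w"
  unfolding cc_dist_def hlength_def hnorm_def by (rule INF_lower2[of "(c, w)"]) auto

lemma cc_dist_lessE:
  assumes "cc_dist G x y < e"
  obtains c w where "horizontal_curve G c w" "c 0 = x" "c 1 = y" "hlength w < e"
  using assms unfolding cc_dist_def INF_less_iff hlength_def hnorm_def by auto

lemma cc_dist_greatest:
  assumes "\<And>c w. horizontal_curve G c w \<Longrightarrow> c 0 = x \<Longrightarrow> c 1 = y \<Longrightarrow> a \<le> hlength w"
  shows "a \<le> cc_dist G x y"
  unfolding cc_dist_def using assms by (intro INF_greatest) (auto simp: hlength_def hnorm_def)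

text \<open>Left invariance of the fields keeps the control \<open>w\<close>, and with it the
  length.\<close>

lemma horizontal_lmul:
  assumes "horizontal_curve G c w"
  shows "horizontal_curve G (\<lambda>t. x \<odot> c t) w"
  unfolding horizontal_curve_def
proof
  show "abs_cont_on {0..1} (\<lambda>t. x \<odot> c t)"
    by (rule abs_cont_on_smooth[OF _ smooth_lmul]) (use assms in \<open>simp add: horizontal_curve_def\<close>)
  have "AE t\<in>{0..1} in lebesgue. w t \<in> layer G 1 \<and>
      (c has_vector_derivative lfield G (w t) (c t)) (at t within {0..1})"
    using assms by (simp add: horizontal_curve_def)
  then show "AE t\<in>{0..1} in lebesgue. w t \<in> layer G 1 \<and>
      ((\<lambda>t. x \<odot> c t) has_vector_derivative lfield G (w t) (x \<odot> c t)) (at t within {0..1})"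
  proof eventually_elim
    case (elim t)
    then show ?case
      using has_vector_derivative_compose_derivative[OF _ DL_has_derivative, of c _ t "{0..1}" x]
      by (auto simp: DL_lfield[symmetric])
  qed
qed

lemma cc_dist_lmul [simp]: "cc_dist G (g \<odot> x) (g \<odot> y) = cc_dist G x y"
proof (rule antisym)
  have le: "cc_dist G (g \<odot> x) (g \<odot> y) \<le> cc_dist G x y" for g x y
  proof (rule cc_dist_greatest)
    fix c w
    assume "horizontal_curve G c w" "c 0 = x" "c 1 = y"
    then show "cc_dist G (g \<odot> x) (g \<odot> y) \<le> hlength w"
      using cc_dist_le[OF horizontal_lmul, of c w g] by simp
  qed
  show "cc_dist G (g \<odot> x) (g \<odot> y) \<le> cc_dist G x y"
    by (rule le)
  show "cc_dist G x y \<le> cc_dist G (g \<odot> x) (g \<odot> y)"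
    using le[of "- g" "g \<odot> x" "g \<odot> y"] by (simp add: grp.assoc[symmetric])
qed

text \<open>On the first layer the dilation is multiplication by \<open>r\<close>, so the control,
  and for positive \<open>r\<close> the length, is scaled by \<open>r\<close>.\<close>

lemma horizontal_dil:
  assumes "horizontal_curve G c w"
  shows "horizontal_curve G (\<lambda>t. dil r (c t)) (\<lambda>t. r *\<^sub>R w t)"
  unfolding horizontal_curve_def
proof
  obtain K where K: "\<And>v. norm (dil r v) \<le> K * norm v"
    using linear_bounded[OF linear_dil] by metis
  show "abs_cont_on {0..1} (\<lambda>t. dil r (c t))"
  proof (rule abs_cont_on_dominated[where c = c and K = K])
    show "abs_cont_on {0..1} c"
      using assms by (simp add: horizontal_curve_def)
    show "norm (dil r (c t) - dil r (c s)) \<le> K * norm (c t - c s)" for s t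
      using K[of "c t - c s"] by (simp add: linear_diff[OF linear_dil])
  qed
  have "AE t\<in>{0..1} in lebesgue. w t \<in> layer G 1 \<and>
      (c has_vector_derivative lfield G (w t) (c t)) (at t within {0..1})"
    using assms by (simp add: horizontal_curve_def)
  then show "AE t\<in>{0..1} in lebesgue. r *\<^sub>R w t \<in> layer G 1 \<and>
      ((\<lambda>t. dil r (c t)) has_vector_derivative lfield G (r *\<^sub>R w t) (dil r (c t))) (at t within {0..1})"
  proof eventually_elim
    case (elim t)
    show ?case
    proof
      assume t: "t \<in> {0..1}"
      with elim have w: "w t \<in> layer G 1" and
        c: "(c has_vector_derivative lfield G (w t) (c t)) (at t within {0..1})" by auto
      have "dil r (w t) = r *\<^sub>R w t"
        using dil_stratum[of "w t" 1 r] w step_pos by (simp add: stratum_def)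
      then show "r *\<^sub>R w t \<in> layer G 1 \<and>
          ((\<lambda>t. dil r (c t)) has_vector_derivative lfield G (r *\<^sub>R w t) (dil r (c t))) (at t within {0..1})"
        using has_vector_derivative_compose_derivative[OF c dil_has_derivative, of r] w
          subspace_scale[OF subspace_layer] step_pos
        by (auto simp: dil_lfield)
    qed
  qed
qed

lemma cc_dist_dil_le:
  assumes "0 < r"
  shows "cc_dist G (dil r x) (dil r y) \<le> ennreal r * cc_dist G x y"
proof -
  have one: "ennreal (1 / r) * ennreal r = 1"
    using assms by (simp add: ennreal_mult[symmetric])
  have "ennreal (1 / r) * cc_dist G (dil r x) (dil r y) \<le> cc_dist G x y"
  proof (rule cc_dist_greatest)
    fix c w
    assume c: "horizontal_curve G c w" "c 0 = x" "c 1 = y"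
    have "cc_dist G (dil r x) (dil r y) \<le> hlength (\<lambda>t. r *\<^sub>R w t)"
      using cc_dist_le[OF horizontal_dil[OF c(1), of r]] c by simp
    also have "\<dots> = (\<integral>\<^sup>+t. ennreal r * (ennreal (hnorm (w t)) * indicator {0..1} t) \<partial>lebesgue)"
      unfolding hlength_def hnorm_scaleR using assms
      by (intro nn_integral_cong) (simp add: ennreal_mult' mult.assoc)
    also have "\<dots> \<le> ennreal r * hlength w"
      unfolding hlength_def by (rule nn_integral_cmult_le[OF assms])
    finally have "ennreal (1 / r) * cc_dist G (dil r x) (dil r y) \<le> ennreal (1 / r) * (ennreal r * hlength w)"
      by (rule mult_left_mono) simp
    also have "\<dots> = hlength w"
      by (simp only: mult.assoc[symmetric] one mult_1_left)
    finally show "ennreal (1 / r) * cc_dist G (dil r x) (dil r y) \<le> hlength w" .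
  qed
  then have "ennreal r * (ennreal (1 / r) * cc_dist G (dil r x) (dil r y)) \<le> ennreal r * cc_dist G x y"
    by (rule mult_left_mono) simp
  moreover have "ennreal r * (ennreal (1 / r) * cc_dist G (dil r x) (dil r y)) = cc_dist G (dil r x) (dil r y)"
    using one by (simp only: mult.assoc[symmetric] mult.commute[of "ennreal r"] mult_1_left)
  ultimately show ?thesis
    by simp
qed

lemma cc_dist_sym_le: "cc_dist G y x \<le> cc_dist G x y"
proof (rule cc_dist_greatest)
  fix c w
  assume c: "horizontal_curve G c w" "c 0 = x" "c 1 = y"
  have "horizontal_curve G (\<lambda>t. c (1 - t)) (\<lambda>t. - w (1 - t))"
    unfolding horizontal_curve_def
  proof
    show "abs_cont_on {0..1} (\<lambda>t. c (1 - t))"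
      by (rule abs_cont_on_reparam[where T = "\<lambda>t. 1 - t" and K = 1])
         (use c(1) in \<open>auto simp: horizontal_curve_def antimono_def monotone_on_def\<close>)
    have "AE t in lebesgue. t \<in> {0..1} \<longrightarrow> w t \<in> layer G 1 \<and>
        (c has_vector_derivative lfield G (w t) (c t)) (at t within {0..1})"
      using c(1) by (simp add: horizontal_curve_def)
    from AE_lebesgue_affine[OF this, of "- 1" 1]
    have "AE t in lebesgue. (1 - t) \<in> {0..1} \<longrightarrow> w (1 - t) \<in> layer G 1 \<and>
        (c has_vector_derivative lfield G (w (1 - t)) (c (1 - t))) (at (1 - t) within {0..1})"
      by simp
    then show "AE t\<in>{0..1} in lebesgue. - w (1 - t) \<in> layer G 1 \<and>
      ((\<lambda>t. c (1 - t)) has_vector_derivative lfield G (- w (1 - t)) (c (1 - t))) (at t within {0..1})"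
    proof eventually_elim
      case (elim t)
      show ?case
      proof
        assume t: "t \<in> {0..1}"
        with elim have w: "w (1 - t) \<in> layer G 1" and
          c: "(c has_vector_derivative lfield G (w (1 - t)) (c (1 - t))) (at (1 - t) within {0..1})" by auto
        have 1: "((\<lambda>t. 1 - t) has_vector_derivative - 1) (at t within {0..1::real})"
          by (auto intro!: derivative_eq_intros)
        have 2: "(c has_vector_derivative lfield G (w (1 - t)) (c (1 - t))) (at (1 - t) within (\<lambda>t. 1 - t) ` {0..1})"
          by (rule has_vector_derivative_within_subset[OF c]) auto
        have "- w (1 - t) \<in> layer G 1"
          using w subspace_neg[OF subspace_layer] step_pos by simp
        then show "- w (1 - t) \<in> layer G 1 \<and>
            ((\<lambda>t. c (1 - t)) has_vector_derivative lfield G (- w (1 - t)) (c (1 - t))) (at t within {0..1})"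
          using vector_diff_chain_within[OF 1 2] by (simp add: o_def linear_neg[OF linear_lfield])
      qed
    qed
  qed
  then have "cc_dist G y x \<le> hlength (\<lambda>t. - w (1 - t))"
    using cc_dist_le[of "\<lambda>t. c (1 - t)"] c by simp
  also have "\<dots> = (\<integral>\<^sup>+t. ennreal \<bar>- 1\<bar> * (ennreal (hnorm (w ((- 1) * t + 1))) * indicator {0..1} ((- 1) * t + 1)) \<partial>lebesgue)"
    unfolding hlength_def using hnorm_scaleR[of "- 1"]
    by (intro nn_integral_cong) (auto simp: indicator_def)
  also have "\<dots> \<le> hlength w"
    unfolding hlength_def by (rule nn_integral_affine_le) simp
  finally show "cc_dist G y x \<le> hlength w" .
qed

text \<open>The curve is a sum of two reparametrised curves, each at rest on one half of the
  interval. Absolute continuity is inherited from the summands, and away from the junction only one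
  of them moves.\<close>

lemma horizontal_concat:
  assumes h1: "horizontal_curve G c1 w1" and h2: "horizontal_curve G c2 w2" and join: "c1 1 = c2 0"
  shows "horizontal_curve G (\<lambda>t. c1 (min 1 (2 * t)) + (c2 (max 0 (2 * t - 1)) - c1 1))
    (\<lambda>t. if t < 1 / 2 then 2 *\<^sub>R w1 (2 * t) else 2 *\<^sub>R w2 (2 * t - 1))"
    (is "horizontal_curve G ?c ?w")
  unfolding horizontal_curve_def
proof
  have "abs_cont_on {0..1} (\<lambda>s. c2 s - c1 1)"
    by (rule abs_cont_on_dominated[where K = 1 and c = c2]) (use h2 in \<open>auto simp: horizontal_curve_def\<close>)
  then have "abs_cont_on {0..1} (\<lambda>t. c2 (max 0 (2 * t - 1)) - c1 1)"
    by (rule abs_cont_on_reparam[where K = 2]) (auto intro!: monoI simp: max_def abs_if)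
  moreover have "abs_cont_on {0..1} (\<lambda>t. c1 (min 1 (2 * t)))"
    by (rule abs_cont_on_reparam[where K = 2 and c = c1 and T = "\<lambda>t. min 1 (2 * t)"])
       (use h1 in \<open>auto intro!: monoI simp: horizontal_curve_def min_def abs_if\<close>)
  ultimately show "abs_cont_on {0..1} ?c"
    by (intro abs_cont_on_add)
  have 1: "AE t in lebesgue. t \<in> {0..1} \<longrightarrow> w1 t \<in> layer G 1 \<and>
      (c1 has_vector_derivative lfield G (w1 t) (c1 t)) (at t within {0..1})"
    using h1 by (simp add: horizontal_curve_def)
  have 2: "AE t in lebesgue. t \<in> {0..1} \<longrightarrow> w2 t \<in> layer G 1 \<and>
      (c2 has_vector_derivative lfield G (w2 t) (c2 t)) (at t within {0..1})"
    using h2 by (simp add: horizontal_curve_def)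
  have two: "(2::real) \<noteq> 0" by simp
  \<comment> \<open>Away from these points \<open>2 * t\<close> or \<open>2 * t - 1\<close> lies
    strictly inside the unit interval, where derivatives within it are two-sided.\<close>
  have "AE t in lebesgue. t \<notin> {0, 1 / 2, 1 :: real}"
    using negligible_finite[of "{0, 1 / 2, 1 :: real}"] by (intro AE_not_in) (simp add: negligible_iff_null_sets)
  moreover note AE_lebesgue_affine[OF 1 two, of 0] AE_lebesgue_affine[OF 2 two, of "- 1"]
  ultimately show "AE t\<in>{0..1} in lebesgue. ?w t \<in> layer G 1 \<and>
      (?c has_vector_derivative lfield G (?w t) (?c t)) (at t within {0..1})"
  proof eventually_elim
    case (elim t)
    have scale: "v \<in> layer G 1 \<Longrightarrow> 2 *\<^sub>R v \<in> layer G 1" for v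
      using subspace_scale[OF subspace_layer] step_pos by simp
    show ?case
    proof
      assume "t \<in> {0..1}"
      then consider "0 < t" "t < 1 / 2" | "1 / 2 < t" "t < 1"
        using elim(1) by force
      then show "?w t \<in> layer G 1 \<and> (?c has_vector_derivative lfield G (?w t) (?c t)) (at t within {0..1})"
      proof cases
        case 1
        then have w: "w1 (2 * t) \<in> layer G 1"
          and "(c1 has_vector_derivative lfield G (w1 (2 * t)) (c1 (2 * t))) (at (2 * t) within {0..1})"
          using elim(2) by auto
        then have c: "(c1 has_vector_derivative lfield G (w1 (2 * t)) (c1 (2 * t))) (at (2 * t))"
          using 1 by (simp add: at_within_Icc_at)
        have "((\<lambda>t. 2 * t) has_vector_derivative 2) (at t)"
          by (auto intro!: derivative_eq_intros)
        from vector_diff_chain_at[OF this c]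
        have "((\<lambda>t. c1 (2 * t)) has_vector_derivative lfield G (?w t) (?c t)) (at t)"
          using 1 join by (simp add: o_def linear_cmul[OF linear_lfield])
        then have "(?c has_vector_derivative lfield G (?w t) (?c t)) (at t)"
          by (rule has_vector_derivative_transform_within_open[where S = "{..<1/2}"])
             (use 1 join in auto)
        then show ?thesis
          using 1 scale[OF w] by (simp add: has_vector_derivative_at_within)
      next
        case 2
        then have w: "w2 (2 * t - 1) \<in> layer G 1"
          and "(c2 has_vector_derivative lfield G (w2 (2 * t - 1)) (c2 (2 * t - 1))) (at (2 * t - 1) within {0..1})"
          using elim(3) by auto
        then have c: "(c2 has_vector_derivative lfield G (w2 (2 * t - 1)) (c2 (2 * t - 1))) (at (2 * t - 1))"
          using 2 by (simp add: at_within_Icc_at)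
        have "((\<lambda>t. 2 * t - 1) has_vector_derivative 2) (at t)"
          by (auto intro!: derivative_eq_intros)
        from vector_diff_chain_at[OF this c]
        have "((\<lambda>t. c2 (2 * t - 1)) has_vector_derivative lfield G (?w t) (?c t)) (at t)"
          using 2 join by (simp add: o_def linear_cmul[OF linear_lfield])
        then have "(?c has_vector_derivative lfield G (?w t) (?c t)) (at t)"
          by (rule has_vector_derivative_transform_within_open[where S = "{1/2<..}"])
             (use 2 join in auto)
        then show ?thesis
          using 2 scale[OF w] by (simp add: has_vector_derivative_at_within)
      qed
    qed
  qed
qed

text \<open>Splitting the integral at 1/2 requires measurability; it is done for a measurable
  minorant that has the same integral as the speed.\<close>

lemma hlength_concat:
  "hlength (\<lambda>t. if t < 1 / 2 then 2 *\<^sub>R w1 (2 * t) else 2 *\<^sub>R w2 (2 * t - 1)) \<le> hlength w1 + hlength w2"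
proof -
  let ?F = "\<lambda>w t. ennreal (hnorm (w t)) * indicator {0..1} t"
  let ?w = "\<lambda>t. if t < 1 / 2 then 2 *\<^sub>R w1 (2 * t) else 2 *\<^sub>R w2 (2 * t - 1)"
  obtain h where h: "h \<in> borel_measurable lebesgue" "h \<le> ?F ?w" "integral\<^sup>N lebesgue h = hlength ?w"
    unfolding hlength_def using nn_integral_lower_measurable[of lebesgue "?F ?w"] by blast
  have "hlength ?w = (\<integral>\<^sup>+t. h t * indicator {..<1/2} t + h t * indicator {1/2..} t \<partial>lebesgue)"
    unfolding h(3)[symmetric] by (intro nn_integral_cong) (auto simp: indicator_def)
  also have "\<dots> = (\<integral>\<^sup>+t. h t * indicator {..<1/2} t \<partial>lebesgue) + (\<integral>\<^sup>+t. h t * indicator {1/2..} t \<partial>lebesgue)"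
    using h(1) by (intro nn_integral_add borel_measurable_times_ennreal borel_measurable_indicator) auto
  also have "\<dots> \<le> (\<integral>\<^sup>+t. ennreal \<bar>2\<bar> * ?F w1 (2 * t + 0) \<partial>lebesgue) + (\<integral>\<^sup>+t. ennreal \<bar>2\<bar> * ?F w2 (2 * t + - 1) \<partial>lebesgue)"
  proof (intro add_mono nn_integral_mono)
    fix t :: real
    have "h t \<le> ?F ?w t"
      using h(2) by (simp add: le_fun_def)
    then show "h t * indicator {..<1/2} t \<le> ennreal \<bar>2\<bar> * ?F w1 (2 * t + 0)"
      by (auto simp: indicator_def hnorm_scaleR ennreal_mult' split: if_splits)
    show "h t * indicator {1/2..} t \<le> ennreal \<bar>2\<bar> * ?F w2 (2 * t + - 1)"
      using \<open>h t \<le> ?F ?w t\<close> by (auto simp: indicator_def hnorm_scaleR ennreal_mult' split: if_splits)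
  qed
  also have "\<dots> \<le> hlength w1 + hlength w2"
    unfolding hlength_def by (intro add_mono nn_integral_affine_le) auto
  finally show ?thesis .
qed

text \<open>Strict bounds provide actual curves to concatenate, and they are what membership in
  balls amounts to.\<close>

lemma cc_dist_triangle:
  assumes "cc_dist G x y < ennreal a" "cc_dist G y z < ennreal b" "0 \<le> a" "0 \<le> b"
  shows "cc_dist G x z < ennreal (a + b)"
proof -
  obtain c1 w1 where 1: "horizontal_curve G c1 w1" "c1 0 = x" "c1 1 = y" "hlength w1 < ennreal a"
    using cc_dist_lessE[OF assms(1)] by blast
  obtain c2 w2 where 2: "horizontal_curve G c2 w2" "c2 0 = y" "c2 1 = z" "hlength w2 < ennreal b"
    using cc_dist_lessE[OF assms(2)] by blast
  have "cc_dist G x z \<le> hlength (\<lambda>t. if t < 1 / 2 then 2 *\<^sub>R w1 (2 * t) else 2 *\<^sub>R w2 (2 * t - 1))"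
    using cc_dist_le[OF horizontal_concat[OF 1(1) 2(1)]] 1 2 by simp
  also have "\<dots> \<le> hlength w1 + hlength w2"
    by (rule hlength_concat)
  also have "\<dots> < ennreal a + ennreal b"
    using 1(4) 2(4) by (rule add_strict_mono)
  also have "\<dots> = ennreal (a + b)"
    using assms by simp
  finally show ?thesis .
qed

lemma cc_dist_sym: "cc_dist G x y = cc_dist G y x"
  by (intro antisym cc_dist_sym_le)

lemma cc_dist_refl [simp]: "cc_dist G x x = 0"
proof -
  have "abs_cont_on {0..1} (\<lambda>_. x)"
    unfolding abs_cont_on_pairs pair_variation_def by (auto intro: exI[of _ 1])
  then have "horizontal_curve G (\<lambda>_. x) (\<lambda>_. 0)"
    using step_pos subspace_0[OF subspace_layer] linear_0[OF linear_lfield]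
    by (auto simp: horizontal_curve_def)
  then have "cc_dist G x x \<le> hlength (\<lambda>_. 0)"
    using cc_dist_le by blast
  also have "\<dots> = 0"
    using hnorm_scaleR[of 0 0] by (simp add: hlength_def)
  finally show ?thesis by simp
qed

lemma cc_ball_lmul: "cc_ball G (g \<odot> x) r = gmul G g ` cc_ball G x r"
proof (intro set_eqI iffI)
  fix y
  assume "y \<in> cc_ball G (g \<odot> x) r"
  then have "cc_dist G (- g \<odot> (g \<odot> x)) (- g \<odot> y) < ennreal r"
    unfolding cc_ball_def cc_dist_lmul by simp
  then have "- g \<odot> y \<in> cc_ball G x r"
    by (simp add: cc_ball_def grp.assoc[symmetric])
  moreover have "y = g \<odot> (- g \<odot> y)"
    by (simp add: grp.assoc[symmetric])
  ultimately show "y \<in> gmul G g ` cc_ball G x r" by blast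
qed (auto simp: cc_ball_def)

lemma cc_ball_dil:
  assumes "0 < r"
  shows "cc_ball G 0 (r * s) = dil r ` cc_ball G 0 s"
proof -
  have sub: "dil r ` cc_ball G 0 s \<subseteq> cc_ball G 0 (r * s)" if "0 < r" for r s
  proof
    fix y
    assume "y \<in> dil r ` cc_ball G 0 s"
    then obtain x where x: "y = dil r x" "cc_dist G 0 x < ennreal s"
      by (auto simp: cc_ball_def)
    then obtain a where a: "cc_dist G 0 x = ennreal a" "0 \<le> a"
      by (cases "cc_dist G 0 x" rule: ennreal_cases) auto
    have "cc_dist G (dil r 0) (dil r x) \<le> ennreal r * ennreal a"
      using cc_dist_dil_le[OF that, of 0 x] a by simp
    also have "\<dots> = ennreal (r * a)"
      using that a by (simp add: ennreal_mult)
    also have "\<dots> < ennreal (r * s)"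
      using x(2) a that by (simp add: ennreal_less_iff)
    finally show "y \<in> cc_ball G 0 (r * s)"
      using x(1) linear_0[OF linear_dil] by (simp add: cc_ball_def)
  qed
  have "cc_ball G 0 (r * s) \<subseteq> dil r ` cc_ball G 0 s"
  proof
    fix y
    assume "y \<in> cc_ball G 0 (r * s)"
    then have "dil (inverse r) y \<in> cc_ball G 0 (inverse r * (r * s))"
      using sub[of "inverse r" "r * s"] assms by auto
    then have "dil (inverse r) y \<in> cc_ball G 0 s"
      using assms by (simp add: mult.assoc[symmetric])
    moreover have "y = dil r (dil (inverse r) y)"
      using dil_inverse[of r y] assms by simp
    ultimately show "y \<in> dil r ` cc_ball G 0 s" by blast
  qed
  with sub[OF assms] show ?thesis by blast
qed

end

section \<open>Balls as neighbourhoods\<close>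

text \<open>If the unit ball has positive finite measure, Chow's theorem and the boundedness of small balls
  are consequences of invariance: a Steinhaus argument shows that balls are neighbourhoods, and points
  at distance zero from the identity would generate infinitely many disjoint translates in a ball.\<close>

locale carnot_group_ball = carnot_group +
  assumes unit_ball_pos: "emeasure lebesgue (cc_ball G 0 1) \<noteq> 0"
    and unit_ball_finite: "emeasure lebesgue (cc_ball G 0 1) \<noteq> \<infinity>"
begin

interpretation grp: Groups.group "gmul G" 0 uminus
  by (rule group_law)

text \<open>A set outside the sigma-algebra has \<open>emeasure\<close> 0, so positivity already
  implies measurability.\<close>

lemma unit_ball_lmeasurable: "cc_ball G 0 1 \<in> lmeasurable"
  using unit_ball_pos unit_ball_finite emeasure_notin_sets[of "cc_ball G 0 1" lebesgue]
  by (auto simp: fmeasurable_def less_top)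

lemma measure_unit_ball_pos: "0 < measure lebesgue (cc_ball G 0 1)"
  using unit_ball_pos emeasure_eq_measure2[OF unit_ball_lmeasurable] by (simp add: zero_less_measure_iff)

lemma cc_ball_eq: "0 < r \<Longrightarrow> cc_ball G x r = gmul G x ` dil r ` cc_ball G 0 1"
  using cc_ball_lmul[of x 0 r] cc_ball_dil[of r 1] by simp

lemma cc_ball_lmeasurable: "0 < r \<Longrightarrow> cc_ball G x r \<in> lmeasurable"
  unfolding cc_ball_eq by (intro measure_lmul measure_dil unit_ball_lmeasurable) simp

lemma measure_cc_ball:
  "0 < r \<Longrightarrow> measure lebesgue (cc_ball G x r) = \<bar>jacobian (dil r)\<bar> * measure lebesgue (cc_ball G 0 1)"
  unfolding cc_ball_eq using measure_dil[OF unit_ball_lmeasurable, of r] measure_lmul(2)[of "dil r ` cc_ball G 0 1" x]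
  by simp

lemma measure_cc_ball_pos: "0 < r \<Longrightarrow> 0 < measure lebesgue (cc_ball G x r)"
  using measure_cc_ball[of r x] measure_unit_ball_pos jacobian_dil[of r] by simp

text \<open>The factor is 3 to the power of the homogeneous dimension; it enters the covering
  argument as the constant of the maximal inequality.\<close>

lemma measure_cc_ball_tripling:
  assumes "0 < r"
  shows "measure lebesgue (cc_ball G x (3 * r)) = \<bar>jacobian (dil 3)\<bar> * measure lebesgue (cc_ball G x r)"
proof -
  have "jacobian (dil (3 * r)) = jacobian (dil 3) * jacobian (dil r)"
    using jacobian_compose[OF linear_dil linear_dil, of 3 r] by (simp add: dil_dil)
  then show ?thesis
    using measure_cc_ball[of "3 * r" x] measure_cc_ball[of r x] assms by (simp add: abs_mult)
qed

text \<open>Steinhaus: the unit ball contains a compact set \<open>K\<close> of positive measure,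
  and for \<open>x\<close> near 0 the translate of \<open>K\<close> by \<open>x\<close> meets
  \<open>K\<close>. Then \<open>x = k' \<odot> - k\<close> with both \<open>k\<close> and
  \<open>k'\<close> at distance less than 1 from 0.\<close>

lemma cc_ball_2_nbhd: obtains e where "0 < e" "ball 0 e \<subseteq> cc_ball G 0 2"
proof -
  let ?B = "cc_ball G 0 1"
  obtain Z C where Z: "negligible Z" and C: "\<And>n::nat. compact (C n)" "?B = (\<Union>n. C n) \<union> Z"
    using lebesgue_regular_inner[OF fmeasurableD[OF unit_ball_lmeasurable]] by metis
  have "\<exists>n. measure lebesgue (C n) \<noteq> 0"
  proof (rule ccontr)
    assume "\<not> ?thesis"
    then have "negligible (C n)" for n
      using C(1) by (simp add: negligible_iff_measure lmeasurable_compact)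
    then have "negligible ?B"
      unfolding C(2) using Z by (intro negligible_Un negligible_countable_Union) auto
    then show False
      using measure_unit_ball_pos by (simp add: negligible_iff_measure)
  qed
  then obtain K where K: "compact K" "K \<subseteq> ?B" "0 < measure lebesgue K"
    using C by (metis UN_upper UNIV_I le_supI1 measure_nonneg order_le_less)
  have Km: "K \<in> lmeasurable"
    by (rule lmeasurable_compact[OF K(1)])
  \<comment> \<open>An open neighbourhood of less than twice the measure of \<open>K\<close> has no
    room for two disjoint copies of \<open>K\<close>.\<close>
  obtain U where U: "open U" "K \<subseteq> U" "U - K \<in> lmeasurable" "emeasure lebesgue (U - K) < ennreal (measure lebesgue K)"
    using sets_lebesgue_outer_open[OF fmeasurableD[OF Km] K(3)] by metis
  have UK: "measure lebesgue (U - K) < measure lebesgue K"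
    using U(4) emeasure_eq_measure2[OF U(3)] by (simp add: ennreal_less_iff)
  have Um: "U \<in> lmeasurable"
    using fmeasurable.Un[OF Km U(3)] U(2) by (simp add: Un_absorb1)
  have "measure lebesgue U = measure lebesgue K + measure lebesgue (U - K)"
    using measurable_measure_Diff[OF Um fmeasurableD[OF Km] U(2)] by simp
  with UK have U2: "measure lebesgue U < 2 * measure lebesgue K" by simp
  have "continuous_on UNIV (\<lambda>(x, y). gmul G x y)"
    by (rule smooth_continuous_on[OF smooth_mul])
  then have op: "open ((\<lambda>(x, y). gmul G x y) -` U)"
    using U(1) by (simp add: continuous_on_open_vimage)
  have sub0: "{0} \<times> K \<subseteq> (\<lambda>(x, y). gmul G x y) -` U"
    using U(2) by auto
  \<comment> \<open>Compactness of \<open>K\<close> makes the neighbourhood of 0 uniform: all its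
    elements translate \<open>K\<close> into \<open>U\<close>.\<close>
  obtain X where X: "0 \<in> X" "open X" "X \<times> K \<subseteq> (\<lambda>(x, y). gmul G x y) -` U"
    using Elementary_Topology.tube_lemma[OF K(1) op sub0] by (elim exE conjE) (rule that)
  obtain e where e: "0 < e" "ball 0 e \<subseteq> X"
    using X(1,2) open_contains_ball by blast
  have "x \<in> cc_ball G 0 2" if "x \<in> ball 0 e" for x
  proof -
    have sub: "gmul G x ` K \<subseteq> U"
      using X(3) e(2) that by force
    have "gmul G x ` K \<inter> K \<noteq> {}"
    proof
      assume disj: "gmul G x ` K \<inter> K = {}"
      have "measure lebesgue (gmul G x ` K \<union> K) = measure lebesgue (gmul G x ` K) + measure lebesgue K"
        using disj measure_lmul[OF Km, of x] Km by (simp add: measure_Un3)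
      also have "\<dots> = 2 * measure lebesgue K"
        using measure_lmul[OF Km, of x] by simp
      finally have "2 * measure lebesgue K \<le> measure lebesgue U"
        using measure_mono_fmeasurable[OF _ _ Um, of "gmul G x ` K \<union> K"] sub U(2) measure_lmul(1)[OF Km, of x] Km
        by auto
      then show False using U2 by simp
    qed
    then obtain k k' where k: "k \<in> K" "k' \<in> K" "x \<odot> k = k'" by auto
    then have "x = k' \<odot> - k"
      by (metis grp.assoc grp.right_inverse grp.right_neutral)
    moreover have "cc_dist G k' (k' \<odot> - k) < ennreal 1"
    proof -
      have "cc_dist G k' (k' \<odot> - k) = cc_dist G 0 (- k)"
        using cc_dist_lmul[of k' 0 "- k"] by simp
      also have "\<dots> = cc_dist G k 0"
        using cc_dist_lmul[of k 0 "- k"] by simp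
      also have "\<dots> < ennreal 1"
        using k(1) K(2) cc_dist_sym[of k 0] by (auto simp: cc_ball_def)
      finally show ?thesis .
    qed
    moreover have "cc_dist G 0 k' < ennreal 1"
      using k(2) K(2) by (auto simp: cc_ball_def)
    ultimately have "cc_dist G 0 x < ennreal (1 + 1)"
      using cc_dist_triangle[of 0 k' 1 x 1] by simp
    then show ?thesis
      by (simp add: cc_ball_def)
  qed
  then show ?thesis
    using that e(1) by blast
qed

lemma cc_ball_nbhd_0:
  assumes "0 < r"
  obtains e where "0 < e" "ball 0 e \<subseteq> cc_ball G 0 r"
proof -
  obtain e where e: "0 < e" "ball 0 e \<subseteq> cc_ball G 0 2"
    by (rule cc_ball_2_nbhd)
  obtain K where K: "0 < K" "\<And>y. norm (dil (2 / r) y) \<le> K * norm y"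
    using linear_bounded_pos[OF linear_dil] by metis
  have "y \<in> cc_ball G 0 r" if "y \<in> ball 0 (e / K)" for y
  proof -
    have "norm (dil (2 / r) y) < e"
      using K(2)[of y] that K(1) by (simp add: pos_less_divide_eq mult.commute order.strict_trans1)
    then have "dil (2 / r) y \<in> cc_ball G 0 2"
      using e(2) by auto
    then have "dil (r / 2) (dil (2 / r) y) \<in> cc_ball G 0 (r / 2 * 2)"
      using cc_ball_dil[of "r / 2" 2] assms by auto
    then show ?thesis
      using assms by (simp add: dil_dil)
  qed
  then have "ball 0 (e / K) \<subseteq> cc_ball G 0 r" by blast
  then show ?thesis
    using that[of "e / K"] e(1) K(1) by simp
qed

lemma cc_dist_less_left: "cc_dist G y z = cc_dist G 0 (- y \<odot> z)"
  using cc_dist_lmul[of "- y" y z] by simp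

lemma continuous_on_lmul: "continuous_on S (gmul G x)"
  by (rule smooth_continuous_on[OF smooth_lmul])

lemma open_cc_ball: "open (cc_ball G x r)"
proof (subst open_subopen, intro ballI)
  fix y
  assume y: "y \<in> cc_ball G x r"
  then obtain s where s: "cc_dist G x y < s" "s < ennreal r"
    using dense unfolding cc_ball_def by blast
  then obtain a where a: "s = ennreal a" "0 \<le> a"
    using s(2) by (cases s rule: ennreal_cases) auto
  then have "a < r"
    using s(2) by (simp add: ennreal_less_iff)
  obtain e where e: "0 < e" "ball 0 e \<subseteq> cc_ball G 0 (r - a)"
    using cc_ball_nbhd_0[of "r - a"] \<open>a < r\<close> by auto
  have "open (gmul G (- y) -` ball 0 e)"
    by (rule open_vimage[OF open_ball continuous_on_lmul])
  moreover have "y \<in> gmul G (- y) -` ball 0 e"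
    using e(1) by simp
  moreover have "gmul G (- y) -` ball 0 e \<subseteq> cc_ball G x r"
  proof
    fix z
    assume "z \<in> gmul G (- y) -` ball 0 e"
    then have "cc_dist G y z < ennreal (r - a)"
      using e(2) cc_dist_less_left[of y z] by (auto simp: cc_ball_def)
    then have "cc_dist G x z < ennreal (a + (r - a))"
      using s(1) a \<open>a < r\<close> by (intro cc_dist_triangle) auto
    then show "z \<in> cc_ball G x r"
      by (simp add: cc_ball_def)
  qed
  ultimately show "\<exists>T. open T \<and> y \<in> T \<and> T \<subseteq> cc_ball G x r" by blast
qed

text \<open>By \<open>exp_coords\<close> the multiples of \<open>h\<close> are its powers in the
  group, and the triangle inequality keeps them at distance 0.\<close>

lemma cc_dist_0_multiple:
  assumes h: "\<And>r. 0 < r \<Longrightarrow> h \<in> cc_ball G 0 r"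
  shows "0 < r \<Longrightarrow> real n *\<^sub>R h \<in> cc_ball G 0 r"
proof (induction n arbitrary: r)
  case 0
  then show ?case by (simp add: cc_ball_def)
next
  case (Suc n)
  have eq: "real n *\<^sub>R h \<odot> h = real (Suc n) *\<^sub>R h"
    using exp_coords[of "real n" h 1] by (simp add: add.commute)
  have "cc_dist G (real n *\<^sub>R h) (real n *\<^sub>R h \<odot> h) < ennreal (r / 2)"
    using h[of "r / 2"] Suc.prems cc_dist_lmul[of "real n *\<^sub>R h" 0 h] by (simp add: cc_ball_def)
  moreover have "cc_dist G 0 (real n *\<^sub>R h) < ennreal (r / 2)"
    using Suc.IH[of "r / 2"] Suc.prems by (simp add: cc_ball_def)
  ultimately have "cc_dist G 0 (real n *\<^sub>R h \<odot> h) < ennreal (r / 2 + r / 2)"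
    using Suc.prems by (intro cc_dist_triangle) auto
  then show ?case
    by (simp add: cc_ball_def eq)
qed

text \<open>If \<open>h\<close> were nonzero, the translates of a small Euclidean ball
  \<open>?V\<close> by widely spaced multiples of \<open>h\<close> would be disjoint, of equal
  positive measure, and all inside the unit ball, whose measure is finite.\<close>

lemma cc_dist_separates:
  assumes h: "\<And>r. 0 < r \<Longrightarrow> h \<in> cc_ball G 0 r"
  shows "h = 0"
proof (rule ccontr)
  assume "h \<noteq> 0"
  obtain e where e: "0 < e" "ball 0 e \<subseteq> cc_ball G 0 (1 / 2)"
    using cc_ball_nbhd_0[of "1 / 2"] by auto
  let ?V = "cball 0 (e / 2) :: 'a set"
  have V: "?V \<subseteq> cc_ball G 0 (1 / 2)"
    using e by auto
  have "compact ((\<lambda>(a, b). a \<odot> b) ` ((\<lambda>(a, b). (a, - b)) ` (?V \<times> ?V)))"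
    by (intro compact_continuous_image smooth_continuous_on[OF smooth_mul] compact_Times compact_cball)
       (auto simp: case_prod_beta intro!: continuous_intros)
  then have "bounded ((\<lambda>(a, b). a \<odot> b) ` ((\<lambda>(a, b). (a, - b)) ` (?V \<times> ?V)))"
    by (rule compact_imp_bounded)
  then obtain R where "\<forall>x\<in>(\<lambda>(a, b). a \<odot> b) ` ((\<lambda>(a, b). (a, - b)) ` (?V \<times> ?V)). norm x \<le> R"
    unfolding bounded_iff by blast
  then have R: "norm (a \<odot> - b) \<le> R" if "a \<in> ?V" "b \<in> ?V" for a b
    using that by (simp add: image_image ball_Un)
  \<comment> \<open>If two translates met, the difference of their multiples would equal some
    \<open>a \<odot> - b\<close> with \<open>a\<close> and \<open>b\<close> in \<open>?V\<close>, of
    norm at most \<open>R\<close>; spacing by \<open>k\<close> excludes this.\<close>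
  obtain k :: nat where k: "R < real k * norm h"
    using \<open>h \<noteq> 0\<close> ex_less_of_nat_mult[of "norm h" R] by auto
  let ?S = "\<lambda>j::nat. gmul G (real (j * k) *\<^sub>R h) ` ?V"
  have Vm: "?V \<in> lmeasurable" "0 < measure lebesgue ?V"
    using e(1) content_cball_pos[of "e / 2" 0] by auto
  have disj: "disjoint_family ?S"
  proof -
    have "?S i \<inter> ?S j = {}" if "i < j" for i j
    proof (rule ccontr)
      assume "\<not> ?thesis"
      then obtain a b where ab: "a \<in> ?V" "b \<in> ?V" "(real (i * k) *\<^sub>R h) \<odot> a = (real (j * k) *\<^sub>R h) \<odot> b"
        by auto
      have "- (real (i * k) *\<^sub>R h) \<odot> (real (j * k) *\<^sub>R h) = real ((j - i) * k) *\<^sub>R h"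
        using exp_coords[of "- real (i * k)" h "real (j * k)"] that
        by (simp add: of_nat_diff algebra_simps)
      moreover have "- (real (i * k) *\<^sub>R h) \<odot> (real (j * k) *\<^sub>R h) = a \<odot> - b"
        using ab(3) by (metis grp.assoc grp.left_inverse grp.left_neutral grp.right_inverse grp.right_neutral)
      ultimately have "real ((j - i) * k) * norm h \<le> R"
        using R[OF ab(1,2)] by (metis abs_of_nat norm_scaleR)
      moreover have "1 \<le> j - i"
        using that by linarith
      then have "1 * k \<le> (j - i) * k"
        by (rule mult_le_mono1)
      then have "real k * norm h \<le> real ((j - i) * k) * norm h"
        by (intro mult_right_mono of_nat_mono) auto
      ultimately show False using k by simp
    qed
    then show ?thesis
      unfolding disjoint_family_on_def by (metis Int_commute linorder_neqE_nat)
  qed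
  have sub: "?S j \<subseteq> cc_ball G 0 1" for j
  proof
    fix y
    assume "y \<in> ?S j"
    then obtain v where v: "v \<in> ?V" "y = real (j * k) *\<^sub>R h \<odot> v" by blast
    have "cc_dist G 0 (real (j * k) *\<^sub>R h) < ennreal (1 / 2)"
      using cc_dist_0_multiple[OF h, of "1 / 2" "j * k"] by (simp add: cc_ball_def)
    moreover have "cc_dist G (real (j * k) *\<^sub>R h) y < ennreal (1 / 2)"
      using v V cc_dist_lmul[of "real (j * k) *\<^sub>R h" 0 v] by (auto simp: cc_ball_def)
    ultimately have "cc_dist G 0 y < ennreal (1 / 2 + 1 / 2)"
      by (intro cc_dist_triangle) auto
    then show "y \<in> cc_ball G 0 1" by (simp add: cc_ball_def)
  qed
  have "real n * measure lebesgue ?V \<le> measure lebesgue (cc_ball G 0 1)" for n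
  proof -
    have "real n * measure lebesgue ?V = (\<Sum>j<n. measure lebesgue (?S j))"
      using measure_lmul(2)[OF Vm(1)] by simp
    also have "\<dots> = measure lebesgue (\<Union>j<n. ?S j)"
      using fmeasurableD[OF measure_lmul(1)[OF Vm(1)]] fmeasurableD2[OF measure_lmul(1)[OF Vm(1)]] disj
      by (intro measure_finite_Union[symmetric]) (simp_all add: disjoint_family_on_def image_subset_iff)
    also have "\<dots> \<le> measure lebesgue (cc_ball G 0 1)"
      using sub measure_lmul(1)[OF Vm(1)]
      by (intro measure_mono_fmeasurable unit_ball_lmeasurable sets.finite_UN) auto
    finally show ?thesis .
  qed
  then show False
    using ex_less_of_nat_mult[OF Vm(2), of "measure lebesgue (cc_ball G 0 1)"] by (meson not_le)
qed

lemma continuous_on_dil_param: "continuous_on S (\<lambda>r. dil r x)"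
  unfolding dil_def by (intro continuous_intros)

text \<open>Otherwise arbitrarily small balls reach outside the Euclidean ball. Contracting such
  points by dilations keeps them in the ball and moves them onto the sphere of radius
  \<open>e\<close>; a limit point there has distance 0 from the identity, against
  \<open>cc_dist_separates\<close>.\<close>

lemma small_cc_ball_0:
  assumes "0 < e"
  obtains r where "0 < r" "cc_ball G 0 r \<subseteq> ball 0 e"
proof (rule ccontr)
  assume "\<not> thesis"
  then have no: "\<And>r. 0 < r \<Longrightarrow> \<exists>x\<in>cc_ball G 0 r. e \<le> norm x"
    using that by (metis linorder_not_le mem_ball_0 subsetI)
  have "\<exists>y. norm y = e \<and> y \<in> cc_ball G 0 (inverse (real (Suc n)))" for n
  proof -
    have pos: "0 < inverse (real (Suc n))" by simp
    obtain x where x: "x \<in> cc_ball G 0 (inverse (real (Suc n)))" "e \<le> norm x"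
      using no[OF pos] by blast
    have "continuous_on {0..1} (\<lambda>r. norm (dil r x))"
      by (intro continuous_on_norm continuous_on_dil_param)
    moreover have "dil 0 x = 0"
      unfolding dil_def by (intro sum.neutral) auto
    ultimately obtain r where r: "0 \<le> r" "r \<le> 1" "norm (dil r x) = e"
      using IVT'[of "\<lambda>r. norm (dil r x)" 0 e 1] x(2) assms by auto
    have "r \<noteq> 0"
      using r(3) assms \<open>dil 0 x = 0\<close> by auto
    then have "dil r x \<in> cc_ball G 0 (r * inverse (real (Suc n)))"
      using cc_ball_dil[of r "inverse (real (Suc n))"] r x(1) by auto
    moreover have "ennreal (r * inverse (real (Suc n))) \<le> ennreal (inverse (real (Suc n)))"
      using r by (intro ennreal_leI mult_left_le_one_le) auto
    ultimately have "dil r x \<in> cc_ball G 0 (inverse (real (Suc n)))"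
      unfolding cc_ball_def mem_Collect_eq by (rule less_le_trans)
    then show ?thesis using r(3) by blast
  qed
  then obtain y where y: "\<And>n. norm (y n) = e" "\<And>n. y n \<in> cc_ball G 0 (inverse (real (Suc n)))"
    by metis
  obtain l s where l: "l \<in> sphere 0 e" "strict_mono s" "(y \<circ> s) \<longlonglongrightarrow> l"
    using compact_sphere[of 0 e] y(1) unfolding compact_def by (metis dist_0_norm mem_sphere)
  have "l \<in> cc_ball G 0 r" if rpos: "0 < r" for r
  proof -
    obtain \<epsilon> where \<epsilon>: "0 < \<epsilon>" "ball 0 \<epsilon> \<subseteq> cc_ball G 0 (r / 2)"
      using cc_ball_nbhd_0[of "r / 2"] rpos by auto
    have cont: "isCont (\<lambda>(a, b). a \<odot> b) (- l, l)"
      using smooth_continuous_on[OF smooth_mul, of UNIV] by (simp add: continuous_on_eq_continuous_at)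
    have "(\<lambda>n. (- ((y \<circ> s) n), l)) \<longlonglongrightarrow> (- l, l)"
      by (intro tendsto_intros l)
    from isCont_tendsto_compose[OF cont this] have "(\<lambda>n. - y (s n) \<odot> l) \<longlonglongrightarrow> 0"
      by simp
    then have "\<forall>\<^sub>F n in sequentially. - y (s n) \<odot> l \<in> ball 0 \<epsilon>"
      using \<epsilon>(1) by (auto simp: tendsto_iff dist_commute)
    moreover have "\<forall>\<^sub>F n in sequentially. inverse (real (Suc n)) < r / 2"
      using LIMSEQ_inverse_real_of_nat that by (intro order_tendstoD) auto
    ultimately obtain n where n: "- y (s n) \<odot> l \<in> ball 0 \<epsilon>" "inverse (real (Suc n)) < r / 2"
      using eventually_happens'[OF sequentially_bot eventually_conj] by blast
    have le: "inverse (real (Suc (s n))) \<le> inverse (real (Suc n))"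
      using seq_suble[OF l(2), of n] by (intro le_imp_inverse_le) auto
    then have "ennreal (inverse (real (Suc (s n)))) \<le> ennreal (r / 2)"
      by (intro ennreal_leI) (use n(2) le in linarith)
    then have "cc_dist G 0 (y (s n)) < ennreal (r / 2)"
      using y(2)[of "s n"] unfolding cc_ball_def by auto
    moreover have "cc_dist G (y (s n)) l < ennreal (r / 2)"
      using n(1) \<epsilon>(2) cc_dist_less_left[of "y (s n)" l] by (auto simp: cc_ball_def)
    ultimately have "cc_dist G 0 l < ennreal (r / 2 + r / 2)"
      using that by (intro cc_dist_triangle) auto
    then show ?thesis
      by (simp add: cc_ball_def)
  qed
  then have "l = 0"
    by (rule cc_dist_separates)
  then show False
    using l(1) assms by simp
qed

lemma small_cc_ball:
  assumes "0 < e"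
  obtains r where "0 < r" "\<And>z \<delta>. 0 < \<delta> \<Longrightarrow> \<delta> < r \<Longrightarrow> x \<in> cc_ball G z \<delta> \<Longrightarrow> cc_ball G z \<delta> \<subseteq> ball x e"
proof -
  have "isCont (gmul G x) 0"
    using continuous_on_lmul[of UNIV x] by (simp add: continuous_on_eq_continuous_at)
  then obtain d where d: "0 < d" "\<And>u. norm u < d \<Longrightarrow> dist (x \<odot> u) x < e"
    using assms unfolding continuous_at_eps_delta by (metis dist_0_norm dist_commute grp.right_neutral)
  obtain r where r: "0 < r" "cc_ball G 0 r \<subseteq> ball 0 d"
    using small_cc_ball_0[OF d(1)] by blast
  \<comment> \<open>The ball need not be centred at \<open>x\<close>: its points are within twice
    its radius of \<open>x\<close>, whence the bound \<open>r / 2\<close>.\<close>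
  have "cc_ball G z \<delta> \<subseteq> ball x e" if \<delta>: "0 < \<delta>" "\<delta> < r / 2" "x \<in> cc_ball G z \<delta>" for z \<delta>
  proof
    fix y
    assume "y \<in> cc_ball G z \<delta>"
    then have "cc_dist G x y < ennreal (\<delta> + \<delta>)"
      using \<delta> cc_dist_sym[of z x] by (intro cc_dist_triangle[of x z]) (auto simp: cc_ball_def)
    also have "\<dots> \<le> ennreal r"
      using \<delta> by (intro ennreal_leI) auto
    finally have "norm (- x \<odot> y) < d"
      using r(2) cc_dist_less_left[of x y] by (auto simp: cc_ball_def)
    then have "dist (x \<odot> (- x \<odot> y)) x < e"
      by (rule d(2))
    then show "y \<in> ball x e"
      by (simp add: grp.assoc[symmetric] dist_commute)
  qed
  then show ?thesis
    using that[of "r / 2"] r(1) by auto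
qed

end

section \<open>Differentiation along balls\<close>

lemma open_compact_exhaustion:
  fixes S :: "'a::euclidean_space set"
  assumes "open S"
  obtains C :: "nat \<Rightarrow> 'a set" where "incseq C" "\<And>n. compact (C n)" "\<And>n. C n \<subseteq> S" "(\<Union>n. C n) = S"
proof -
  have "\<exists>C :: nat \<Rightarrow> 'a set. incseq C \<and> (\<forall>n. compact (C n)) \<and> (\<forall>n. C n \<subseteq> S) \<and> (\<Union>n. C n) = S"
  proof (rule open_Union_compact_subsets[OF assms])
    fix C :: "nat \<Rightarrow> 'a set"
    assume C: "\<And>n. compact (C n)" "\<And>n. C n \<subseteq> S" "\<And>n. C n \<subseteq> interior (C (Suc n))" "\<Union>(range C) = S"
    have "incseq C"
      using C(3) interior_subset by (intro incseq_SucI) blast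
    then show "\<exists>C :: nat \<Rightarrow> 'a set. incseq C \<and> (\<forall>n. compact (C n)) \<and> (\<forall>n. C n \<subseteq> S) \<and> (\<Union>n. C n) = S"
      using C(1,2,4) by (intro exI[of _ C]) simp
  qed
  then show ?thesis
    by (elim exE conjE) (rule that, simp_all)
qed

context carnot_group_ball
begin

text \<open>The constant 3 arises here: a point of the smaller ball is within
  \<open>r' + 2 * r\<close> of the centre of the larger one.\<close>

lemma cc_ball_enlarge:
  assumes "cc_ball G z r \<inter> cc_ball G z' r' \<noteq> {}" "0 < r" "r \<le> r'"
  shows "cc_ball G z r \<subseteq> cc_ball G z' (3 * r')"
proof
  fix y
  assume y: "y \<in> cc_ball G z r"
  obtain u where u: "u \<in> cc_ball G z r" "u \<in> cc_ball G z' r'"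
    using assms(1) by blast
  have "cc_dist G u y < ennreal (r + r)"
    using y u assms(2) cc_dist_sym[of z u] by (intro cc_dist_triangle[of u z]) (auto simp: cc_ball_def)
  then have "cc_dist G z' y < ennreal (r' + (r + r))"
    using u assms by (intro cc_dist_triangle[of z' u]) (auto simp: cc_ball_def)
  also have "\<dots> \<le> ennreal (3 * r')"
    using assms by (intro ennreal_leI) auto
  finally show "y \<in> cc_ball G z' (3 * r')"
    by (simp add: cc_ball_def)
qed

text \<open>Balls are handled as pairs of centre and radius, since the set alone need not determine
  either.\<close>

abbreviation ball_of :: "'a \<times> real \<Rightarrow> 'a set" where
  "ball_of p \<equiv> cc_ball G (fst p) (snd p)"

text \<open>Greedy selection: take a ball of maximal radius, discard the balls that meet it, and
  repeat with the rest. The discarded ones lie in its threefold enlargement.\<close>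

lemma Vitali_finite:
  assumes "finite F" "\<And>p. p \<in> F \<Longrightarrow> 0 < snd p"
  shows "\<exists>D\<subseteq>F. disjoint_family_on ball_of D \<and>
    (\<forall>p\<in>F. \<exists>q\<in>D. ball_of p \<subseteq> cc_ball G (fst q) (3 * snd q))"
  using assms
proof (induction "card F" arbitrary: F rule: less_induct)
  case (less F)
  show ?case
  proof (cases "F = {}")
    case True
    then show ?thesis by (auto simp: disjoint_family_on_def)
  next
    case False
    have "finite (snd ` F)" "snd ` F \<noteq> {}"
      using less.prems False by auto
    from Max_in[OF this] obtain p where p: "p \<in> F" "snd p = Max (snd ` F)"
      by auto
    have max: "snd q \<le> snd p" if "q \<in> F" for q
      using p(2) that less.prems(1) by simp
    define H where "H = {q \<in> F. ball_of q \<inter> ball_of p = {}}"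
    have "fst p \<in> ball_of p"
      using less.prems(2)[OF p(1)] by (simp add: cc_ball_def)
    then have "p \<notin> H"
      by (auto simp: H_def)
    then have "H \<subset> F"
      using p(1) by (auto simp: H_def)
    then have card: "card H < card F"
      using less.prems(1) by (rule psubset_card_mono[rotated])
    have H: "finite H" "\<And>q. q \<in> H \<Longrightarrow> 0 < snd q"
      using less.prems by (auto simp: H_def)
    obtain D where D: "D \<subseteq> H" "disjoint_family_on ball_of D"
      "\<forall>q\<in>H. \<exists>d\<in>D. ball_of q \<subseteq> cc_ball G (fst d) (3 * snd d)"
      using less.hyps[OF card H] by blast
    have "insert p D \<subseteq> F"
      using D(1) p(1) by (auto simp: H_def)
    moreover have "disjoint_family_on ball_of (insert p D)"
      using D(1,2) unfolding disjoint_family_on_def H_def by blast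
    moreover have "\<exists>d\<in>insert p D. ball_of q \<subseteq> cc_ball G (fst d) (3 * snd d)" if q: "q \<in> F" for q
    proof (cases "q \<in> H")
      case True
      then show ?thesis using D(3) by blast
    next
      case False
      then have "ball_of q \<inter> ball_of p \<noteq> {}"
        using q by (auto simp: H_def)
      then have "ball_of q \<subseteq> cc_ball G (fst p) (3 * snd p)"
        using cc_ball_enlarge less.prems(2)[OF q] max[OF q] by blast
      then show ?thesis by blast
    qed
    ultimately show ?thesis by blast
  qed
qed

text \<open>The family may be uncountable. Each compact part of its union is covered by finitely
  many balls, from which \<open>Vitali_finite\<close> selects disjoint ones; tripling costs the
  constant and disjointness lets the integrals add up. An exhaustion by compact sets gives the whole
  union.\<close>

lemma maximal_inequality:
  assumes f: "f \<in> borel_measurable lebesgue" and t: "0 \<le> t"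
    and F: "\<And>p. p \<in> F \<Longrightarrow> 0 < snd p \<and> ennreal t * emeasure lebesgue (ball_of p) \<le> (\<integral>\<^sup>+x\<in>ball_of p. f x \<partial>lebesgue)"
  shows "ennreal t * emeasure lebesgue (\<Union>p\<in>F. ball_of p) \<le> ennreal \<bar>jacobian (dil 3)\<bar> * (\<integral>\<^sup>+x. f x \<partial>lebesgue)"
proof -
  let ?C = "ennreal \<bar>jacobian (dil 3)\<bar>" and ?U = "\<Union>p\<in>F. ball_of p"
  have meas: "cc_ball G z r \<in> sets lebesgue" for z r
    using open_cc_ball[of z r] by simp
  have openU: "open ?U"
    using open_cc_ball by blast
  have compact: "ennreal t * emeasure lebesgue K \<le> ?C * (\<integral>\<^sup>+x. f x \<partial>lebesgue)"
    if K: "compact K" "K \<subseteq> ?U" for K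
  proof -
    obtain E where E: "E \<subseteq> F" "finite E" "K \<subseteq> (\<Union>p\<in>E. ball_of p)"
      using compactE_image[OF K(1), of F ball_of] open_cc_ball K(2) by metis
    obtain D where D: "D \<subseteq> E" "disjoint_family_on ball_of D"
      "\<forall>p\<in>E. \<exists>q\<in>D. ball_of p \<subseteq> cc_ball G (fst q) (3 * snd q)"
      using Vitali_finite[OF E(2)] F E(1) by blast
    have "finite D"
      using D(1) E(2) by (rule finite_subset)
    have tripling: "emeasure lebesgue (cc_ball G (fst q) (3 * snd q)) = ?C * emeasure lebesgue (ball_of q)" if "q \<in> D" for q
    proof -
      have "0 < snd q" using F that D(1) E(1) by blast
      then show ?thesis
        using measure_cc_ball_tripling[of "snd q" "fst q"]
        by (simp add: emeasure_eq_measure2 cc_ball_lmeasurable ennreal_mult)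
    qed
    have "K \<subseteq> (\<Union>q\<in>D. cc_ball G (fst q) (3 * snd q))"
    proof
      fix x assume "x \<in> K"
      then obtain p where "p \<in> E" "x \<in> ball_of p" using E(3) by blast
      then show "x \<in> (\<Union>q\<in>D. cc_ball G (fst q) (3 * snd q))" using D(3) by blast
    qed
    then have "emeasure lebesgue K \<le> emeasure lebesgue (\<Union>q\<in>D. cc_ball G (fst q) (3 * snd q))"
      using meas \<open>finite D\<close> by (intro emeasure_mono sets.finite_UN) auto
    also have "\<dots> \<le> (\<Sum>q\<in>D. emeasure lebesgue (cc_ball G (fst q) (3 * snd q)))"
      using meas \<open>finite D\<close> by (intro emeasure_subadditive_finite) auto
    also have "\<dots> = ?C * (\<Sum>q\<in>D. emeasure lebesgue (ball_of q))"
      by (simp add: tripling sum_distrib_left)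
    finally have "ennreal t * emeasure lebesgue K \<le> ennreal t * (?C * (\<Sum>q\<in>D. emeasure lebesgue (ball_of q)))"
      by (rule mult_left_mono) simp
    also have "\<dots> = ?C * (\<Sum>q\<in>D. ennreal t * emeasure lebesgue (ball_of q))"
      by (simp add: sum_distrib_left mult.left_commute)
    also have "\<dots> \<le> ?C * (\<Sum>q\<in>D. \<integral>\<^sup>+x\<in>ball_of q. f x \<partial>lebesgue)"
      using F D(1) E(1) by (intro mult_left_mono sum_mono) auto
    also have "(\<Sum>q\<in>D. \<integral>\<^sup>+x\<in>ball_of q. f x \<partial>lebesgue) = (\<Sum>q\<in>D. emeasure (density lebesgue f) (ball_of q))"
      using f meas by (simp add: emeasure_density)
    also have "\<dots> = emeasure (density lebesgue f) (\<Union>q\<in>D. ball_of q)"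
      using meas \<open>finite D\<close> D(2) by (intro sum_emeasure) auto
    also have "\<dots> \<le> emeasure (density lebesgue f) UNIV"
      by (rule emeasure_mono) auto
    also have "\<dots> = (\<integral>\<^sup>+x. f x \<partial>lebesgue)"
      using f by (simp add: emeasure_density)
    finally show ?thesis
      by (simp add: mult_left_mono)
  qed
  obtain C where C: "incseq C" "\<And>n::nat. compact (C n)" "\<And>n. C n \<subseteq> ?U" "(\<Union>n. C n) = ?U"
    using open_compact_exhaustion[OF openU] by blast
  have "range C \<subseteq> sets lebesgue"
    using C(2) by (auto simp: lmeasurable_compact fmeasurableD)
  then have "emeasure lebesgue ?U = (SUP n. emeasure lebesgue (C n))"
    using SUP_emeasure_incseq[of C lebesgue] C(1,4) by simp
  then have "ennreal t * emeasure lebesgue ?U = (SUP n. ennreal t * emeasure lebesgue (C n))"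
    by (simp add: SUP_mult_left_ennreal)
  then show ?thesis
    using compact[OF C(2,3)] by (simp add: SUP_least)
qed

text \<open>Near a point of \<open>A\<close> the bad balls lie in an open \<open>W\<close> that
  contains \<open>A\<close>, so the maximal inequality for \<open>f\<close> restricted to
  \<open>W - A\<close> bounds the measure of the bad points by a multiple of an arbitrary
  \<open>e\<close>. The assumption \<open>outer\<close> stands in for integrability because the
  constant density 1 will be used as well.\<close>

lemma AE_small_ball_mass:
  assumes f: "f \<in> borel_measurable lebesgue" and A: "A \<in> sets lebesgue" and t: "0 < t"
    and outer: "\<And>e. 0 < e \<Longrightarrow> \<exists>W. open W \<and> A \<subseteq> W \<and> (\<integral>\<^sup>+x\<in>W - A. f x \<partial>lebesgue) \<le> ennreal e"
  shows "AE x in lebesgue. x \<in> A \<longrightarrow> (\<exists>r>0. \<forall>z \<delta>. 0 < \<delta> \<longrightarrow> \<delta> < r \<longrightarrow> x \<in> cc_ball G z \<delta> \<longrightarrow>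
    (\<integral>\<^sup>+x\<in>cc_ball G z \<delta> - A. f x \<partial>lebesgue) < ennreal t * emeasure lebesgue (cc_ball G z \<delta>))"
proof -
  let ?bad = "\<lambda>p. ennreal t * emeasure lebesgue (ball_of p) \<le> (\<integral>\<^sup>+x\<in>ball_of p - A. f x \<partial>lebesgue)"
  let ?N = "{x \<in> A. \<forall>r>0. \<exists>z \<delta>. 0 < \<delta> \<and> \<delta> < r \<and> x \<in> cc_ball G z \<delta> \<and> ?bad (z, \<delta>)}"
  let ?C = "\<bar>jacobian (dil 3)\<bar>"
  have cover: "\<exists>U. U \<in> sets lebesgue \<and> ?N \<subseteq> U \<and> ennreal t * emeasure lebesgue U \<le> ennreal ?C * ennreal e" if epos: "0 < e" for e
  proof -
    obtain W where W: "open W" "A \<subseteq> W" "(\<integral>\<^sup>+x\<in>W - A. f x \<partial>lebesgue) \<le> ennreal e"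
      using outer[OF epos] by blast
    have WA: "W - A \<in> sets lebesgue"
      using W(1) A by auto
    let ?g = "\<lambda>x. f x * indicator (W - A) x"
    define F where "F = {p. 0 < snd p \<and> ball_of p \<subseteq> W \<and> ?bad p}"
    have g: "?g \<in> borel_measurable lebesgue"
      using f WA by (intro borel_measurable_times_ennreal) auto
    have "ennreal t * emeasure lebesgue (\<Union>p\<in>F. ball_of p) \<le> ennreal ?C * (\<integral>\<^sup>+x. ?g x \<partial>lebesgue)"
    proof (rule maximal_inequality[OF g])
      fix p assume "p \<in> F"
      then have p: "0 < snd p" "ball_of p \<subseteq> W" "?bad p" by (auto simp: F_def)
      have "(\<integral>\<^sup>+x\<in>ball_of p - A. f x \<partial>lebesgue) = (\<integral>\<^sup>+x\<in>ball_of p. ?g x \<partial>lebesgue)"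
        using p(2) by (intro nn_integral_cong) (auto simp: indicator_def)
      then show "0 < snd p \<and> ennreal t * emeasure lebesgue (ball_of p) \<le> (\<integral>\<^sup>+x\<in>ball_of p. ?g x \<partial>lebesgue)"
        using p by simp
    qed (use t in simp)
    also have "\<dots> \<le> ennreal ?C * ennreal e"
      using W(3) by (intro mult_left_mono) auto
    finally have "ennreal t * emeasure lebesgue (\<Union>p\<in>F. ball_of p) \<le> ennreal ?C * ennreal e" .
    moreover have "open (\<Union>p\<in>F. ball_of p)"
      using open_cc_ball by blast
    then have "(\<Union>p\<in>F. ball_of p) \<in> sets lebesgue" by simp
    moreover have "?N \<subseteq> (\<Union>p\<in>F. ball_of p)"
    proof
      fix x assume x: "x \<in> ?N"
      then have "x \<in> W" using W(2) by blast
      then obtain e where e: "0 < e" "ball x e \<subseteq> W"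
        using W(1) open_contains_ball by blast
      obtain r where r: "0 < r" "\<And>z \<delta>. 0 < \<delta> \<Longrightarrow> \<delta> < r \<Longrightarrow> x \<in> cc_ball G z \<delta> \<Longrightarrow> cc_ball G z \<delta> \<subseteq> ball x e"
        using small_cc_ball[OF e(1)] by metis
      obtain z \<delta> where z: "0 < \<delta>" "\<delta> < r" "x \<in> cc_ball G z \<delta>" "?bad (z, \<delta>)"
        using x r(1) by blast
      then have "(z, \<delta>) \<in> F"
        using r(2)[OF z(1-3)] e(2) by (auto simp: F_def)
      then show "x \<in> (\<Union>p\<in>F. ball_of p)"
        using z(3) by force
    qed
    ultimately show ?thesis by blast
  qed
  have "negligible ?N"
    unfolding negligible_outer
  proof (intro allI impI)
    fix e :: real
    assume "0 < e"
    \<comment> \<open>Chosen such that the bound \<open>?C * e' / t\<close> is at most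
      \<open>e / 2\<close>; the added 1 keeps the denominator positive.\<close>
    define e' where "e' = t * (e / 2) / (1 + ?C)"
    have C1: "0 < 1 + ?C" by (simp add: add_pos_nonneg)
    then have "0 < e'"
      using \<open>0 < e\<close> t by (simp add: e'_def)
    obtain U where U: "U \<in> sets lebesgue" "?N \<subseteq> U" "ennreal t * emeasure lebesgue U \<le> ennreal ?C * ennreal e'"
      using cover[OF \<open>0 < e'\<close>] by blast
    have "?C * e' \<le> (1 + ?C) * e'"
      using \<open>0 < e'\<close> by simp
    moreover have "(1 + ?C) * e' = t * (e / 2)"
    proof -
      have "k * (y / k) = y" if "0 < k" for k y :: real
        using that by simp
      from this[OF C1] show ?thesis
        unfolding e'_def .
    qed
    ultimately have "?C * e' \<le> t * (e / 2)"
      by simp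
    then have le: "ennreal t * emeasure lebesgue U \<le> ennreal t * ennreal (e / 2)"
    proof -
      have "ennreal ?C * ennreal e' = ennreal (?C * e')"
        using \<open>0 < e'\<close> by (intro ennreal_mult[symmetric]) auto
      also have "\<dots> \<le> ennreal (t * (e / 2))"
        by (rule ennreal_leI) fact
      also have "\<dots> = ennreal t * ennreal (e / 2)"
        using t \<open>0 < e\<close> by (intro ennreal_mult) auto
      finally show ?thesis
        using U(3) by (rule order_trans[rotated])
    qed
    then have "emeasure lebesgue U \<le> ennreal (e / 2)"
      using t by (subst (asm) ennreal_mult_le_mult_iff) auto
    then have "U \<in> lmeasurable"
      using U(1) unfolding fmeasurable_def by (auto intro: order.strict_trans1)
    moreover have "measure lebesgue U \<le> e / 2"
      unfolding measure_def by (rule enn2real_leI) (use \<open>0 < e\<close> \<open>emeasure lebesgue U \<le> ennreal (e / 2)\<close> in auto)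
    ultimately show "\<exists>T. ?N \<subseteq> T \<and> T \<in> lmeasurable \<and> measure lebesgue T < e"
      using U(2) \<open>0 < e\<close> by (intro exI[of _ U]) auto
  qed
  then have "AE x in lebesgue. x \<notin> ?N"
    by (intro AE_not_in) (simp add: negligible_iff_null_sets)
  then show ?thesis
    by eventually_elim (force simp: not_le)
qed

text \<open>Absolute continuity of the finite measure with density \<open>f\<close>: along a
  decreasing sequence of open sets closing in on \<open>A\<close> up to a null set, the mass outside
  \<open>A\<close> tends to 0.\<close>

lemma outer_open_density:
  assumes f: "f \<in> borel_measurable lebesgue" "(\<integral>\<^sup>+x. f x \<partial>lebesgue) < \<infinity>" and A: "A \<in> sets lebesgue" and "0 < e"
  shows "\<exists>W. open W \<and> A \<subseteq> W \<and> (\<integral>\<^sup>+x\<in>W - A. f x \<partial>lebesgue) \<le> ennreal e"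
proof -
  have "\<exists>U. open U \<and> A \<subseteq> U \<and> emeasure lebesgue (U - A) < ennreal (inverse (real (Suc n)))" for n
    using sets_lebesgue_outer_open[OF A, of "inverse (real (Suc n))"] by (metis inverse_positive_iff_positive of_nat_0_less_iff zero_less_Suc)
  then obtain U where U: "\<And>n. open (U n)" "\<And>n. A \<subseteq> U n" "\<And>n. emeasure lebesgue (U n - A) < ennreal (inverse (real (Suc n)))"
    by metis
  \<comment> \<open>Finite intersections stay open and make the sequence decreasing, as continuity
    from above requires.\<close>
  define W where "W n = (\<Inter>k\<le>n. U k)" for n
  have W: "open (W n)" "A \<subseteq> W n" for n
    using U by (auto simp: W_def intro!: open_INT)
  let ?\<nu> = "density lebesgue f"
  have fin: "emeasure ?\<nu> B \<noteq> \<infinity>" for B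
  proof -
    have "emeasure ?\<nu> B \<le> emeasure ?\<nu> UNIV"
      using emeasure_space[of ?\<nu> B] by simp
    also have "\<dots> < \<infinity>"
      using f by (simp add: emeasure_density)
    finally show ?thesis by simp
  qed
  have lim: "(\<lambda>n. emeasure ?\<nu> (W n - A)) \<longlonglongrightarrow> emeasure ?\<nu> (\<Inter>n. W n - A)"
    using W(1) A fin by (intro Lim_emeasure_decseq) (auto simp: decseq_def W_def)
  have "emeasure lebesgue (\<Inter>n. W n - A) = 0"
  proof -
    have "emeasure lebesgue (\<Inter>n. W n - A) \<le> ennreal (inverse (real (Suc n)))" for n
    proof -
      have "emeasure lebesgue (\<Inter>n. W n - A) \<le> emeasure lebesgue (U n - A)"
        using U(1)[of n] A by (intro emeasure_mono) (auto simp: W_def)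
      then show ?thesis using U(3)[of n] by simp
    qed
    then have "emeasure lebesgue (\<Inter>n. W n - A) \<le> ennreal 0"
      by (intro tendsto_lowerbound[OF tendsto_ennrealI[OF LIMSEQ_inverse_real_of_nat]]) (auto intro: always_eventually)
    then show ?thesis by simp
  qed
  moreover have sets: "(\<Inter>n. W n - A) \<in> sets lebesgue"
    using W(1) A by (intro sets.countable_INT) auto
  ultimately have "(\<Inter>n. W n - A) \<in> null_sets lebesgue"
    by (simp add: null_sets_def)
  then have "emeasure ?\<nu> (\<Inter>n. W n - A) = 0"
    using f(1) sets by (simp only: emeasure_density nn_integral_null_set)
  with lim have "(\<lambda>n. emeasure ?\<nu> (W n - A)) \<longlonglongrightarrow> 0" by simp
  then have "\<forall>\<^sub>F n in sequentially. emeasure ?\<nu> (W n - A) < ennreal e"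
    using \<open>0 < e\<close> by (intro order_tendstoD) auto
  then obtain n where "emeasure ?\<nu> (W n - A) < ennreal e"
    using eventually_happens'[OF sequentially_bot] by blast
  moreover have "W n - A \<in> sets lebesgue"
    using W(1)[of n] A by auto
  ultimately show ?thesis
    using W f by (auto simp: emeasure_density intro!: exI[of _ "W n"])
qed

text \<open>Almost every point of a sublevel or superlevel set of \<open>f\<close> sees little of
  the complement in small balls. Doing this for all rational levels squeezes the mean of
  \<open>f\<close> between levels close to \<open>f x\<close>.\<close>

lemma Lebesgue_differentiation:
  fixes f :: "'a \<Rightarrow> real"
  assumes f: "f \<in> borel_measurable lebesgue" "\<And>x. 0 \<le> f x" and fin: "(\<integral>\<^sup>+x. ennreal (f x) \<partial>lebesgue) < \<infinity>"
  shows "AE x in lebesgue. \<forall>e>0. \<exists>r>0. \<forall>z \<delta>. 0 < \<delta> \<longrightarrow> \<delta> < r \<longrightarrow> x \<in> cc_ball G z \<delta> \<longrightarrow>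
    \<bar>enn2real (\<integral>\<^sup>+x\<in>cc_ball G z \<delta>. ennreal (f x) \<partial>lebesgue) - f x * measure lebesgue (cc_ball G z \<delta>)\<bar>
      \<le> e * measure lebesgue (cc_ball G z \<delta>)"
proof -
  let ?J = "\<lambda>B. \<integral>\<^sup>+x\<in>B. ennreal (f x) \<partial>lebesgue" and ?m = "measure lebesgue"
  let ?small = "\<lambda>x P. \<exists>r>0. \<forall>z \<delta>. 0 < \<delta> \<longrightarrow> \<delta> < r \<longrightarrow> x \<in> cc_ball G z \<delta> \<longrightarrow> P (cc_ball G z \<delta>)"
  have f': "(\<lambda>x. ennreal (f x)) \<in> borel_measurable lebesgue"
    using f(1) by measurable
  have J_fin: "?J B < \<infinity>" for B
  proof -
    have "?J B \<le> (\<integral>\<^sup>+x. ennreal (f x) \<partial>lebesgue)"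
      by (intro nn_integral_mono) (auto simp: indicator_def)
    then show ?thesis using fin by (rule order.strict_trans1)
  qed
  have below: "{x. f x < a} \<in> sets lebesgue" and above: "{x. a < f x} \<in> sets lebesgue" for a
    using borel_measurable_less[OF f(1) borel_measurable_const[of a]] borel_measurable_less[OF borel_measurable_const[of a] f(1)]
    by simp_all
  \<comment> \<open>Inside the sublevel set \<open>f\<close> is below \<open>a\<close>, and outside
    it the mass is at most the share \<open>t\<close> of the ball.\<close>
  have upper: "AE x in lebesgue. f x < a \<longrightarrow> ?small x (\<lambda>B. enn2real (?J B) \<le> (a + t) * ?m B)"
    if t: "0 < t" for a t
  proof -
    let ?A = "{x. f x < a}"
    have "AE x in lebesgue. x \<in> ?A \<longrightarrow> ?small x (\<lambda>B. ?J (B - ?A) < ennreal t * emeasure lebesgue B)"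
      by (rule AE_small_ball_mass[OF f' below t outer_open_density[OF f' fin below]])
    then show ?thesis
    proof eventually_elim
      case (elim x)
      show ?case
      proof
        assume "f x < a"
        then have "0 \<le> a" using f(2)[of x] by linarith
        obtain r where r: "0 < r" "\<And>z \<delta>. 0 < \<delta> \<Longrightarrow> \<delta> < r \<Longrightarrow> x \<in> cc_ball G z \<delta> \<Longrightarrow>
            ?J (cc_ball G z \<delta> - ?A) < ennreal t * emeasure lebesgue (cc_ball G z \<delta>)"
          using elim \<open>f x < a\<close> by blast
        have "enn2real (?J (cc_ball G z \<delta>)) \<le> (a + t) * ?m (cc_ball G z \<delta>)"
          if z: "0 < \<delta>" "\<delta> < r" "x \<in> cc_ball G z \<delta>" for z \<delta>
        proof -
          let ?B = "cc_ball G z \<delta>"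
          have Bm: "?B \<in> lmeasurable" using cc_ball_lmeasurable z(1) .
          have BA: "?B - ?A \<in> sets lebesgue"
            using below[of a] Bm by auto
          have "?J ?B \<le> (\<integral>\<^sup>+x. ennreal a * indicator ?B x + ennreal (f x) * indicator (?B - ?A) x \<partial>lebesgue)"
            by (intro nn_integral_mono) (auto simp: indicator_def intro!: ennreal_leI)
          also have "\<dots> = (\<integral>\<^sup>+x. ennreal a * indicator ?B x \<partial>lebesgue) + ?J (?B - ?A)"
            using f' BA Bm by (intro nn_integral_add) auto
          also have "\<dots> = ennreal a * emeasure lebesgue ?B + ?J (?B - ?A)"
            using Bm by (simp add: nn_integral_cmult_indicator fmeasurableD)
          also have "\<dots> \<le> ennreal a * emeasure lebesgue ?B + ennreal t * emeasure lebesgue ?B"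
            using r(2)[OF z] by (intro add_left_mono) simp
          also have "\<dots> = ennreal ((a + t) * ?m ?B)"
            using t \<open>0 \<le> a\<close> Bm by (simp add: emeasure_eq_measure2 ennreal_mult[symmetric] ennreal_plus[symmetric] distrib_right del: ennreal_plus)
          finally show ?thesis
            using t \<open>0 \<le> a\<close> by (intro enn2real_leI) auto
        qed
        then show "?small x (\<lambda>B. enn2real (?J B) \<le> (a + t) * ?m B)"
          using r(1) by blast
      qed
    qed
  qed
  \<comment> \<open>Here the density is the constant 1: all but the share \<open>t\<close> of the
    ball lies in the superlevel set, where \<open>f\<close> exceeds \<open>a\<close>.\<close>
  have lower: "AE x in lebesgue. a < f x \<longrightarrow> ?small x (\<lambda>B. (a - a * t) * ?m B \<le> enn2real (?J B))"
    if t: "0 < t" and a: "0 \<le> a" for a t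
  proof -
    let ?A = "{x. a < f x}"
    have "AE x in lebesgue. x \<in> ?A \<longrightarrow> ?small x (\<lambda>B. (\<integral>\<^sup>+x\<in>B - ?A. 1 \<partial>lebesgue) < ennreal t * emeasure lebesgue B)"
    proof (rule AE_small_ball_mass[OF _ above t])
      fix e :: real
      assume "0 < e"
      obtain T where "open T" "?A \<subseteq> T" "emeasure lebesgue (T - ?A) < ennreal e"
        using sets_lebesgue_outer_open[OF above[of a] \<open>0 < e\<close>] by metis
      moreover have "T - ?A \<in> sets lebesgue"
        using \<open>open T\<close> above[of a] by auto
      ultimately show "\<exists>W. open W \<and> ?A \<subseteq> W \<and> (\<integral>\<^sup>+x\<in>W - ?A. 1 \<partial>lebesgue) \<le> ennreal e"
        by (intro exI[of _ T]) simp
    qed simp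
    then show ?thesis
    proof eventually_elim
      case (elim x)
      show ?case
      proof
        assume "a < f x"
        obtain r where r: "0 < r" "\<And>z \<delta>. 0 < \<delta> \<Longrightarrow> \<delta> < r \<Longrightarrow> x \<in> cc_ball G z \<delta> \<Longrightarrow>
            (\<integral>\<^sup>+x\<in>cc_ball G z \<delta> - ?A. 1 \<partial>lebesgue) < ennreal t * emeasure lebesgue (cc_ball G z \<delta>)"
          using elim \<open>a < f x\<close> by blast
        have "(a - a * t) * ?m (cc_ball G z \<delta>) \<le> enn2real (?J (cc_ball G z \<delta>))"
          if z: "0 < \<delta>" "\<delta> < r" "x \<in> cc_ball G z \<delta>" for z \<delta>
        proof -
          let ?B = "cc_ball G z \<delta>"
          have Bm: "?B \<in> lmeasurable" using cc_ball_lmeasurable z(1) .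
          have BA: "?B - ?A \<in> lmeasurable" "?B \<inter> ?A \<in> lmeasurable"
            using fmeasurable_Diff[OF Bm above[of a]] fmeasurable_Int_fmeasurable[OF Bm above[of a]] by simp_all
          have "?m (?B - ?A) \<le> t * ?m ?B"
            using r(2)[OF z] BA(1) Bm t
            by (simp add: emeasure_eq_measure2 fmeasurableD ennreal_mult[symmetric] ennreal_less_iff)
          moreover have "?m ?B = ?m (?B \<inter> ?A) + ?m (?B - ?A)"
            using measure_Un3[OF BA(2,1)] by (simp add: Int_Diff_Un Int_Diff_disjoint)
          ultimately have "a * ((1 - t) * ?m ?B) \<le> a * ?m (?B \<inter> ?A)"
            using a by (intro mult_left_mono) (auto simp: algebra_simps)
          also have "ennreal (a * ?m (?B \<inter> ?A)) = (\<integral>\<^sup>+x. ennreal a * indicator (?B \<inter> ?A) x \<partial>lebesgue)"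
            using BA(2) a by (simp add: nn_integral_cmult_indicator fmeasurableD emeasure_eq_measure2 ennreal_mult)
          then have "ennreal (a * ?m (?B \<inter> ?A)) \<le> ?J ?B"
            by (auto intro!: nn_integral_mono ennreal_leI simp: indicator_def)
          then have "a * ?m (?B \<inter> ?A) \<le> enn2real (?J ?B)"
            using J_fin[of ?B] a by (metis enn2real_ennreal enn2real_mono infinity_ennreal_def measure_nonneg mult_nonneg_nonneg)
          finally show ?thesis
            by (simp add: algebra_simps)
        qed
        then show "?small x (\<lambda>B. (a - a * t) * ?m B \<le> enn2real (?J B))"
          using r(1) by blast
      qed
    qed
  qed
  have "AE x in lebesgue. \<forall>a\<in>\<rat>. \<forall>t\<in>\<rat>. 0 < t \<longrightarrow> f x < a \<longrightarrow> ?small x (\<lambda>B. enn2real (?J B) \<le> (a + t) * ?m B)"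
    by (intro AE_ball_countable[THEN iffD2] countable_rat ballI AE_impI upper)
  moreover have "AE x in lebesgue. \<forall>a\<in>\<rat>. \<forall>t\<in>\<rat>. 0 < t \<and> 0 \<le> a \<longrightarrow> a < f x \<longrightarrow> ?small x (\<lambda>B. (a - a * t) * ?m B \<le> enn2real (?J B))"
    by (intro AE_ball_countable[THEN iffD2] countable_rat ballI AE_impI lower) auto
  ultimately show ?thesis
  proof eventually_elim
    case (elim x)
    show ?case
    proof (intro allI impI)
      fix e :: real
      assume e: "0 < e"
      obtain a where a: "a \<in> \<rat>" "f x < a" "a < f x + e / 2"
        using Rats_dense_in_real[of "f x" "f x + e / 2"] e by auto
      obtain t where t: "t \<in> \<rat>" "0 < t" "t < e / 2"
        using Rats_dense_in_real[of 0 "e / 2"] e by auto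
      obtain r1 where r1: "0 < r1" "\<And>z \<delta>. 0 < \<delta> \<Longrightarrow> \<delta> < r1 \<Longrightarrow> x \<in> cc_ball G z \<delta> \<Longrightarrow>
          enn2real (?J (cc_ball G z \<delta>)) \<le> (a + t) * ?m (cc_ball G z \<delta>)"
        using elim(1) a t by meson
      have "\<exists>r>0. \<forall>z \<delta>. 0 < \<delta> \<longrightarrow> \<delta> < r \<longrightarrow> x \<in> cc_ball G z \<delta> \<longrightarrow>
          (f x - e) * ?m (cc_ball G z \<delta>) \<le> enn2real (?J (cc_ball G z \<delta>))"
      \<comment> \<open>In the first case the lower bound is nonpositive. Otherwise a level
        \<open>b\<close> within \<open>e / 2\<close> below \<open>f x\<close> is positive, and the
        share \<open>s\<close> can be chosen such that \<open>b * s\<close> costs less than the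
        other \<open>e / 2\<close>.\<close>
      proof (cases "f x \<le> e")
        case True
        then have "(f x - e) * ?m B \<le> enn2real (?J B)" for B
          by (intro order.trans[OF mult_nonpos_nonneg]) auto
        then show ?thesis by (intro exI[of _ 1]) auto
      next
        case False
        obtain b where b: "b \<in> \<rat>" "f x - e / 2 < b" "b < f x"
          using Rats_dense_in_real[of "f x - e / 2" "f x"] e by auto
        have "0 < b" using b(2) False e by linarith
        obtain s where s: "s \<in> \<rat>" "0 < s" "s < (e / 2) / b"
          using Rats_dense_in_real[of 0 "(e / 2) / b"] e \<open>0 < b\<close> by auto
        obtain r where r: "0 < r" "\<And>z \<delta>. 0 < \<delta> \<Longrightarrow> \<delta> < r \<Longrightarrow> x \<in> cc_ball G z \<delta> \<Longrightarrow>
            (b - b * s) * ?m (cc_ball G z \<delta>) \<le> enn2real (?J (cc_ball G z \<delta>))"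
          using elim(2) b s \<open>0 < b\<close> by (meson less_imp_le)
        have "b * s < e / 2"
          using s(3) \<open>0 < b\<close> by (simp add: field_simps)
        then have "f x - e \<le> b - b * s"
          using b(2) by linarith
        then have "(f x - e) * ?m B \<le> (b - b * s) * ?m B" for B
          by (intro mult_right_mono) auto
        then show ?thesis
          using r by (meson order_trans)
      qed
      then obtain r2 where r2: "0 < r2" "\<And>z \<delta>. 0 < \<delta> \<Longrightarrow> \<delta> < r2 \<Longrightarrow> x \<in> cc_ball G z \<delta> \<Longrightarrow>
          (f x - e) * ?m (cc_ball G z \<delta>) \<le> enn2real (?J (cc_ball G z \<delta>))"
        by blast
      show "?small x (\<lambda>B. \<bar>enn2real (?J B) - f x * ?m B\<bar> \<le> e * ?m B)"
      proof (intro exI[of _ "min r1 r2"] conjI allI impI)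
        show "0 < min r1 r2" using r1(1) r2(1) by simp
        fix z \<delta>
        assume z: "0 < \<delta>" "\<delta> < min r1 r2" "x \<in> cc_ball G z \<delta>"
        let ?B = "cc_ball G z \<delta>"
        have "(a + t) * ?m ?B \<le> (f x + e) * ?m ?B"
          using a t by (intro mult_right_mono) auto
        then have "enn2real (?J ?B) \<le> (f x + e) * ?m ?B"
          using r1(2)[of \<delta> z] z by auto
        moreover have "(f x - e) * ?m ?B \<le> enn2real (?J ?B)"
          using r2(2)[of \<delta> z] z by auto
        ultimately show "\<bar>enn2real (?J ?B) - f x * ?m ?B\<bar> \<le> e * ?m ?B"
          by (simp add: abs_le_iff algebra_simps)
      qed
    qed
  qed
qed

end

section \<open>Bump functions and the fundamental lemma\<close>

text \<open>The powers of \<open>1 / t\<close> make the family closed under differentiation up to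
  linear combinations, so smoothness of \<open>exp (- (1 / t))\<close> extended by 0 follows by
  induction for all members at once.\<close>

definition flat :: "nat \<Rightarrow> real \<Rightarrow> real" where
  "flat n t = (if 0 < t then (1 / t) ^ n * exp (- (1 / t)) else 0)"

lemma flat_tendsto_0: "(flat n \<longlongrightarrow> 0) (at 0)"
proof (rule filterlim_split_at)
  show "(flat n \<longlongrightarrow> 0) (at_left 0)"
  proof (rule tendsto_eventually)
    show "\<forall>\<^sub>F t in at_left 0. flat n t = 0"
      unfolding eventually_at_left_field flat_def by (intro exI[of _ "-1"]) auto
  qed
  have "((\<lambda>t. inverse t ^ n / exp (inverse t)) \<longlongrightarrow> (0::real)) (at_right 0)"
    by (rule filterlim_compose[OF tendsto_power_div_exp_0 filterlim_inverse_at_top_right])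
  then show "(flat n \<longlongrightarrow> 0) (at_right 0)"
  proof (rule Lim_transform_eventually)
    show "\<forall>\<^sub>F t in at_right 0. inverse t ^ n / exp (inverse t) = flat n t"
      unfolding eventually_at_right_field flat_def
      by (intro exI[of _ 1]) (auto simp: exp_minus inverse_eq_divide field_simps)
  qed
qed

lemma flat_has_derivative:
  "(flat n has_real_derivative flat (n + 2) t - real n * flat (n + 1) t) (at t)"
proof -
  consider "t > 0" | "t < 0" | "t = 0" by linarith
  then show ?thesis
  proof cases
    case 1
    have "((\<lambda>t. (1 / t) ^ n * exp (- (1 / t))) has_real_derivative
        flat (n + 2) t - real n * flat (n + 1) t) (at t)"
    proof -
      have d: "((\<lambda>t. 1 / t) has_real_derivative - (1 / t\<^sup>2)) (at t)"
        using 1 by (auto intro!: derivative_eq_intros simp: power2_eq_square)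
      have "((\<lambda>t. exp (- (1 / t))) has_real_derivative exp (- (1 / t)) * (1 / t\<^sup>2)) (at t)"
        using DERIV_fun_exp[OF DERIV_minus[OF d]] by simp
      from DERIV_mult[OF DERIV_power[OF d, of n] this]
      show ?thesis
      proof (rule DERIV_cong)
        show "real n * (- (1 / t\<^sup>2) * (1 / t) ^ (n - Suc 0)) * exp (- (1 / t)) +
            exp (- (1 / t)) * (1 / t\<^sup>2) * (1 / t) ^ n = flat (n + 2) t - real n * flat (n + 1) t"
          using 1 by (cases n) (simp_all add: flat_def power2_eq_square algebra_simps)
      qed
    qed
    moreover have "\<forall>\<^sub>F s in nhds t. flat n s = (1 / s) ^ n * exp (- (1 / s))"
      using eventually_nhds_in_open[of "{0<..}" t] 1 by (auto elim!: eventually_mono simp: flat_def)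
    ultimately show ?thesis
      by (subst DERIV_cong_ev) auto
  next
    case 2
    have "\<forall>\<^sub>F s in nhds t. flat n s = 0"
      using eventually_nhds_in_open[of "{..<0}" t] 2 by (auto elim!: eventually_mono simp: flat_def)
    then have "(flat n has_real_derivative 0) (at t)"
      by (subst DERIV_cong_ev[where g = "\<lambda>_. 0"]) auto
    then show ?thesis
      using 2 by (simp add: flat_def)
  next
    case 3
    have flat_0: "flat m 0 = 0" for m
      by (simp add: flat_def)
    \<comment> \<open>The difference quotient at 0 is the next member of the family, which tends to
      0.\<close>
    have "flat n h / h = flat (n + 1) h" for h
      by (simp add: flat_def)
    then have "(flat n has_real_derivative 0) (at 0)"
      using flat_tendsto_0[of "n + 1"] by (simp add: DERIV_def flat_0)
    then show ?thesis
      using 3 by (simp add: flat_0)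
  qed
qed

lemma k_smooth_flat: "k_smooth k (flat n)"
proof (induction k arbitrary: n)
  case 0
  show ?case
    unfolding k_smooth.simps
    using flat_has_derivative DERIV_isCont continuous_at_imp_continuous_on by blast
next
  case (Suc k)
  show ?case
  proof (rule k_smooth_SucI)
    show "(flat n has_derivative (\<lambda>v. v * (flat (n + 2) x + (- real n) * flat (n + 1) x))) (at x)" for x
      using flat_has_derivative[of n x] by (simp add: has_field_derivative_def mult_commute_abs)
    show "k_smooth k (\<lambda>x. b * (flat (n + 2) x + (- real n) * flat (n + 1) x))" for b
      by (intro k_smooth_mult k_smooth_add k_smooth_const Suc)
  qed
qed

text \<open>Smooth functions with values between 0 and 1 that vanish off the open box and converge
  to its indicator as \<open>n\<close> grows.\<close>

definition box_bump :: "'a::euclidean_space \<Rightarrow> 'a \<Rightarrow> nat \<Rightarrow> 'a \<Rightarrow> real" where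
  "box_bump a b n x = (\<Prod>i\<in>Basis. flat 0 (real (Suc n) * (x \<bullet> i - a \<bullet> i)) * flat 0 (real (Suc n) * (b \<bullet> i - x \<bullet> i)))"

lemma smooth_box_bump: "smooth (box_bump a b n)"
  unfolding smooth_def
proof
  fix k
  have 1: "k_smooth k (\<lambda>x. flat 0 (real (Suc n) * (x \<bullet> i - a \<bullet> i)))" for i
    using k_smooth_affine[OF bounded_linear_const_mult[OF bounded_linear_inner_left], of k "flat 0" "real (Suc n)" i "- (real (Suc n) * (a \<bullet> i))"]
    by (simp add: k_smooth_flat algebra_simps)
  have 2: "k_smooth k (\<lambda>x. flat 0 (real (Suc n) * (b \<bullet> i - x \<bullet> i)))" for i
    using k_smooth_affine[OF bounded_linear_const_mult[OF bounded_linear_inner_left], of k "flat 0" "- real (Suc n)" i "real (Suc n) * (b \<bullet> i)"]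
    by (simp add: k_smooth_flat algebra_simps)
  show "k_smooth k (box_bump a b n)"
    unfolding box_bump_def[abs_def] by (intro k_smooth_prod k_smooth_mult 1 2)
qed

lemma flat_0_bounds: "0 \<le> flat 0 t" "flat 0 t \<le> 1"
  by (auto simp: flat_def)

lemma box_bump_bounds: "0 \<le> box_bump a b n x" "box_bump a b n x \<le> 1"
  unfolding box_bump_def
  by (auto intro!: prod_nonneg prod_le_1 mult_le_one flat_0_bounds mult_nonneg_nonneg)

lemma box_bump_eq_0: "x \<notin> box a b \<Longrightarrow> box_bump a b n x = 0"
proof -
  assume "x \<notin> box a b"
  then obtain i where "i \<in> Basis" "\<not> (a \<bullet> i < x \<bullet> i \<and> x \<bullet> i < b \<bullet> i)"
    by (auto simp: mem_box)
  then show ?thesis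
    unfolding box_bump_def by (intro prod_zero) (auto simp: flat_def zero_less_mult_iff)
qed

lemma box_bump_tendsto:
  "(\<lambda>n. box_bump a b n x) \<longlonglongrightarrow> indicator (box a b) x"
proof (cases "x \<in> box a b")
  case True
  have lim: "(\<lambda>n. flat 0 (real (Suc n) * t)) \<longlonglongrightarrow> 1" if "0 < t" for t
  proof -
    have "(\<lambda>n. exp (- (inverse (real (Suc n)) * inverse t))) \<longlonglongrightarrow> exp (- (0 * inverse t))"
      by (intro tendsto_intros LIMSEQ_inverse_real_of_nat)
    then show ?thesis
      using that by (simp add: flat_def divide_inverse mult.commute)
  qed
  have "(\<lambda>n. box_bump a b n x) \<longlonglongrightarrow> (\<Prod>i\<in>(Basis :: 'a set). 1 * 1)"
    unfolding box_bump_def using True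
    by (intro tendsto_prod tendsto_mult lim) (auto simp: mem_box)
  then show ?thesis
    using True by simp
qed (simp add: box_bump_eq_0)

lemma box_bump_test_function:
  assumes "cbox a b \<subseteq> W"
  shows "box_bump a b n \<in> test_functions W"
proof -
  have "{x. box_bump a b n x \<noteq> 0} \<subseteq> cbox a b"
    using box_bump_eq_0 box_subset_cbox by blast
  then have "closure {x. box_bump a b n x \<noteq> 0} \<subseteq> cbox a b"
    by (intro closure_minimal closed_cbox)
  moreover from this have "compact (closure {x. box_bump a b n x \<noteq> 0})"
    by (meson bounded_cbox bounded_subset closed_closure compact_eq_bounded_closed)
  ultimately show ?thesis
    using assms smooth_box_bump by (auto simp: test_functions_def)
qed

section \<open>From test functions to equality almost everywhere\<close>

text \<open>Open boxes are stable under intersection and generate the Borel sets. The assumption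
  \<open>total\<close> is what the complement step of the induction consumes, the whole space not
  being a box.\<close>

lemma AE_zero_if_box_integrals_zero:
  fixes f :: "'a::euclidean_space \<Rightarrow> real"
  assumes f: "integrable lebesgue f" and box: "\<And>l u. (LINT x:box l u|lebesgue. f x) = 0"
    and total: "(LINT x|lebesgue. f x) = 0"
  shows "AE x in lebesgue. f x = 0"
proof -
  have int: "set_integrable lebesgue A f" if "A \<in> sets lebesgue" for A
    using integrable_mult_indicator[OF that f] by (simp add: set_integrable_def)
  have borel: "(LINT x:A|lebesgue. f x) = 0" if "A \<in> sets borel" for A
  proof -
    let ?E = "range (\<lambda>(a, b). box a b :: 'a set)"
    have "Int_stable ?E"
      by (auto simp: Int_stable_def box_Int_box)
    moreover have "?E \<subseteq> Pow UNIV" by simp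
    moreover have "A \<in> sigma_sets UNIV ?E"
      using that by (simp add: borel_eq_box)
    ultimately show ?thesis
    proof (induction rule: sigma_sets_induct_disjoint)
      case (basic A)
      then show ?case using box by auto
    next
      case empty
      show ?case by (simp add: set_lebesgue_integral_def)
    next
      case (compl A)
      then have A: "A \<in> sets lebesgue"
        by (simp add: borel_eq_box)
      have "(LINT x:A \<union> (UNIV - A)|lebesgue. f x) = (LINT x:A|lebesgue. f x) + (LINT x:UNIV - A|lebesgue. f x)"
        using A by (intro set_integral_Un int) auto
      then show ?case
        using compl total by (simp add: set_lebesgue_integral_def)
    next
      case (union A)
      have "A i \<in> sets borel" for i
        using union by (auto simp: borel_eq_box)
      then have A: "A i \<in> sets lebesgue" for i
        by simp
      have "(LINT x:(\<Union>i. A i)|lebesgue. f x) = (\<Sum>i. LINT x:A i|lebesgue. f x)"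
        using A union(1) by (intro lebesgue_integral_countable_add int) (auto simp: disjoint_family_on_def)
      then show ?case
        using union by simp
    qed
  qed
  have "AE x in lebesgue. f x = (\<lambda>_. 0) x"
  proof (rule density_unique_real[OF f])
    fix A :: "'a set"
    assume "A \<in> sets lebesgue"
    then obtain S N N' where A: "A = S \<union> N" "N \<subseteq> N'" "N' \<in> null_sets lborel" "S \<in> sets lborel"
      by (rule sets_completionE)
    then have N: "N \<in> null_sets lebesgue"
      by (meson null_sets_completion_subset null_sets_completionI)
    have "(LINT x:A|lebesgue. f x) = (LINT x:S|lebesgue. f x)"
    proof (rule set_integral_cong_set)
      show "AE x in lebesgue. x \<in> S \<longleftrightarrow> x \<in> A"
        using AE_not_in[OF N] by eventually_elim (auto simp: A)
      show "set_borel_measurable lebesgue S f" "set_borel_measurable lebesgue A f"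
        using int[of S] int[OF \<open>A \<in> sets lebesgue\<close>] A(4)
        unfolding set_integrable_def set_borel_measurable_def
        by (auto intro: borel_measurable_integrable)
    qed
    then show "(LINT x:A|lebesgue. f x) = (LINT x:A|lebesgue. 0)"
      using borel A(4) by simp
  qed simp
  then show ?thesis by simp
qed

text \<open>Dominated convergence along \<open>box_bump\<close> turns the hypothesis into vanishing
  integrals over boxes whose closure lies in \<open>W\<close>. Cut off to one such box,
  \<open>h\<close> is integrable and \<open>AE_zero_if_box_integrals_zero\<close> applies; countably
  many closed boxes fill \<open>W\<close>, and their boundaries are null.\<close>

lemma fundamental_lemma:
  fixes h :: "'a::euclidean_space \<Rightarrow> real"
  assumes "open W" and loc: "\<And>K. compact K \<Longrightarrow> K \<subseteq> W \<Longrightarrow> set_integrable lebesgue K h"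
    and test: "\<And>\<eta>. \<eta> \<in> test_functions W \<Longrightarrow> (LINT x:W|lebesgue. h x * \<eta> x) = 0"
  shows "AE x\<in>W in lebesgue. h x = 0"
proof -
  have box0: "(LINT x:box a b|lebesgue. h x) = 0" if ab: "cbox a b \<subseteq> W" for a b
  proof -
    have int: "integrable lebesgue (\<lambda>x. indicator (cbox a b) x * h x)"
      using loc[OF compact_cbox ab] by (simp add: set_integrable_def)
    have int': "integrable lebesgue (\<lambda>x. indicator (box a b) x * h x)"
      using integrable_mult_indicator[OF _ int, of "box a b"]
      by (rule Bochner_Integration.integrable_cong[THEN iffD1, rotated 2])
         (use box_subset_cbox[of a b] in \<open>auto simp: indicator_def\<close>)
    have eq: "indicator W x * (h x * box_bump a b n x) = box_bump a b n x * (indicator (cbox a b) x * h x)" for n x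
      using box_bump_eq_0[of x a b n] box_subset_cbox[of a b] ab by (cases "x \<in> box a b") (auto simp: indicator_def)
    have "(\<lambda>n. LINT x|lebesgue. box_bump a b n x * (indicator (cbox a b) x * h x)) \<longlonglongrightarrow>
        (LINT x|lebesgue. indicator (box a b) x * h x)"
    proof (rule integral_dominated_convergence[where w = "\<lambda>x. \<bar>indicator (cbox a b) x * h x\<bar>"])
      show "(\<lambda>x. indicator (box a b) x * h x) \<in> borel_measurable lebesgue"
        using int' by (rule borel_measurable_integrable)
      have "box_bump a b n \<in> borel_measurable lebesgue" for n
        using borel_measurable_continuous_onI[OF smooth_continuous_on[OF smooth_box_bump]]
        by (intro measurable_completion) simp
      then show "(\<lambda>x. box_bump a b n x * (indicator (cbox a b) x * h x)) \<in> borel_measurable lebesgue" for n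
        by (rule borel_measurable_times[OF _ borel_measurable_integrable[OF int]])
      show "integrable lebesgue (\<lambda>x. \<bar>indicator (cbox a b) x * h x\<bar>)"
        using int by (rule integrable_abs)
      show "AE x in lebesgue. (\<lambda>n. box_bump a b n x * (indicator (cbox a b) x * h x)) \<longlonglongrightarrow> indicator (box a b) x * h x"
      proof (rule AE_I2)
        fix x
        have "(\<lambda>n. box_bump a b n x * (indicator (cbox a b) x * h x)) \<longlonglongrightarrow> indicator (box a b) x * (indicator (cbox a b) x * h x)"
          by (intro tendsto_mult box_bump_tendsto tendsto_const)
        then show "(\<lambda>n. box_bump a b n x * (indicator (cbox a b) x * h x)) \<longlonglongrightarrow> indicator (box a b) x * h x"
          using box_subset_cbox[of a b] by (cases "x \<in> box a b") (auto simp: indicator_def)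
      qed
      show "AE x in lebesgue. norm (box_bump a b n x * (indicator (cbox a b) x * h x)) \<le> \<bar>indicator (cbox a b) x * h x\<bar>" for n
      proof (rule AE_I2)
        fix x
        have "\<bar>box_bump a b n x\<bar> * \<bar>indicator (cbox a b) x * h x\<bar> \<le> 1 * \<bar>indicator (cbox a b) x * h x\<bar>"
          using box_bump_bounds[of a b n x] by (intro mult_right_mono) auto
        then show "norm (box_bump a b n x * (indicator (cbox a b) x * h x)) \<le> \<bar>indicator (cbox a b) x * h x\<bar>"
          by (simp add: abs_mult)
      qed
    qed
    moreover have "(LINT x|lebesgue. box_bump a b n x * (indicator (cbox a b) x * h x)) = 0" for n
      using test[OF box_bump_test_function[OF ab, of n]] by (simp add: set_lebesgue_integral_def eq)
    ultimately show ?thesis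
      by (simp add: set_lebesgue_integral_def LIMSEQ_const_iff)
  qed
  have local: "AE x in lebesgue. x \<in> cbox a b \<longrightarrow> h x = 0" if ab: "cbox a b \<subseteq> W" for a b
  proof -
    let ?f = "\<lambda>x. indicator (box a b) x * h x"
    have int: "integrable lebesgue ?f"
      using set_integrable_subset[OF loc[OF compact_cbox ab], of "box a b"] box_subset_cbox[of a b]
      by (simp add: set_integrable_def)
    have "AE x in lebesgue. ?f x = 0"
    proof (rule AE_zero_if_box_integrals_zero[OF int])
      show "(LINT x|lebesgue. ?f x) = 0"
        using box0[OF ab] by (simp add: set_lebesgue_integral_def)
      fix l u :: 'a
      obtain c d where cd: "box l u \<inter> box a b = box c d"
        unfolding box_Int_box by blast
      have "(LINT x:box l u|lebesgue. ?f x) = (LINT x:box c d|lebesgue. h x)"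
        unfolding set_lebesgue_integral_def cd[symmetric]
        by (intro Bochner_Integration.integral_cong) (auto simp: indicator_def)
      also have "\<dots> = 0"
      proof (cases "box c d = {}")
        case False
        have "box c d \<subseteq> cbox a b"
          using cd box_subset_cbox[of a b] by blast
        then have "cbox c d \<subseteq> W"
          using ab closure_box[OF False] closure_minimal[of "box c d" "cbox a b"] by auto
        then show ?thesis by (rule box0)
      qed (simp add: set_lebesgue_integral_def)
      finally show "(LINT x:box l u|lebesgue. ?f x) = 0" .
    qed
    moreover have "cbox a b - box a b \<in> null_sets lebesgue"
      using negligible_frontier_interval[of a b] by (simp add: negligible_iff_null_sets)
    then have "AE x in lebesgue. x \<notin> cbox a b - box a b"
      by (rule AE_not_in)
    ultimately show ?thesis
      by eventually_elim (auto simp: indicator_def split: if_splits)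
  qed
  have "\<exists>D. countable D \<and> (\<forall>X\<in>D. X \<subseteq> W \<and> (\<exists>a b. X = cbox a b)) \<and> \<Union>D = W"
  proof (rule open_countable_Union_open_cbox[OF \<open>open W\<close>])
    fix D
    assume "countable D" "D \<subseteq> Pow W" "\<And>X. X \<in> D \<Longrightarrow> \<exists>a b. X = cbox a b" "\<Union>D = W"
    then show "\<exists>D. countable D \<and> (\<forall>X\<in>D. X \<subseteq> W \<and> (\<exists>a b. X = cbox a b)) \<and> \<Union>D = W"
      by (intro exI[of _ D]) auto
  qed
  then obtain D where D: "countable D" "\<forall>X\<in>D. X \<subseteq> W \<and> (\<exists>a b. X = cbox a b)" "\<Union>D = W"
    by (elim exE conjE) (rule that)
  have "AE x in lebesgue. x \<in> X \<longrightarrow> h x = 0" if XD: "X \<in> D" for X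
  proof -
    obtain a b where ab: "X = cbox a b"
      using bspec[OF D(2) XD] by (elim conjE exE) (rule that)
    then have "cbox a b \<subseteq> W"
      using bspec[OF D(2) XD] by simp
    from local[OF this] show ?thesis
      by (simp only: ab)
  qed
  then have "AE x in lebesgue. \<forall>X\<in>D. x \<in> X \<longrightarrow> h x = 0"
    by (intro AE_ball_countable' D(1))
  then show ?thesis
  proof eventually_elim
    case (elim x)
    then show ?case using D(3) by blast
  qed
qed

section \<open>Lipschitz functions and saw teeth\<close>

text \<open>Crude but sufficient: the sum is at most \<open>n\<close> times its largest
  term.\<close>

lemma powr_sum_le:
  fixes a :: "nat \<Rightarrow> real"
  assumes "\<And>j. 0 \<le> a j" "0 < q"
  shows "(\<Sum>j<n. a j) powr q \<le> (real n powr q) * (\<Sum>j<n. a j powr q)"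
proof (cases "n = 0")
  case False
  have fin: "finite (a ` {..<n})" "a ` {..<n} \<noteq> {}"
    using False by auto
  from Max_in[OF this] obtain i where i: "i < n" "a i = Max (a ` {..<n})"
    by auto
  have "(\<Sum>j<n. a j) \<le> real n * a i"
    using sum_bounded_above[of "{..<n}" a "a i"] i(2) fin(1) by simp
  then have "(\<Sum>j<n. a j) powr q \<le> (real n * a i) powr q"
    using assms by (intro powr_mono2) (auto intro: sum_nonneg)
  also have "\<dots> = real n powr q * a i powr q"
    using assms by (simp add: powr_mult)
  also have "a i powr q \<le> (\<Sum>j<n. a j powr q)"
    using i(1) by (intro member_le_sum) auto
  finally show ?thesis
    by (simp add: mult_left_mono)
qed simp

lemma Lip_bound:
  assumes "u \<in> Lip"
  shows "\<bar>u y - u z\<bar> \<le> lip_const u * dist y z" "0 \<le> lip_const u"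
proof -
  obtain C where C: "C-lipschitz_on UNIV u"
    using assms by (auto simp: Lip_def)
  let ?r = "\<lambda>(y1, y2). \<bar>u y1 - u y2\<bar> / dist y1 y2"
  have "?r p \<le> C" for p
  proof -
    obtain y z where p: "p = (y, z)" by force
    have "\<bar>u y - u z\<bar> \<le> C * dist y z"
      using lipschitz_onD[OF C, of y z] by (simp add: dist_real_def)
    then show ?thesis
      using lipschitz_on_nonneg[OF C] by (cases "y = z") (auto simp: p pos_divide_le_eq)
  qed
  then have bdd: "bdd_above (range ?r)"
    by (intro bdd_aboveI) auto
  have le: "?r p \<le> lip_const u" for p
    unfolding lip_const_def by (rule cSUP_upper[OF _ bdd]) simp
  show "0 \<le> lip_const u"
    using le[of "(y, y)"] by simp
  show "\<bar>u y - u z\<bar> \<le> lip_const u * dist y z"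
    using le[of "(y, z)"] by (cases "y = z") (auto simp: pos_divide_le_eq)
qed

lemma lip_const_le:
  assumes "0 \<le> C" "\<And>y z. \<bar>u y - u z\<bar> \<le> C * dist y z"
  shows "u \<in> Lip" "lip_const u \<le> C"
proof -
  show "u \<in> Lip"
    using assms unfolding Lip_def by (auto simp: lipschitz_on_def dist_real_def)
  have "\<bar>u y - u z\<bar> / dist y z \<le> C" for y z
    using assms(1) assms(2)[of y z] by (cases "y = z") (auto simp: pos_divide_le_eq)
  then show "lip_const u \<le> C"
    unfolding lip_const_def by (intro cSUP_least) auto
qed

definition Lip1 :: "('y::metric_space \<Rightarrow> real) set" where
  "Lip1 = {u \<in> Lip. lip_const u \<le> 1}"

lemma Lip1_iff: "u \<in> Lip1 \<longleftrightarrow> (\<forall>y z. \<bar>u y - u z\<bar> \<le> dist y z)"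
proof
  assume u: "u \<in> Lip1"
  show "\<forall>y z. \<bar>u y - u z\<bar> \<le> dist y z"
  proof (intro allI)
    fix y z
    have "\<bar>u y - u z\<bar> \<le> lip_const u * dist y z"
      using u Lip_bound(1) by (auto simp: Lip1_def)
    also have "\<dots> \<le> 1 * dist y z"
      using u by (intro mult_right_mono) (auto simp: Lip1_def)
    finally show "\<bar>u y - u z\<bar> \<le> dist y z" by simp
  qed
next
  assume "\<forall>y z. \<bar>u y - u z\<bar> \<le> dist y z"
  then show "u \<in> Lip1"
    using lip_const_le[of 1 u] by (simp add: Lip1_def)
qed

lemma Lip1_continuous_on: "u \<in> Lip1 \<Longrightarrow> continuous_on S u"
  unfolding Lip1_iff continuous_on_iff dist_real_def by (meson order.strict_trans1)

text \<open>As a distance to a set it is 1-Lipschitz at once. Lattice points \<open>2 * h\<close>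
  apart bound it by \<open>h\<close>, and \<open>a\<close> is a free phase.\<close>

definition saw :: "real \<Rightarrow> real \<Rightarrow> real \<Rightarrow> real" where
  "saw a h t = infdist t (range (\<lambda>i::int. a + 2 * h * real_of_int i))"

lemma saw_lip: "\<bar>saw a h s - saw a h t\<bar> \<le> \<bar>s - t\<bar>"
  unfolding saw_def using infdist_triangle_abs by (metis dist_real_def)

lemma saw_nonneg: "0 \<le> saw a h t"
  unfolding saw_def by (rule infdist_nonneg)

lemma saw_eq:
  assumes "0 < h" "a + 2 * h * real_of_int j \<le> t" "t \<le> a + 2 * h * real_of_int (j + 1)"
  shows "saw a h t = min (t - (a + 2 * h * real_of_int j)) (a + 2 * h * real_of_int (j + 1) - t)"
proof (rule antisym)
  let ?f = "\<lambda>i::int. a + 2 * h * real_of_int i"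
  have "saw a h t \<le> dist t (?f i)" for i
    unfolding saw_def by (rule infdist_le) (rule rangeI)
  from this[of j] this[of "j + 1"] show "saw a h t \<le> min (t - ?f j) (?f (j + 1) - t)"
    using assms(2,3) by (auto simp: dist_real_def)
  show "min (t - ?f j) (?f (j + 1) - t) \<le> saw a h t"
  proof -
    have ne: "range ?f \<noteq> {}" by simp
    show ?thesis
    unfolding saw_def infdist_notempty[OF ne]
  proof (rule cINF_greatest[OF ne])
    fix p
    assume "p \<in> range ?f"
    then obtain i where p: "p = ?f i" by blast
    show "min (t - ?f j) (?f (j + 1) - t) \<le> dist t p"
    proof (cases "i \<le> j")
      case True
      then have "2 * h * real_of_int i \<le> 2 * h * real_of_int j"
        using assms(1) by (intro mult_left_mono) auto
      then show ?thesis
        unfolding p dist_real_def by linarith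
    next
      case False
      then have "2 * h * real_of_int (j + 1) \<le> 2 * h * real_of_int i"
        using assms(1) by (intro mult_left_mono) auto
      then show ?thesis
        unfolding p dist_real_def by linarith
    qed
  qed
  qed
qed

lemma saw_cell:
  assumes "0 < h"
  obtains j :: int where "a + 2 * h * real_of_int j \<le> t" "t < a + 2 * h * real_of_int (j + 1)"
proof -
  let ?j = "\<lfloor>(t - a) / (2 * h)\<rfloor>"
  have "real_of_int ?j * (2 * h) \<le> t - a" "t - a < (real_of_int ?j + 1) * (2 * h)"
    using assms floor_divide_lower[of "2 * h" "t - a"] floor_divide_upper[of "2 * h" "t - a"] by simp_all
  then show ?thesis
    using that[of ?j] by (simp add: algebra_simps)
qed

lemma saw_le: "0 < h \<Longrightarrow> saw a h t \<le> h"
proof -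
  assume h: "0 < h"
  obtain j :: int where j: "a + 2 * h * real_of_int j \<le> t" "t < a + 2 * h * real_of_int (j + 1)"
    using saw_cell[OF h] by metis
  show ?thesis
    unfolding saw_eq[OF h j(1) less_imp_le[OF j(2)]] by (auto simp: min_def algebra_simps)
qed

lemma saw_up:
  assumes "0 < h" "a + h * real_of_int (2 * j) < t" "t < a + h * real_of_int (2 * j + 1)"
  shows "saw a h t = t - (a + h * real_of_int (2 * j))"
  using assms by (subst saw_eq[where j = j]) (auto simp: algebra_simps)

lemma saw_down:
  assumes "0 < h" "a + h * real_of_int (2 * j + 1) < t" "t < a + h * real_of_int (2 * j + 2)"
  shows "saw a h t = (a + h * real_of_int (2 * j + 2)) - t"
  using assms by (subst saw_eq[where j = j]) (auto simp: algebra_simps)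

text \<open>The corners are the lattice points and the peaks midway between them, hence a grid of
  mesh \<open>h\<close>, with slope 1 on even and -1 on odd cells.\<close>

lemma saw_affine:
  assumes "0 < h"
  obtains \<sigma> c :: real where "\<bar>\<sigma>\<bar> = 1"
    "\<And>t. a + h * real_of_int i < t \<Longrightarrow> t < a + h * real_of_int (i + 1) \<Longrightarrow> saw a h t = \<sigma> * t + c"
proof (cases "even i")
  case True
  then obtain j where i: "i = 2 * j" by blast
  show ?thesis
  proof (rule that[of 1 "- (a + h * real_of_int (2 * j))"])
    fix t
    assume "a + h * real_of_int i < t" "t < a + h * real_of_int (i + 1)"
    then show "saw a h t = 1 * t + - (a + h * real_of_int (2 * j))"
      using saw_up[OF assms, of a j t] by (simp add: i)
  qed simp
next
  case False
  then obtain j where i: "i = 2 * j + 1" by (rule oddE)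
  show ?thesis
  proof (rule that[of "- 1" "a + h * real_of_int (2 * j + 2)"])
    fix t
    assume t: "a + h * real_of_int i < t" "t < a + h * real_of_int (i + 1)"
    have e: "i + 1 = 2 * j + 2" by (simp add: i)
    show "saw a h t = - 1 * t + (a + h * real_of_int (2 * j + 2))"
      using saw_down[OF assms t(1)[unfolded i] t(2)[unfolded e]] by simp
  qed simp
qed

lemma grid_cell:
  fixes t :: real
  assumes "0 < h" "\<And>i::int. t \<noteq> a + h * real_of_int i"
  obtains i :: int where "a + h * real_of_int i < t" "t < a + h * real_of_int (i + 1)"
proof -
  let ?i = "\<lfloor>(t - a) / h\<rfloor>"
  have "real_of_int ?i * h \<le> t - a" "t - a < (real_of_int ?i + 1) * h"
    using assms(1) floor_divide_lower[of h "t - a"] floor_divide_upper[of h "t - a"] by simp_all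
  then show ?thesis
    using that[of ?i] assms(2)[of ?i] by (simp add: algebra_simps)
qed

lemma infdist_less_imp:
  assumes "A \<noteq> {}" "infdist y A < r"
  shows "\<exists>p\<in>A. dist y p < r"
proof (rule ccontr)
  assume "\<not> ?thesis"
  then have "r \<le> infdist y A"
    unfolding infdist_notempty[OF assms(1)] by (intro cINF_greatest assms(1)) (simp add: not_less)
  then show False using assms(2) by simp
qed

lemma compact_closed_gap:
  fixes K T :: "'y::metric_space set"
  assumes "compact K" "closed T" "K \<inter> T = {}"
  obtains d where "0 < d" "\<And>y z. y \<in> K \<Longrightarrow> z \<in> T \<Longrightarrow> d \<le> dist y z"
proof (cases "K = {} \<or> T = {}")
  case True
  then show ?thesis using that[of 1] by auto
next
  case False
  have "continuous_on K (\<lambda>y. infdist y T)"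
    by (intro continuous_on_infdist continuous_on_id)
  then obtain y0 where y0: "y0 \<in> K" "\<And>y. y \<in> K \<Longrightarrow> infdist y0 T \<le> infdist y T"
    using continuous_attains_inf[OF assms(1)] False by blast
  have "0 < infdist y0 T"
    using in_closed_iff_infdist_zero[OF assms(2), of y0] False y0(1) assms(3) infdist_nonneg[of y0 T]
    by (auto simp: less_le)
  moreover have "infdist y0 T \<le> dist y z" if "y \<in> K" "z \<in> T" for y z
    using y0(2)[OF that(1)] infdist_le[OF that(2), of y] by simp
  ultimately show ?thesis using that by blast
qed

text \<open>The cut-off stays above \<open>h\<close> within distance \<open>h\<close> of
  \<open>L\<close> and vanishes from distance \<open>2 * h\<close> on; it acts by a minimum, which
  keeps the Lipschitz constant. Empty \<open>L\<close> is separate because \<open>infdist\<close> to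
  the empty set is 0, and the cut-off would be \<open>2 * h\<close> everywhere.\<close>

definition bump_near :: "real \<Rightarrow> 'y::metric_space set \<Rightarrow> ('y \<Rightarrow> real) \<Rightarrow> 'y \<Rightarrow> real" where
  "bump_near h L f y = (if L = {} then 0 else min (f y) (max 0 (2 * h - infdist y L)))"

lemma bump_near_lip:
  assumes "\<And>y z. \<bar>f y - f z\<bar> \<le> dist y z"
  shows "\<bar>bump_near h L f y - bump_near h L f z\<bar> \<le> dist y z"
  using assms[of y z] infdist_triangle_abs[of y L z] unfolding bump_near_def
  by (auto simp: min_def max_def abs_if split: if_splits)

lemma bump_near_bounds:
  assumes "0 < h" "\<And>y. 0 \<le> f y" "\<And>y. f y \<le> h"
  shows "0 \<le> bump_near h L f y" "bump_near h L f y \<le> h"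
  using assms(1) assms(2)[of y] assms(3)[of y] by (auto simp: bump_near_def)

lemma bump_near_support: "0 \<le> f y \<Longrightarrow> bump_near h L f y \<noteq> 0 \<Longrightarrow> L \<noteq> {} \<and> infdist y L < 2 * h"
  by (auto simp: bump_near_def split: if_splits)

lemma bump_near_eq: "L \<noteq> {} \<Longrightarrow> 0 \<le> f y \<Longrightarrow> f y \<le> h \<Longrightarrow> infdist y L < h \<Longrightarrow> bump_near h L f y = f y"
  by (auto simp: bump_near_def)

text \<open>A bump lives within \<open>2 * h\<close> of its set, so a gap of \<open>6 * h\<close>
  between the sets leaves at least \<open>h\<close> between points where different bumps are active.
  Two bump values differ by at most \<open>h\<close>, and at each point at most one is
  nonzero.\<close>

lemma sum_bump_near_Lip1:
  fixes L :: "nat \<Rightarrow> 'y::metric_space set"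
  assumes h: "0 < h" and lip: "\<And>k y z. \<bar>f k y - f k z\<bar> \<le> dist y z"
    and rng: "\<And>k y. 0 \<le> f k y" "\<And>k y. f k y \<le> h"
    and gap: "\<And>k l y z. k \<noteq> l \<Longrightarrow> k \<le> n \<Longrightarrow> l \<le> n \<Longrightarrow> y \<in> L k \<Longrightarrow> z \<in> L l \<Longrightarrow> 6 * h \<le> dist y z"
  shows "(\<lambda>y. \<Sum>k\<le>n. bump_near h (L k) (f k) y) \<in> Lip1"
  unfolding Lip1_iff
proof (intro allI)
  fix y z
  let ?b = "\<lambda>k y. bump_near h (L k) (f k) y"
  have far: "h \<le> dist y z" if "?b k y \<noteq> 0" "?b l z \<noteq> 0" "k \<noteq> l" "k \<le> n" "l \<le> n" for k l y z
  proof -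
    have y: "L k \<noteq> {}" "infdist y (L k) < 2 * h" and z: "L l \<noteq> {}" "infdist z (L l) < 2 * h"
      using bump_near_support[OF rng(1) that(1)] bump_near_support[OF rng(1) that(2)] by auto
    obtain p where p: "p \<in> L k" "dist y p < 2 * h"
      using infdist_less_imp[OF y] by blast
    obtain p' where p': "p' \<in> L l" "dist z p' < 2 * h"
      using infdist_less_imp[OF z] by blast
    have "6 * h \<le> dist p p'"
      by (rule gap[OF that(3-5) p(1) p'(1)])
    also have "\<dots> \<le> dist p y + dist y z + dist z p'"
      using dist_triangle[of p p' y] dist_triangle[of y p' z] by linarith
    finally show ?thesis
      using p(2) p'(2) h by (simp add: dist_commute)
  qed
  have single: "?b l y = 0" if "?b k y \<noteq> 0" "l \<noteq> k" "k \<le> n" "l \<le> n" for k l y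
    using far[of k y l y] that h by force
  have sum_single: "(\<Sum>k\<le>n. ?b k y) = ?b k y" if "k \<le> n" "\<And>l. l \<le> n \<Longrightarrow> l \<noteq> k \<Longrightarrow> ?b l y = 0" for k y
    using that sum.mono_neutral_right[of "{..n}" "{k}" "\<lambda>k. ?b k y"] by auto
  show "\<bar>(\<Sum>k\<le>n. ?b k y) - (\<Sum>k\<le>n. ?b k z)\<bar> \<le> dist y z"
  proof (cases "\<exists>k\<le>n. \<exists>l\<le>n. k \<noteq> l \<and> ?b k y \<noteq> 0 \<and> ?b l z \<noteq> 0")
    case True
    then obtain k l where kl: "k \<le> n" "l \<le> n" "k \<noteq> l" "?b k y \<noteq> 0" "?b l z \<noteq> 0" by blast
    have "(\<Sum>k\<le>n. ?b k y) = ?b k y" "(\<Sum>k\<le>n. ?b k z) = ?b l z"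
      using kl by (auto intro!: sum_single intro: single)
    then show ?thesis
      using bump_near_bounds[where f = "f k" and L = "L k" and y = y, OF h rng]
        bump_near_bounds[where f = "f l" and L = "L l" and y = z, OF h rng] far[OF kl(4,5,3,1,2)]
      by linarith
  next
    case False
    have "\<exists>k\<le>n. \<forall>l\<le>n. l \<noteq> k \<longrightarrow> ?b l y = 0 \<and> ?b l z = 0"
    proof (cases "\<exists>k\<le>n. ?b k y \<noteq> 0 \<or> ?b k z \<noteq> 0")
      case True
      then obtain k where k: "k \<le> n" "?b k y \<noteq> 0 \<or> ?b k z \<noteq> 0" by blast
      have "?b l y = 0 \<and> ?b l z = 0" if l: "l \<le> n" "l \<noteq> k" for l
      proof (cases "?b k y \<noteq> 0")
        case True
        then have "?b l y = 0" using single[OF True l(2) k(1) l(1)] by simp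
        moreover have "?b l z = 0" using False True k(1) l by blast
        ultimately show ?thesis ..
      next
        case False
        then have z: "?b k z \<noteq> 0" using k(2) by blast
        then have "?b l z = 0" using single[OF z l(2) k(1) l(1)] by simp
        moreover have "?b l y = 0"
          using \<open>\<not> (\<exists>k\<le>n. \<exists>l\<le>n. k \<noteq> l \<and> ?b k y \<noteq> 0 \<and> ?b l z \<noteq> 0)\<close> z k(1) l by blast
        ultimately show ?thesis by blast
      qed
      then show ?thesis using k(1) by blast
    next
      case False
      then show ?thesis by blast
    qed
    then obtain k where k: "k \<le> n" "\<And>l. l \<le> n \<Longrightarrow> l \<noteq> k \<Longrightarrow> ?b l y = 0 \<and> ?b l z = 0" by blast
    then have "(\<Sum>k\<le>n. ?b k y) = ?b k y" "(\<Sum>k\<le>n. ?b k z) = ?b k z"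
      by (auto intro!: sum_single)
    then show ?thesis
      using bump_near_lip[OF lip] by metis
  qed
qed

text \<open>On a bounded piece of \<open>W\<close> the image of Lebesgue measure under
  \<open>w\<close> is finite and has countably many atoms; \<open>W\<close> is a countable union of
  such pieces.\<close>

lemma countable_positive_levels:
  fixes w :: "'a::euclidean_space \<Rightarrow> real"
  assumes "open W" and w: "continuous_on W w"
  shows "countable {t. {x \<in> W. w x = t} \<notin> null_sets lebesgue}"
proof -
  define S where "S n = W \<inter> ball 0 (real n)" for n :: nat
  have S: "open (S n)" for n
    using assms(1) by (auto simp: S_def)
  have lev: "{x \<in> S n. w x = t} \<in> sets borel" for n t
  proof -
    have "w \<in> borel_measurable (restrict_space borel (S n))"
      by (rule borel_measurable_continuous_on_restrict) (rule continuous_on_subset[OF w], simp add: S_def)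
    from measurable_sets[OF this, of "{t}"] have "w -` {t} \<inter> S n \<in> sets (restrict_space borel (S n))"
      by (simp add: space_restrict_space)
    moreover have "w -` {t} \<inter> S n = {x \<in> S n. w x = t}" by auto
    ultimately show ?thesis
      using S[of n] by (simp add: sets_restrict_space_iff)
  qed
  have "countable {t. measure lborel {x \<in> S n. w x = t} \<noteq> 0}" for n
  proof -
    let ?M = "restrict_space lborel (S n)"
    have "w \<in> borel_measurable (restrict_space borel (S n))"
      by (rule borel_measurable_continuous_on_restrict) (rule continuous_on_subset[OF w], simp add: S_def)
    moreover have "borel_measurable ?M = (borel_measurable (restrict_space borel (S n)) :: ('a \<Rightarrow> real) set)"
      by (rule measurable_cong_sets) (simp_all add: sets_restrict_space)
    ultimately have wm: "w \<in> borel_measurable ?M"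
      by simp
    have "emeasure lborel (S n) \<le> emeasure lborel (ball (0::'a) (real n))"
      by (intro emeasure_mono) (auto simp: S_def)
    also have "\<dots> < \<infinity>"
      by (rule emeasure_lborel_ball_finite)
    finally have fin: "emeasure lborel (S n) < \<infinity>" .
    have "finite_measure ?M"
      using fin S[of n] by (intro finite_measureI) (auto simp: emeasure_restrict_space space_restrict_space)
    then interpret D: finite_measure "distr ?M borel w"
      using wm by (rule finite_measure.finite_measure_distr)
    have eq: "measure (distr ?M borel w) {t} = measure lborel {x \<in> S n. w x = t}" for t
    proof -
      have "measure (distr ?M borel w) {t} = measure ?M (w -` {t} \<inter> space ?M)"
        using wm by (simp add: measure_distr)
      also have "w -` {t} \<inter> space ?M = {x \<in> S n. w x = t}"
        by (auto simp: space_restrict_space)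
      also have "measure ?M \<dots> = measure lborel {x \<in> S n. w x = t}"
        using S[of n] by (intro measure_restrict_space) auto
      finally show ?thesis .
    qed
    show ?thesis
      using D.countable_support unfolding eq .
  qed
  then have "countable (\<Union>n. {t. measure lborel {x \<in> S n. w x = t} \<noteq> 0})"
    by (intro countable_UN) auto
  moreover have "{t. {x \<in> W. w x = t} \<notin> null_sets lebesgue} \<subseteq> (\<Union>n. {t. measure lborel {x \<in> S n. w x = t} \<noteq> 0})"
  proof
    fix t
    assume t: "t \<in> {t. {x \<in> W. w x = t} \<notin> null_sets lebesgue}"
    show "t \<in> (\<Union>n. {t. measure lborel {x \<in> S n. w x = t} \<noteq> 0})"
    proof (rule ccontr)
      assume "\<not> ?thesis"
      then have 0: "measure lborel {x \<in> S n. w x = t} = 0" for n by auto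
      have "{x \<in> S n. w x = t} \<in> null_sets lborel" for n
      proof -
        have "emeasure lborel {x \<in> S n. w x = t} \<le> emeasure lborel (ball (0::'a) (real n))"
          by (intro emeasure_mono) (auto simp: S_def)
        also have "\<dots> < \<infinity>"
          by (rule emeasure_lborel_ball_finite)
        finally have "emeasure lborel {x \<in> S n. w x = t} \<noteq> \<infinity>" by simp
        then have "emeasure lborel {x \<in> S n. w x = t} = 0"
          using 0[of n] by (auto simp: measure_def enn2real_eq_0_iff)
        then show ?thesis using lev[of n t] by (simp add: null_sets_def)
      qed
      then have "(\<Union>n. {x \<in> S n. w x = t}) \<in> null_sets lebesgue"
        by (intro null_sets_UN null_sets_completionI)
      moreover have "(\<Union>n. {x \<in> S n. w x = t}) = {x \<in> W. w x = t}"
      proof -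
        have "\<exists>n::nat. norm x < real n" for x :: 'a
          using reals_Archimedean2 by blast
        then show ?thesis by (auto simp: S_def)
      qed
      ultimately show False using t by simp
    qed
  qed
  ultimately show ?thesis
    by (rule countable_subset[rotated])
qed

section \<open>Weak derivatives of compositions\<close>

text \<open>\<open>c\<close> is the density of Haar measure with respect to Lebesgue measure. The
  value 0 is allowed; it occurs if the unit ball has infinite measure, and then statements almost
  everywhere are void.\<close>

locale lip_composition = carnot_group G for G :: "'a::euclidean_space carnot_data" +
  fixes \<Omega> :: "'a set" and q :: real and \<phi> :: "'a \<Rightarrow> 'y::metric_space" and \<psi> :: "'y \<Rightarrow> 'a" and c :: real
  assumes open_\<Omega>: "open \<Omega>" and nonempty_\<Omega>: "\<Omega> \<noteq> {}" and q_ge_1: "1 \<le> q"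
    and homeo: "homeomorphism \<Omega> UNIV \<phi> \<psi>"
    and bounded: "bounded_composition G q \<Omega> \<phi>"
    and haar_const: "inverse (emeasure lebesgue (cc_ball G 0 1)) = ennreal c" and c_nonneg: "0 \<le> c"
begin

lemma haar_eq: "haar G = density lebesgue (\<lambda>_. ennreal c)"
  by (simp only: haar_def haar_const)

abbreviation M :: "'a measure" where "M \<equiv> haar G"

lemma sets_M [simp]: "sets M = sets lebesgue" and space_M [simp]: "space M = UNIV"
  by (simp_all add: haar_def)

lemma borel_measurable_M: "borel_measurable M = borel_measurable lebesgue"
  by (rule measurable_cong_sets) simp_all

lemma AE_M: "(AE x in M. P x) \<longleftrightarrow> c = 0 \<or> (AE x in lebesgue. P x)"
  unfolding haar_eq using c_nonneg by (subst AE_density) (auto simp: less_le)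

lemma AE_M_I: "(AE x in lebesgue. P x) \<Longrightarrow> (AE x in M. P x)"
  by (simp add: AE_M)

lemma L1_loc_measurable:
  assumes "f \<in> L1_loc G \<Omega>"
  shows "(\<lambda>x. indicator \<Omega> x * f x) \<in> borel_measurable lebesgue"
proof -
  obtain C where C: "incseq C" "\<And>n::nat. compact (C n)" "\<And>n. C n \<subseteq> \<Omega>" "(\<Union>n. C n) = \<Omega>"
    using open_compact_exhaustion[OF open_\<Omega>] by blast
  have conv: "(\<lambda>n. indicator (C n) x * f x) \<longlonglongrightarrow> indicator \<Omega> x * f x" for x
  proof -
    have "(\<lambda>n. indicator (C n) x :: real) \<longlonglongrightarrow> indicator (\<Union>n. C n) x"
      by (rule LIMSEQ_indicator_incseq[OF C(1)])
    then show ?thesis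
      unfolding C(4) by (intro tendsto_mult tendsto_const)
  qed
  have meas: "(\<lambda>x. indicator (C n) x * f x) \<in> borel_measurable lebesgue" for n
    using assms C(2,3)[of n] borel_measurable_integrable[of M "\<lambda>x. indicator (C n) x * f x"]
    by (auto simp: L1_loc_def set_integrable_def borel_measurable_M)
  show ?thesis
    by (rule borel_measurable_LIMSEQ_real[OF conv meas])
qed

lemma L1_loc_diff: "f \<in> L1_loc G \<Omega> \<Longrightarrow> g \<in> L1_loc G \<Omega> \<Longrightarrow> (\<lambda>x. f x - g x) \<in> L1_loc G \<Omega>"
  by (auto simp: L1_loc_def)

lemma L1_loc_mult: "f \<in> L1_loc G \<Omega> \<Longrightarrow> (\<lambda>x. r * f x) \<in> L1_loc G \<Omega>"
  by (auto simp: L1_loc_def)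

lemma integrable_times_test:
  assumes f: "f \<in> L1_loc G \<Omega>" and \<theta>: "continuous_on UNIV \<theta>" and S: "compact S" "S \<subseteq> \<Omega>"
    and zero: "\<And>x. x \<notin> S \<Longrightarrow> \<theta> x = 0"
  shows "integrable M (\<lambda>x. indicator \<Omega> x * (f x * \<theta> x))"
proof -
  have int: "integrable M (\<lambda>x. indicator S x * f x)"
    using f S by (auto simp: L1_loc_def set_integrable_def)
  have "bounded (\<theta> ` S)"
    using \<theta> by (intro compact_imp_bounded compact_continuous_image S) (rule continuous_on_subset, auto)
  then obtain B where "\<forall>y\<in>\<theta> ` S. norm y \<le> B"
    unfolding bounded_iff by blast
  then have B: "\<And>x. x \<in> S \<Longrightarrow> \<bar>\<theta> x\<bar> \<le> B" by simp
  have eq: "indicator \<Omega> x * (f x * \<theta> x) = (indicator S x * f x) * \<theta> x" for x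
    using S(2) zero[of x] by (auto simp: indicator_def)
  have "\<theta> \<in> borel_measurable M"
    unfolding borel_measurable_M
    using borel_measurable_continuous_onI[OF \<theta>] by (intro measurable_completion) simp
  then have "(\<lambda>x. (indicator S x * f x) * \<theta> x) \<in> borel_measurable M"
    by (rule borel_measurable_times[OF borel_measurable_integrable[OF int]])
  moreover have "norm ((indicator S x * f x) * \<theta> x) \<le> norm (B * (indicator S x * f x))" for x
    using B[of x] by (cases "x \<in> S") (auto simp: abs_mult mult.commute intro!: mult_right_mono)
  ultimately show ?thesis
    unfolding eq by (intro Bochner_Integration.integrable_bound[OF integrable_mult_right[OF int, of B]] AE_I2)
qed

abbreviation X :: "'a \<Rightarrow> ('a \<Rightarrow> real) \<Rightarrow> 'a \<Rightarrow> real" where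
  "X v \<eta> x \<equiv> frechet_derivative \<eta> (at x) (lfield G v x)"

lemma X_test_function:
  assumes "\<eta> \<in> test_functions \<Omega>"
  shows "continuous_on UNIV (X v \<eta>)" "x \<notin> closure {x. \<eta> x \<noteq> 0} \<Longrightarrow> X v \<eta> x = 0"
proof -
  have \<eta>: "smooth \<eta>"
    using assms by (simp add: test_functions_def)
  have "X v \<eta> x = (\<Sum>b\<in>Basis. (lfield G v x \<bullet> b) * frechet_derivative \<eta> (at x) b)" for x
    by (subst (1) euclidean_representation[of "lfield G v x", symmetric])
       (simp only: linear_sum[OF smooth_linear_frechet[OF \<eta>]] linear_cmul[OF smooth_linear_frechet[OF \<eta>]] real_scaleR_def)
  then show "continuous_on UNIV (X v \<eta>)"
    using smooth_continuous_on[OF smooth_lfield, of UNIV v] smooth_continuous_on[OF smooth_directional[OF \<eta>]]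
    by (auto intro!: continuous_on_sum continuous_on_mult continuous_on_inner continuous_on_const)
  show "X v \<eta> x = 0" if "x \<notin> closure {x. \<eta> x \<noteq> 0}"
  proof -
    have op: "open (- closure {x. \<eta> x \<noteq> 0})"
      by (intro open_Compl closed_closure)
    have "((\<lambda>_. 0) has_derivative (\<lambda>_. 0)) (at x)" by simp
    then have "(\<eta> has_derivative (\<lambda>_. 0)) (at x)"
      by (rule has_derivative_transform_within_open[OF _ op])
         (use that closure_subset[of "{x. \<eta> x \<noteq> 0}"] in auto)
    then have "frechet_derivative \<eta> (at x) = (\<lambda>_. 0)"
      using frechet_derivative_at by metis
    then show ?thesis by simp
  qed
qed

lemma test_functionD:
  assumes "\<eta> \<in> test_functions W"
  shows "continuous_on UNIV \<eta>" "compact (closure {x. \<eta> x \<noteq> 0})" "closure {x. \<eta> x \<noteq> 0} \<subseteq> W"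
    "x \<notin> closure {x. \<eta> x \<noteq> 0} \<Longrightarrow> \<eta> x = 0"
  using assms closure_subset[of "{x. \<eta> x \<noteq> 0}"] by (auto simp: test_functions_def smooth_continuous_on)

lemma test_functions_mono: "W \<subseteq> \<Omega> \<Longrightarrow> \<eta> \<in> test_functions W \<Longrightarrow> \<eta> \<in> test_functions \<Omega>"
  by (auto simp: test_functions_def)

lemma integrable_test:
  "f \<in> L1_loc G \<Omega> \<Longrightarrow> \<eta> \<in> test_functions \<Omega> \<Longrightarrow> integrable M (\<lambda>x. indicator \<Omega> x * (f x * \<eta> x))"
  by (rule integrable_times_test[OF _ test_functionD(1-3)]) (auto dest: test_functionD(4))

lemma integrable_X_test:
  "f \<in> L1_loc G \<Omega> \<Longrightarrow> \<eta> \<in> test_functions \<Omega> \<Longrightarrow> integrable M (\<lambda>x. indicator \<Omega> x * (f x * X v \<eta> x))"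
  by (rule integrable_times_test[OF _ X_test_function(1) test_functionD(2,3)]) (auto dest: X_test_function(2))

lemma zero_if_test_integrals_zero:
  assumes h: "h \<in> L1_loc G \<Omega>" and W: "open W" "W \<subseteq> \<Omega>"
    and test: "\<And>\<eta>. \<eta> \<in> test_functions W \<Longrightarrow> (LINT x|M. indicator \<Omega> x * (h x * \<eta> x)) = 0"
  shows "AE x\<in>W in M. h x = 0"
proof (cases "c = 0")
  case True
  then show ?thesis by (simp add: AE_M)
next
  case False
  have h_meas: "(\<lambda>x. indicator \<Omega> x * h x) \<in> borel_measurable lebesgue"
    by (rule L1_loc_measurable[OF h])
  have "AE x\<in>W in lebesgue. h x = 0"
  proof (rule fundamental_lemma[OF W(1)])
    fix K
    assume K: "compact K" "K \<subseteq> W"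
    then have int: "integrable M (\<lambda>x. indicator K x * h x)"
      using h W(2) by (auto simp: L1_loc_def set_integrable_def)
    then have "integrable lebesgue (\<lambda>x. c * (indicator K x * h x))"
      using borel_measurable_integrable[OF int] c_nonneg
      unfolding haar_eq by (subst (asm) integrable_density) (auto simp: haar_eq[symmetric] borel_measurable_M)
    then show "set_integrable lebesgue K h"
      using False by (simp add: set_integrable_def)
  next
    fix \<eta>
    assume \<eta>: "\<eta> \<in> test_functions W"
    let ?F = "\<lambda>x. indicator \<Omega> x * (h x * \<eta> x)"
    have int: "integrable M ?F"
      by (rule integrable_test[OF h test_functions_mono[OF W(2) \<eta>]])
    have "(LINT x|M. ?F x) = (LINT x|lebesgue. c * ?F x)"
      using borel_measurable_integrable[OF int] c_nonneg
      unfolding haar_eq by (subst integral_density) (auto simp: haar_eq[symmetric] borel_measurable_M)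
    then have "(LINT x|lebesgue. ?F x) = 0"
      using test[OF \<eta>] False by simp
    moreover have eq: "indicator W x * (h x * \<eta> x) = ?F x" for x
      using W(2) test_functionD(3)[OF \<eta>] test_functionD(4)[OF \<eta>, of x] by (auto simp: indicator_def)
    ultimately show "(LINT x:W|lebesgue. h x * \<eta> x) = 0"
      unfolding set_lebesgue_integral_def real_scaleR_def eq by blast
  qed
  then show ?thesis by (rule AE_M_I)
qed

section \<open>Weak gradients of compositions with Lipschitz functions\<close>

abbreviation D :: "nat \<Rightarrow> ('y \<Rightarrow> real) \<Rightarrow> 'a \<Rightarrow> real" where
  "D j u \<equiv> the_weak_deriv G \<Omega> (frame G j) (u \<circ> \<phi>)"

abbreviation hgrad :: "('y \<Rightarrow> real) \<Rightarrow> 'a \<Rightarrow> real" where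
  "hgrad u \<equiv> hgrad_norm G \<Omega> (u \<circ> \<phi>)"

lemma comp_L1q: "u \<in> Lip \<Longrightarrow> u \<circ> \<phi> \<in> L1q G q \<Omega>"
  using bounded by (simp add: bounded_composition_def)

lemma comp_L1_loc: "u \<in> Lip \<Longrightarrow> u \<circ> \<phi> \<in> L1_loc G \<Omega>"
  using comp_L1q by (auto simp: L1q_def)

lemma weak_deriv_D:
  assumes "u \<in> Lip" "j < hdim G"
  shows "weak_deriv G \<Omega> (frame G j) (u \<circ> \<phi>) (D j u)"
proof -
  have "\<exists>g. weak_deriv G \<Omega> (frame G j) (u \<circ> \<phi>) g"
    using comp_L1q[OF assms(1)] assms(2) unfolding L1q_def by blast
  then show ?thesis
    unfolding the_weak_deriv_def by (rule someI_ex)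
qed

lemma D_L1_loc: "u \<in> Lip \<Longrightarrow> j < hdim G \<Longrightarrow> D j u \<in> L1_loc G \<Omega>"
  using weak_deriv_D by (simp add: weak_deriv_def)

lemma weak_derivD:
  "weak_deriv G \<Omega> v u g \<Longrightarrow> \<eta> \<in> test_functions \<Omega> \<Longrightarrow>
    (LINT x|M. indicator \<Omega> x * (g x * \<eta> x)) = - (LINT x|M. indicator \<Omega> x * (u x * X v \<eta> x))"
  by (auto simp: weak_deriv_def set_lebesgue_integral_def)

lemma const_Lip: "(\<lambda>_. k) \<in> Lip"
  using lip_const_le(1)[of 0 "\<lambda>_. k"] by simp

text \<open>\<open>D j u\<close> is an arbitrary choice among the weak derivatives, while membership
  in the Lebesgue class is known for some weak derivative; the fundamental lemma identifies the two
  almost everywhere.\<close>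

lemma D_Lq:
  assumes "u \<in> Lip" "j < hdim G"
  obtains g where "g \<in> Lq G q \<Omega>" "AE x\<in>\<Omega> in M. D j u x = g x"
proof -
  obtain g where g: "g \<in> Lq G q \<Omega>" "weak_deriv G \<Omega> (frame G j) (u \<circ> \<phi>) g"
    using comp_L1q[OF assms(1)] assms(2) by (auto simp: L1q_def)
  then have g_loc: "g \<in> L1_loc G \<Omega>"
    by (simp add: weak_deriv_def)
  have "AE x\<in>\<Omega> in M. D j u x - g x = 0"
  proof (rule zero_if_test_integrals_zero[OF L1_loc_diff[OF D_L1_loc[OF assms] g_loc] open_\<Omega> order_refl])
    fix \<eta>
    assume \<eta>: "\<eta> \<in> test_functions \<Omega>"
    have "(LINT x|M. indicator \<Omega> x * ((D j u x - g x) * \<eta> x)) =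
        (LINT x|M. indicator \<Omega> x * (D j u x * \<eta> x) - indicator \<Omega> x * (g x * \<eta> x))"
      by (simp add: algebra_simps)
    also have "\<dots> = (LINT x|M. indicator \<Omega> x * (D j u x * \<eta> x)) - (LINT x|M. indicator \<Omega> x * (g x * \<eta> x))"
      by (intro Bochner_Integration.integral_diff integrable_test D_L1_loc assms g_loc \<eta>)
    also have "\<dots> = 0"
      using weak_derivD[OF weak_deriv_D[OF assms] \<eta>] weak_derivD[OF g(2) \<eta>] by simp
    finally show "(LINT x|M. indicator \<Omega> x * ((D j u x - g x) * \<eta> x)) = 0" .
  qed
  then have "AE x\<in>\<Omega> in M. D j u x = g x" by simp
  then show ?thesis using that g(1) by blast
qed

text \<open>Test functions supported in \<open>W\<close> see the relation on \<open>W\<close> only,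
  so the weak derivative is local. The derivative of the constant \<open>k\<close> is carried along
  until \<open>hgrad_const\<close> removes it.\<close>

lemma D_affine:
  assumes u: "u1 \<in> Lip" "u2 \<in> Lip" and j: "j < hdim G" and W: "open W" "W \<subseteq> \<Omega>"
    and eq: "\<And>x. x \<in> W \<Longrightarrow> u1 (\<phi> x) = \<sigma> * u2 (\<phi> x) + k"
  shows "AE x\<in>W in M. D j u1 x - \<sigma> * D j u2 x - D j (\<lambda>_. k) x = 0"
proof (rule zero_if_test_integrals_zero[OF _ W])
  note loc = D_L1_loc[OF u(1) j] D_L1_loc[OF u(2) j] D_L1_loc[OF const_Lip j, of k]
  note cloc = comp_L1_loc[OF u(1)] comp_L1_loc[OF u(2)] comp_L1_loc[OF const_Lip, of k]
  show "(\<lambda>x. D j u1 x - \<sigma> * D j u2 x - D j (\<lambda>_. k) x) \<in> L1_loc G \<Omega>"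
    by (intro L1_loc_diff L1_loc_mult loc)
  fix \<eta>
  assume \<eta>W: "\<eta> \<in> test_functions W"
  then have \<eta>: "\<eta> \<in> test_functions \<Omega>"
    by (rule test_functions_mono[OF W(2)])
  let ?i = "\<lambda>f x. indicator \<Omega> x * (f x * \<eta> x) :: real"
  let ?x = "\<lambda>f x. indicator \<Omega> x * (f x * X (frame G j) \<eta> x) :: real"
  have "(LINT x|M. indicator \<Omega> x * ((D j u1 x - \<sigma> * D j u2 x - D j (\<lambda>_. k) x) * \<eta> x)) =
      (LINT x|M. ?i (D j u1) x - \<sigma> * ?i (D j u2) x - ?i (D j (\<lambda>_. k)) x)"
    by (simp add: algebra_simps)
  also have "\<dots> = (LINT x|M. ?i (D j u1) x) - \<sigma> * (LINT x|M. ?i (D j u2) x) - (LINT x|M. ?i (D j (\<lambda>_. k)) x)"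
    using integrable_test[OF loc(1) \<eta>] integrable_test[OF loc(2) \<eta>] integrable_test[OF loc(3) \<eta>] by simp
  also have "\<dots> = - (LINT x|M. ?x (u1 \<circ> \<phi>) x) + \<sigma> * (LINT x|M. ?x (u2 \<circ> \<phi>) x) + (LINT x|M. ?x ((\<lambda>_. k) \<circ> \<phi>) x)"
    using weak_derivD[OF weak_deriv_D[OF u(1) j] \<eta>] weak_derivD[OF weak_deriv_D[OF u(2) j] \<eta>]
      weak_derivD[OF weak_deriv_D[OF const_Lip j, of k] \<eta>] by simp
  also have "\<dots> = - (LINT x|M. ?x (u1 \<circ> \<phi>) x - \<sigma> * ?x (u2 \<circ> \<phi>) x - ?x ((\<lambda>_. k) \<circ> \<phi>) x)"
    using integrable_X_test[OF cloc(1) \<eta>, of "frame G j"] integrable_X_test[OF cloc(2) \<eta>, of "frame G j"]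
      integrable_X_test[OF cloc(3) \<eta>, of "frame G j"] by simp
  also have "(\<lambda>x. ?x (u1 \<circ> \<phi>) x - \<sigma> * ?x (u2 \<circ> \<phi>) x - ?x ((\<lambda>_. k) \<circ> \<phi>) x) = (\<lambda>_. 0)"
  proof
    fix x
    show "?x (u1 \<circ> \<phi>) x - \<sigma> * ?x (u2 \<circ> \<phi>) x - ?x ((\<lambda>_. k) \<circ> \<phi>) x = 0"
    proof (cases "x \<in> W")
      case True
      then show ?thesis by (simp add: eq algebra_simps)
    next
      case False
      then have "X (frame G j) \<eta> x = 0"
        using test_functionD(3)[OF \<eta>W] by (intro X_test_function(2)[OF \<eta>]) blast
      then show ?thesis by simp
    qed
  qed
  finally show "(LINT x|M. indicator \<Omega> x * ((D j u1 x - \<sigma> * D j u2 x - D j (\<lambda>_. k) x) * \<eta> x)) = 0"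
    by (simp only: Bochner_Integration.integral_zero minus_zero)
qed

lemma hgrad_measurable: "u \<in> Lip \<Longrightarrow> (\<lambda>x. indicator \<Omega> x * hgrad u x) \<in> borel_measurable lebesgue"
proof -
  assume u: "u \<in> Lip"
  have "indicator \<Omega> x * hgrad u x = sqrt (\<Sum>j<hdim G. (indicator \<Omega> x * D j u x)\<^sup>2)" for x
    by (cases "x \<in> \<Omega>") (simp_all add: hgrad_norm_def)
  moreover have "(\<lambda>x. \<Sum>j<hdim G. (indicator \<Omega> x * D j u x)\<^sup>2) \<in> borel_measurable lebesgue"
    by (intro borel_measurable_sum borel_measurable_power L1_loc_measurable D_L1_loc u) auto
  then have "(\<lambda>x. sqrt (\<Sum>j<hdim G. (indicator \<Omega> x * D j u x)\<^sup>2)) \<in> borel_measurable lebesgue"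
    by measurable
  ultimately show ?thesis by simp
qed

lemma hgrad_nonneg: "0 \<le> hgrad u x"
  by (simp add: hgrad_norm_def sum_nonneg)

abbreviation dens :: "('y \<Rightarrow> real) \<Rightarrow> 'a \<Rightarrow> real" where
  "dens u x \<equiv> hgrad u x powr q"

lemma dens_measurable: "u \<in> Lip \<Longrightarrow> (\<lambda>x. indicator \<Omega> x * dens u x) \<in> borel_measurable lebesgue"
proof -
  assume u: "u \<in> Lip"
  have "indicator \<Omega> x * dens u x = (indicator \<Omega> x * hgrad u x) powr q" for x
    by (simp add: indicator_def)
  moreover have "(\<lambda>x. (indicator \<Omega> x * hgrad u x) powr q) \<in> borel_measurable lebesgue"
    using hgrad_measurable[OF u] by measurable
  ultimately show ?thesis by simp
qed

text \<open>The Euclidean norm of the gradient is at most the sum of the moduli of its components,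
  each of which agrees almost everywhere with a function in the Lebesgue class.\<close>

lemma dens_integrable: "u \<in> Lip \<Longrightarrow> integrable M (\<lambda>x. indicator \<Omega> x * dens u x)"
proof -
  assume u: "u \<in> Lip"
  have "\<exists>g. g \<in> Lq G q \<Omega> \<and> (AE x\<in>\<Omega> in M. D j u x = g x)" if "j < hdim G" for j
    using D_Lq[OF u that] by metis
  then obtain g where g: "\<And>j. j < hdim G \<Longrightarrow> g j \<in> Lq G q \<Omega>"
    "\<And>j. j < hdim G \<Longrightarrow> AE x\<in>\<Omega> in M. D j u x = g j x"
    by metis
  let ?n = "hdim G"
  let ?b = "\<lambda>x. real ?n powr q * (\<Sum>j<?n. indicator \<Omega> x * \<bar>g j x\<bar> powr q)"
  have "integrable M ?b"
    using g(1) by (intro integrable_mult_right Bochner_Integration.integrable_sum)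
      (auto simp: Lq_def set_integrable_def)
  moreover have "(\<lambda>x. indicator \<Omega> x * dens u x) \<in> borel_measurable M"
    unfolding borel_measurable_M by (rule dens_measurable[OF u])
  moreover have "AE x in M. \<forall>j\<in>{..<?n}. x \<in> \<Omega> \<longrightarrow> D j u x = g j x"
    using g(2) by (intro AE_finite_allI) auto
  then have "AE x in M. norm (indicator \<Omega> x * dens u x) \<le> norm (?b x)"
  proof eventually_elim
    case (elim x)
    show ?case
    proof (cases "x \<in> \<Omega>")
      case True
      have "hgrad u x = L2_set (\<lambda>j. g j x) {..<?n}"
        using elim True by (simp add: hgrad_norm_def L2_set_def)
      then have "hgrad u x \<le> (\<Sum>j<?n. \<bar>g j x\<bar>)"
        by (simp add: L2_set_le_sum_abs)
      then have "dens u x \<le> (\<Sum>j<?n. \<bar>g j x\<bar>) powr q"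
        using q_ge_1 hgrad_nonneg by (intro powr_mono2) auto
      also have "\<dots> \<le> real ?n powr q * (\<Sum>j<?n. \<bar>g j x\<bar> powr q)"
        using q_ge_1 by (intro powr_sum_le) auto
      finally show ?thesis
        using True by (simp add: sum_nonneg)
    qed simp
  qed
  ultimately show ?thesis
    by (rule Bochner_Integration.integrable_bound)
qed

definition bound :: real where
  "bound = (SOME C. 0 \<le> C \<and> (\<forall>u\<in>Lip. L1q_seminorm G q \<Omega> (u \<circ> \<phi>) \<le> C * lip_const u))"

lemma bound: "0 \<le> bound" "u \<in> Lip \<Longrightarrow> L1q_seminorm G q \<Omega> (u \<circ> \<phi>) \<le> bound * lip_const u"
proof -
  obtain C where C: "\<And>u. u \<in> Lip \<Longrightarrow> L1q_seminorm G q \<Omega> (u \<circ> \<phi>) \<le> C * lip_const u"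
    using bounded by (auto simp: bounded_composition_def)
  \<comment> \<open>\<open>bounded_composition\<close> does not ask the constant to be nonnegative,
    whereas \<open>composition_norm\<close> does.\<close>
  have "L1q_seminorm G q \<Omega> (u \<circ> \<phi>) \<le> max C 0 * lip_const u" if "u \<in> Lip" for u
    using C[OF that] mult_right_mono[of C "max C 0" "lip_const u"] Lip_bound(2)[OF that] by linarith
  then have "0 \<le> max C 0 \<and> (\<forall>u\<in>Lip. L1q_seminorm G q \<Omega> (u \<circ> \<phi>) \<le> max C 0 * lip_const u)"
    by simp
  then have "0 \<le> bound \<and> (\<forall>u\<in>Lip. L1q_seminorm G q \<Omega> (u \<circ> \<phi>) \<le> bound * lip_const u)"
    unfolding bound_def by (rule someI)
  then show "0 \<le> bound" "u \<in> Lip \<Longrightarrow> L1q_seminorm G q \<Omega> (u \<circ> \<phi>) \<le> bound * lip_const u"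
    by blast+
qed

lemma seminorm_eq: "L1q_seminorm G q \<Omega> (u \<circ> \<phi>) = (LINT x|M. indicator \<Omega> x * dens u x) powr (1 / q)"
  using hgrad_nonneg by (simp add: L1q_seminorm_def Lq_norm_def set_lebesgue_integral_def)

lemma nn_integral_dens:
  assumes "u \<in> Lip"
  shows "(\<integral>\<^sup>+x\<in>\<Omega>. ennreal (dens u x) \<partial>M) = ennreal (L1q_seminorm G q \<Omega> (u \<circ> \<phi>) powr q)"
proof -
  have nonneg: "0 \<le> (LINT x|M. indicator \<Omega> x * dens u x)"
    by (intro Bochner_Integration.integral_nonneg) simp
  have "(\<integral>\<^sup>+x\<in>\<Omega>. ennreal (dens u x) \<partial>M) = (\<integral>\<^sup>+x. ennreal (indicator \<Omega> x * dens u x) \<partial>M)"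
    by (intro nn_integral_cong) (simp add: indicator_def)
  also have "\<dots> = ennreal (LINT x|M. indicator \<Omega> x * dens u x)"
    by (rule nn_integral_eq_integral[OF dens_integrable[OF assms]]) simp
  also have "(LINT x|M. indicator \<Omega> x * dens u x) = L1q_seminorm G q \<Omega> (u \<circ> \<phi>) powr q"
    unfolding seminorm_eq using q_ge_1 nonneg by (simp add: powr_powr)
  finally show ?thesis .
qed

lemma nn_integral_dens_le:
  assumes "u \<in> Lip1"
  shows "(\<integral>\<^sup>+x\<in>\<Omega>. ennreal (dens u x) \<partial>M) \<le> ennreal (bound powr q)"
proof -
  have u: "u \<in> Lip" "lip_const u \<le> 1"
    using assms by (auto simp: Lip1_def)
  have "L1q_seminorm G q \<Omega> (u \<circ> \<phi>) \<le> bound * 1"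
    using bound(2)[OF u(1)] mult_left_mono[OF u(2) bound(1)] by linarith
  then show ?thesis
    unfolding nn_integral_dens[OF u(1)] using q_ge_1
    by (intro ennreal_leI powr_mono2) (auto simp: seminorm_eq)
qed

text \<open>The bound of the composition operator forces constants to have zero weak gradient.\<close>

lemma hgrad_const: "AE x\<in>\<Omega> in M. hgrad (\<lambda>_. k) x = 0"
proof -
  have u: "(\<lambda>_::'y. k) \<in> Lip" "lip_const (\<lambda>_::'y. k) \<le> 0"
    using lip_const_le[of 0 "\<lambda>_. k"] by simp_all
  have "L1q_seminorm G q \<Omega> ((\<lambda>_. k) \<circ> \<phi>) \<le> 0"
    using bound(2)[OF u(1)] mult_left_mono[OF u(2) bound(1)] by simp
  moreover have "0 \<le> L1q_seminorm G q \<Omega> ((\<lambda>_. k) \<circ> \<phi>)"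
    by (simp only: seminorm_eq powr_ge_zero)
  ultimately have "L1q_seminorm G q \<Omega> ((\<lambda>_. k) \<circ> \<phi>) = 0"
    by (rule antisym)
  then have "(\<integral>\<^sup>+x\<in>\<Omega>. ennreal (dens (\<lambda>_. k) x) \<partial>M) = 0"
    using nn_integral_dens[OF u(1)] q_ge_1 by simp
  moreover have "(\<lambda>x. ennreal (dens (\<lambda>_. k) x) * indicator \<Omega> x) = (\<lambda>x. ennreal (indicator \<Omega> x * dens (\<lambda>_. k) x))"
    by (auto simp: indicator_def fun_eq_iff)
  moreover have "(\<lambda>x. ennreal (indicator \<Omega> x * dens (\<lambda>_. k) x)) \<in> borel_measurable M"
    unfolding borel_measurable_M using dens_measurable[OF u(1)] by measurable
  ultimately have "AE x in M. ennreal (indicator \<Omega> x * dens (\<lambda>_. k) x) = 0"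
    by (simp add: nn_integral_0_iff_AE)
  then show ?thesis
    by eventually_elim (auto simp: indicator_def ennreal_eq_0_iff order.antisym split: if_splits)
qed

text \<open>Used with slope 1 or -1 on the cells of a saw tooth, with slope 0 where a function is
  constant, and with the reciprocal of a Lipschitz constant for normalisation.\<close>

lemma hgrad_affine:
  assumes u: "u1 \<in> Lip" "u2 \<in> Lip" and W: "open W" "W \<subseteq> \<Omega>"
    and eq: "\<And>x. x \<in> W \<Longrightarrow> u1 (\<phi> x) = \<sigma> * u2 (\<phi> x) + k"
  shows "AE x\<in>W in M. hgrad u1 x = \<bar>\<sigma>\<bar> * hgrad u2 x"
proof -
  have "AE x in M. \<forall>j\<in>{..<hdim G}. x \<in> W \<longrightarrow> D j u1 x - \<sigma> * D j u2 x - D j (\<lambda>_. k) x = 0"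
    using D_affine[OF u _ W eq] by (intro AE_finite_allI) auto
  with hgrad_const[of k] show ?thesis
  proof eventually_elim
    case (elim x)
    show ?case
    proof
      assume x: "x \<in> W"
      have "(\<Sum>j<hdim G. (D j (\<lambda>_. k) x)\<^sup>2) = 0"
        using elim(1) x W(2) by (auto simp: hgrad_norm_def)
      then have "D j (\<lambda>_. k) x = 0" if "j < hdim G" for j
        using that by (simp add: sum_nonneg_eq_0_iff)
      then have "D j u1 x = \<sigma> * D j u2 x" if "j < hdim G" for j
        using elim(2) x that by simp
      then have "(\<Sum>j<hdim G. (D j u1 x)\<^sup>2) = \<sigma>\<^sup>2 * (\<Sum>j<hdim G. (D j u2 x)\<^sup>2)"
        by (simp add: sum_distrib_left power_mult_distrib)
      then show "hgrad u1 x = \<bar>\<sigma>\<bar> * hgrad u2 x"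
        by (simp add: hgrad_norm_def real_sqrt_mult)
    qed
  qed
qed

end

section \<open>The energy as an integral\<close>

context lip_composition
begin

lemma continuous_\<phi>: "continuous_on \<Omega> \<phi>" and \<psi>_\<phi>: "x \<in> \<Omega> \<Longrightarrow> \<psi> (\<phi> x) = x"
  and \<phi>_\<psi>: "\<phi> (\<psi> y) = y" and \<psi>_\<Omega>: "\<psi> y \<in> \<Omega>" and continuous_\<psi>: "continuous_on UNIV \<psi>"
  using homeo by (auto simp: homeomorphism_def)

lemma image_\<phi>: "U \<subseteq> \<Omega> \<Longrightarrow> \<phi> ` U = \<psi> -` U"
  using \<psi>_\<phi> \<phi>_\<psi> by (auto simp: image_iff) (metis subsetD)+

lemma open_image_\<phi>: "open U \<Longrightarrow> U \<subseteq> \<Omega> \<Longrightarrow> open (\<phi> ` U)"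
  by (simp add: image_\<phi> open_vimage continuous_\<psi>)

lemma Lip1_Lip: "u \<in> Lip1 \<Longrightarrow> u \<in> Lip"
  by (simp add: Lip1_def)

text \<open>Images of disjoint compact sets, and such an image and the closed complement of the
  image of \<open>U\<close>, are a positive distance apart. Each bound holds for all sufficiently
  small \<open>h\<close>, so finitely many hold together. The factor 6 is the one in
  \<open>sum_bump_near_Lip1\<close>.\<close>

lemma exists_gap:
  assumes K: "\<And>k. k \<le> (n::nat) \<Longrightarrow> compact (K k)" "\<And>k. k \<le> n \<Longrightarrow> K k \<subseteq> U"
    and disj: "\<And>k l. k \<le> n \<Longrightarrow> l \<le> n \<Longrightarrow> k \<noteq> l \<Longrightarrow> K k \<inter> K l = {}"
    and U: "open U" "U \<subseteq> \<Omega>"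
  shows "\<exists>h>0. (\<forall>k\<le>n. \<forall>l\<le>n. k \<noteq> l \<longrightarrow> (\<forall>y\<in>\<phi> ` K k. \<forall>z\<in>\<phi> ` K l. 6 * h \<le> dist y z)) \<and>
    (\<forall>k\<le>n. \<forall>y\<in>\<phi> ` K k. \<forall>z\<in>- \<phi> ` U. 6 * h \<le> dist y z)"
proof -
  have comp: "compact (\<phi> ` K k)" if "k \<le> n" for k
    using K[OF that] U continuous_\<phi> by (intro compact_continuous_image) (auto intro: continuous_on_subset)
  have small: "\<forall>\<^sub>F h in at_right 0. 6 * h \<le> (d::real)" if "0 < d" for d
    unfolding eventually_at_right_field using that by (intro exI[of _ "d / 6"]) auto
  have "\<forall>\<^sub>F h in at_right (0::real). \<forall>k\<in>{..n}. \<forall>l\<in>{..n}. k \<noteq> l \<longrightarrow> (\<forall>y\<in>\<phi> ` K k. \<forall>z\<in>\<phi> ` K l. 6 * h \<le> dist y z)"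
  proof (intro eventually_ball_finite ballI finite_atMost)
    fix k l
    assume kl: "k \<in> {..n}" "l \<in> {..n}"
    show "\<forall>\<^sub>F h in at_right 0. k \<noteq> l \<longrightarrow> (\<forall>y\<in>\<phi> ` K k. \<forall>z\<in>\<phi> ` K l. 6 * h \<le> dist y z)"
    proof (cases "k = l")
      case False
      have "inj_on \<phi> \<Omega>"
        using \<psi>_\<phi> by (rule inj_on_inverseI)
      then have "\<phi> ` K k \<inter> \<phi> ` K l = \<phi> ` (K k \<inter> K l)"
        using K(2)[of k] K(2)[of l] U(2) kl by (intro inj_on_image_Int[of \<phi> \<Omega>, symmetric]) auto
      then have "\<phi> ` K k \<inter> \<phi> ` K l = {}"
        using disj[of k l] kl False by simp
      then obtain d where d: "0 < d" "\<And>y z. y \<in> \<phi> ` K k \<Longrightarrow> z \<in> \<phi> ` K l \<Longrightarrow> d \<le> dist y z"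
        using compact_closed_gap[OF comp compact_imp_closed[OF comp], of k l] kl by auto
      from small[OF d(1)] show ?thesis
        by eventually_elim (use d(2) in \<open>meson order_trans\<close>)
    qed simp
  qed
  moreover have "\<forall>\<^sub>F h in at_right (0::real). \<forall>k\<in>{..n}. \<forall>y\<in>\<phi> ` K k. \<forall>z\<in>- \<phi> ` U. 6 * h \<le> dist y z"
  proof (rule eventually_ball_finite[OF finite_atMost], rule ballI)
    fix k
    assume k: "k \<in> {..n}"
    have "\<phi> ` K k \<inter> - \<phi> ` U = {}"
      using K(2)[of k] k by auto
    then obtain d where d: "0 < d" "\<And>y z. y \<in> \<phi> ` K k \<Longrightarrow> z \<in> - \<phi> ` U \<Longrightarrow> d \<le> dist y z"
      using compact_closed_gap[OF comp closed_Compl[OF open_image_\<phi>[OF U]], of k] k by auto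
    from small[OF d(1)] show "\<forall>\<^sub>F h in at_right 0. \<forall>y\<in>\<phi> ` K k. \<forall>z\<in>- \<phi> ` U. 6 * h \<le> dist y z"
      by eventually_elim (use d(2) in \<open>meson order_trans\<close>)
  qed
  moreover have "\<forall>\<^sub>F h in at_right (0::real). 0 < h"
    by (rule eventually_at_right_less)
  ultimately have "\<forall>\<^sub>F h in at_right (0::real). 0 < h \<and>
      (\<forall>k\<in>{..n}. \<forall>l\<in>{..n}. k \<noteq> l \<longrightarrow> (\<forall>y\<in>\<phi> ` K k. \<forall>z\<in>\<phi> ` K l. 6 * h \<le> dist y z)) \<and>
      (\<forall>k\<in>{..n}. \<forall>y\<in>\<phi> ` K k. \<forall>z\<in>- \<phi> ` U. 6 * h \<le> dist y z)"
    by eventually_elim blast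
  then have "\<exists>h. 0 < h \<and>
      (\<forall>k\<in>{..n}. \<forall>l\<in>{..n}. k \<noteq> l \<longrightarrow> (\<forall>y\<in>\<phi> ` K k. \<forall>z\<in>\<phi> ` K l. 6 * h \<le> dist y z)) \<and>
      (\<forall>k\<in>{..n}. \<forall>y\<in>\<phi> ` K k. \<forall>z\<in>- \<phi> ` U. 6 * h \<le> dist y z)"
    using eventually_happens'[OF trivial_limit_at_right_real] by blast
  then show ?thesis
    by (simp only: Ball_def atMost_iff)
qed

text \<open>Distinct functions are glued along disjoint compact sets. Folding their values into \<open>[0, h]\<close>
  by a saw tooth makes truncation compatible with the Lipschitz constant; the grid of the saw tooth
  is shifted such that its corners are hit on null sets only.\<close>

lemma glue:
  assumes u: "\<And>k. k \<le> n \<Longrightarrow> u k \<in> Lip1"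
    and K: "\<And>k. k \<le> (n::nat) \<Longrightarrow> compact (K k)" "\<And>k. k \<le> n \<Longrightarrow> K k \<subseteq> U"
    and disj: "\<And>k l. k \<le> n \<Longrightarrow> l \<le> n \<Longrightarrow> k \<noteq> l \<Longrightarrow> K k \<inter> K l = {}"
    and U: "open U" "U \<subseteq> \<Omega>"
  shows "\<exists>v. v \<in> Lip1 \<and> 0 < set_edist (spt v) (UNIV - \<phi> ` U) \<and>
    (\<forall>k\<le>n. AE x\<in>K k in M. hgrad v x = hgrad (u k) x)"
proof -
  obtain h where h: "0 < h"
    and h_gap: "\<forall>k\<le>n. \<forall>l\<le>n. k \<noteq> l \<longrightarrow> (\<forall>y\<in>\<phi> ` K k. \<forall>z\<in>\<phi> ` K l. 6 * h \<le> dist y z)"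
    and h_gapU: "\<forall>k\<le>n. \<forall>y\<in>\<phi> ` K k. \<forall>z\<in>- \<phi> ` U. 6 * h \<le> dist y z"
  proof -
    have "\<exists>h>0. (\<forall>k\<le>n. \<forall>l\<le>n. k \<noteq> l \<longrightarrow> (\<forall>y\<in>\<phi> ` K k. \<forall>z\<in>\<phi> ` K l. 6 * h \<le> dist y z)) \<and>
        (\<forall>k\<le>n. \<forall>y\<in>\<phi> ` K k. \<forall>z\<in>- \<phi> ` U. 6 * h \<le> dist y z)"
      by (rule exists_gap[OF K disj U])
    then show ?thesis
      by (elim exE conjE) (rule that)
  qed
  have gap: "6 * h \<le> dist y z" if "k \<noteq> l" "k \<le> n" "l \<le> n" "y \<in> \<phi> ` K k" "z \<in> \<phi> ` K l" for k l y z
    using h_gap that by blast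
  have gapU: "6 * h \<le> dist y z" if "k \<le> n" "y \<in> \<phi> ` K k" "z \<notin> \<phi> ` U" for k y z
    using h_gapU that by blast
  define L where "L k = \<phi> ` K k" for k
  \<comment> \<open>Padding by the zero function makes the Lipschitz and range bounds hold for every
    index, as \<open>sum_bump_near_Lip1\<close> states them.\<close>
  define u' where "u' k = (if k \<le> n then u k else (\<lambda>_. 0))" for k
  have u'_Lip1: "u' k \<in> Lip1" for k
    using u by (simp add: u'_def Lip1_iff)
  have cont_u: "continuous_on \<Omega> (\<lambda>x. u' k (\<phi> x))" for k
    by (rule continuous_on_compose2[OF Lip1_continuous_on[OF u'_Lip1, of UNIV] continuous_\<phi>]) simp
  define Bad where "Bad k = {t. {x \<in> \<Omega>. u' k (\<phi> x) = t} \<notin> null_sets lebesgue}" for k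
  have "countable (Bad k)" for k
    unfolding Bad_def by (rule countable_positive_levels[OF open_\<Omega> cont_u])
  then have "countable (\<Union>k. \<Union>i::int. (\<lambda>t. t - h * real_of_int i) ` Bad k)"
    by (intro countable_UN countable_image) auto
  \<comment> \<open>Only countably many phases put some grid point \<open>a + h * i\<close> on a
    level that one of the functions takes on a set that is not null.\<close>
  then obtain a where a: "a \<notin> (\<Union>k. \<Union>i::int. (\<lambda>t. t - h * real_of_int i) ` Bad k)"
    using uncountable_UNIV_real by (metis UNIV_eq_I)
  have null: "{x \<in> \<Omega>. u' k (\<phi> x) = a + h * real_of_int i} \<in> null_sets lebesgue" for k i
  proof (rule ccontr)
    assume "\<not> ?thesis"
    then have "a + h * real_of_int i \<in> Bad k"
      by (simp add: Bad_def)
    then have "a \<in> (\<lambda>t. t - h * real_of_int i) ` Bad k"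
      by (rule rev_image_eqI) simp
    then show False using a by blast
  qed
  define f where "f k y = saw a h (u' k y)" for k y
  have f_lip: "\<bar>f k y - f k z\<bar> \<le> dist y z" for k y z
    using saw_lip[of a h "u' k y" "u' k z"] u'_Lip1[of k] unfolding f_def Lip1_iff by (meson order_trans)
  have f_rng: "0 \<le> f k y" "f k y \<le> h" for k y
    by (simp_all add: f_def saw_nonneg saw_le h)
  define v where "v y = (\<Sum>k\<le>n. bump_near h (L k) (f k) y)" for y
  have v_Lip1: "v \<in> Lip1"
    unfolding v_def using gap by (intro sum_bump_near_Lip1[OF h f_lip f_rng]) (auto simp: L_def)
  have near: "\<exists>p\<in>L k. dist y p < r" if "L k \<noteq> {}" "infdist y (L k) < r" for k y r
    by (rule infdist_less_imp[OF that])
  have "{y. v y \<noteq> 0} \<subseteq> (\<Union>k\<in>{k. k \<le> n \<and> L k \<noteq> {}}. {y. infdist y (L k) \<le> 2 * h})"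
  proof
    fix y
    assume "y \<in> {y. v y \<noteq> 0}"
    then obtain k where "k \<le> n" "bump_near h (L k) (f k) y \<noteq> 0"
      unfolding v_def by (auto elim: sum.not_neutral_contains_not_neutral)
    then show "y \<in> (\<Union>k\<in>{k. k \<le> n \<and> L k \<noteq> {}}. {y. infdist y (L k) \<le> 2 * h})"
      using bump_near_support[of "f k" y h "L k"] f_rng(1) by force
  qed
  moreover have "closed (\<Union>k\<in>{k. k \<le> n \<and> L k \<noteq> {}}. {y. infdist y (L k) \<le> 2 * h})"
    by (intro closed_UN ballI closed_Collect_le continuous_on_infdist continuous_on_id continuous_on_const) auto
  ultimately have spt: "spt v \<subseteq> (\<Union>k\<in>{k. k \<le> n \<and> L k \<noteq> {}}. {y. infdist y (L k) \<le> 2 * h})"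
    unfolding spt_def by (rule closure_minimal)
  \<comment> \<open>A point of the support is closer than \<open>3 * h\<close> to some image, and
    that image is at least \<open>6 * h\<close> away from the complement.\<close>
  have "ennreal (3 * h) \<le> set_edist (spt v) (UNIV - \<phi> ` U)"
    unfolding set_edist_def
  proof (rule INF_greatest)
    fix p
    assume "p \<in> spt v \<times> (UNIV - \<phi> ` U)"
    then obtain y z where p: "p = (y, z)" "y \<in> spt v" "z \<notin> \<phi> ` U" by auto
    obtain k where k: "k \<le> n" "L k \<noteq> {}" "infdist y (L k) \<le> 2 * h"
      using spt p(2) by blast
    then obtain w where w: "w \<in> L k" "dist y w < 3 * h"
      using near[of k y "3 * h"] h by auto
    have "6 * h \<le> dist w z"
      using gapU[OF k(1) _ p(3)] w(1) by (simp add: L_def)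
    then have "3 * h \<le> dist y z"
      using w(2) dist_triangle[of w z y] by (simp add: dist_commute)
    then show "ennreal (3 * h) \<le> (case p of (a, b) \<Rightarrow> ennreal (dist a b))"
      by (simp add: p(1) ennreal_leI)
  qed
  then have pos: "0 < set_edist (spt v) (UNIV - \<phi> ` U)"
    using h by (metis ennreal_less_zero_iff less_le_trans mult_pos_pos zero_less_numeral)
  have ae: "AE x\<in>K k in M. hgrad v x = hgrad (u k) x" if k: "k \<le> n" for k
  proof (cases "K k = {}")
    case False
    \<comment> \<open>On \<open>W i\<close> the \<open>k\<close>-th bump is the only active one and
      is not truncated, and \<open>u k\<close> stays in one cell of the saw tooth; so there
      \<open>v\<close> is plus or minus \<open>u k\<close> up to a constant. The sets
      \<open>W i\<close> cover \<open>K k\<close> up to the grid levels, which are null.\<close>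
    define W where "W i = (\<Omega> \<inter> (\<lambda>x. infdist (\<phi> x) (L k)) -` {..<h}) \<inter>
        (\<Omega> \<inter> (\<lambda>x. u' k (\<phi> x)) -` {a + h * real_of_int i<..<a + h * real_of_int (i + 1)})" for i :: int
    have W: "open (W i)" "W i \<subseteq> \<Omega>" for i
      unfolding W_def
      by (intro open_Int continuous_open_preimage open_\<Omega> cont_u continuous_on_infdist continuous_\<phi>; simp) auto
    have "AE x in M. x \<in> W i \<longrightarrow> hgrad v x = hgrad (u k) x" for i
    proof -
      obtain \<sigma> b :: real where \<sigma>: "\<bar>\<sigma>\<bar> = 1"
        "\<And>t. a + h * real_of_int i < t \<Longrightarrow> t < a + h * real_of_int (i + 1) \<Longrightarrow> saw a h t = \<sigma> * t + b"
        using saw_affine[OF h, of a i] by metis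
      have "v (\<phi> x) = \<sigma> * u k (\<phi> x) + b" if x: "x \<in> W i" for x
      proof -
        have Lk: "L k \<noteq> {}" using False by (simp add: L_def)
        have inf: "infdist (\<phi> x) (L k) < h" using x by (simp add: W_def)
        obtain p where p: "p \<in> L k" "dist (\<phi> x) p < h"
          using near[OF Lk inf] by blast
        have zero: "bump_near h (L l) (f l) (\<phi> x) = 0" if l: "l \<le> n" "l \<noteq> k" for l
        proof (rule ccontr)
          assume "\<not> ?thesis"
          then have "L l \<noteq> {}" "infdist (\<phi> x) (L l) < 2 * h"
            using bump_near_support[of "f l" "\<phi> x" h "L l"] f_rng(1) by blast+
          then obtain p' where p': "p' \<in> L l" "dist (\<phi> x) p' < 2 * h"
            using near by blast
          have "6 * h \<le> dist p p'"
            using gap[of k l p p'] l k p(1) p'(1) by (simp add: L_def)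
          also have "\<dots> \<le> dist (\<phi> x) p + dist (\<phi> x) p'"
            using dist_triangle[of p p' "\<phi> x"] by (simp add: dist_commute)
          finally show False using p(2) p'(2) h by simp
        qed
        have "v (\<phi> x) = bump_near h (L k) (f k) (\<phi> x)"
          unfolding v_def using k zero
            sum.mono_neutral_right[of "{..n}" "{k}" "\<lambda>l. bump_near h (L l) (f l) (\<phi> x)"] by auto
        also have "\<dots> = f k (\<phi> x)"
          by (rule bump_near_eq[OF Lk f_rng inf])
        also have "\<dots> = \<sigma> * u k (\<phi> x) + b"
          using x k \<sigma>(2) by (simp add: f_def W_def u'_def)
        finally show ?thesis .
      qed
      then have "AE x\<in>W i in M. hgrad v x = \<bar>\<sigma>\<bar> * hgrad (u k) x"
        using u[OF k] v_Lip1 W by (intro hgrad_affine) (auto intro: Lip1_Lip)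
      then show ?thesis using \<sigma>(1) by simp
    qed
    then have "AE x in M. \<forall>i. x \<in> W i \<longrightarrow> hgrad v x = hgrad (u k) x"
      by (intro AE_all_countable[THEN iffD2] allI)
    moreover have "AE x in M. x \<notin> (\<Union>i. {x \<in> \<Omega>. u' k (\<phi> x) = a + h * real_of_int i})"
      using null by (intro AE_M_I AE_not_in null_sets_UN')  auto
    ultimately show ?thesis
    proof eventually_elim
      case (elim x)
      show ?case
      proof
        assume x: "x \<in> K k"
        then have x\<Omega>: "x \<in> \<Omega>" using K(2)[OF k] U(2) by blast
        have "infdist (\<phi> x) (L k) \<le> dist (\<phi> x) (\<phi> x)"
          using x by (intro infdist_le) (simp add: L_def)
        then have inf: "infdist (\<phi> x) (L k) < h" using h by simp
        have "\<And>i::int. u' k (\<phi> x) \<noteq> a + h * real_of_int i"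
          using elim(2) x\<Omega> by blast
        then obtain i :: int where "a + h * real_of_int i < u' k (\<phi> x)" "u' k (\<phi> x) < a + h * real_of_int (i + 1)"
          using grid_cell[OF h] by metis
        then have "x \<in> W i"
          using inf x\<Omega> by (simp add: W_def)
        then show "hgrad v x = hgrad (u k) x" using elim(1) by blast
      qed
    qed
  qed simp
  show ?thesis
    using v_Lip1 pos ae by (intro exI[of _ v]) simp
qed

lemma dens_ennreal_measurable: "u \<in> Lip \<Longrightarrow> S \<in> sets lebesgue \<Longrightarrow> S \<subseteq> \<Omega> \<Longrightarrow>
  (\<lambda>x. ennreal (dens u x) * indicator S x) \<in> borel_measurable M"
proof -
  assume u: "u \<in> Lip" and S: "S \<in> sets lebesgue" "S \<subseteq> \<Omega>"
  have "ennreal (dens u x) * indicator S x = ennreal (indicator \<Omega> x * dens u x) * indicator S x" for x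
    using S(2) by (auto simp: indicator_def)
  moreover have "(\<lambda>x. ennreal (indicator \<Omega> x * dens u x) * indicator S x) \<in> borel_measurable M"
    unfolding borel_measurable_M using dens_measurable[OF u] S(1) by measurable
  ultimately show ?thesis by simp
qed

text \<open>\<open>U\<close> is divided according to which \<open>u k\<close> has the largest
  gradient. Compact subsets of the pieces are disjoint, so \<open>glue\<close> gives one competitor
  with the right gradient on all of them; monotone convergence recovers \<open>U\<close> up to a
  null set.\<close>

lemma energy_ge_finite:
  assumes u: "\<And>k. u k \<in> Lip1" and U: "open U" "U \<subseteq> \<Omega>"
  shows "(\<integral>\<^sup>+x\<in>U. (SUP k\<in>{..n::nat}. ennreal (dens (u k) x)) \<partial>M) \<le> energy G q \<Omega> \<phi> (\<phi> ` U)"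
proof -
  define d where "d k x = indicator \<Omega> x * dens (u k) x" for k x
  have d_meas [measurable]: "d k \<in> borel_measurable lebesgue" for k
    unfolding d_def[abs_def] using u by (intro dens_measurable) (rule Lip1_Lip)
  have U_meas [measurable]: "U \<in> sets lebesgue"
    using U(1) by simp
  \<comment> \<open>Ties go to the smallest index, which makes the pieces disjoint.\<close>
  define A where "A k = {x \<in> U. (\<forall>j\<in>{..n}. d j x \<le> d k x) \<and> (\<forall>j\<in>{..<k}. d j x < d k x)}" for k
  have "A k \<in> sets lebesgue" for k
  proof -
    have "{x \<in> space lebesgue. x \<in> U \<and> (\<forall>j\<in>{..n}. d j x \<le> d k x) \<and> (\<forall>j\<in>{..<k}. d j x < d k x)} \<in> sets lebesgue"
      by measurable
    then show ?thesis by (simp add: A_def)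
  qed
  then have "\<exists>Z C. negligible Z \<and> (\<forall>m::nat. compact (C m)) \<and> A k = (\<Union>m. C m) \<union> Z" for k
    using lebesgue_regular_inner[of "A k"] by metis
  then obtain Z C where Z: "\<And>k. negligible (Z k)" and C: "\<And>k m::nat. compact (C k m)"
    and AC: "\<And>k. A k = (\<Union>m. C k m) \<union> Z k"
    by metis
  have disjA: "A k \<inter> A l = {}" if "k \<le> n" "l \<le> n" "k \<noteq> l" for k l
  proof -
    have "A i \<inter> A j = {}" if "i < j" "i \<le> n" "j \<le> n" for i j
    proof -
      have False if x: "x \<in> A i" "x \<in> A j" for x
      proof -
        have "d j x \<le> d i x"
          using x(1) \<open>j \<le> n\<close> by (simp add: A_def)
        moreover have "d i x < d j x"
          using x(2) \<open>i < j\<close> by (simp add: A_def)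
        ultimately show False by simp
      qed
      then show ?thesis by blast
    qed
    from this[of k l] this[of l k] that show ?thesis
      by (cases k l rule: linorder_cases) (simp_all add: Int_commute)
  qed
  have coverA: "\<exists>k\<le>n. x \<in> A k" if "x \<in> U" for x
  proof -
    have fin: "finite ((\<lambda>k. d k x) ` {..n})" "(\<lambda>k. d k x) ` {..n} \<noteq> {}" by auto
    define P where "P k \<longleftrightarrow> k \<le> n \<and> (\<forall>j\<in>{..n}. d j x \<le> d k x)" for k
    obtain k where "k \<le> n" "d k x = Max ((\<lambda>k. d k x) ` {..n})"
      using Max_in[OF fin] unfolding image_iff Bex_def atMost_iff by (metis (no_types))
    then have "P k"
      using fin(1) by (auto simp: P_def)
    define k0 where "k0 = (LEAST k. P k)"
    have P: "P k0"
      unfolding k0_def by (rule LeastI[of P, OF \<open>P k\<close>])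
    have "d j x < d k0 x" if "j < k0" for j
    proof (rule ccontr)
      assume "\<not> d j x < d k0 x"
      then have "P j"
        using P that by (auto simp: P_def intro: order_trans)
      then show False
        using not_less_Least[of j P] that by (simp add: k0_def)
    qed
    then have "x \<in> A k0"
      using P that by (auto simp: A_def P_def)
    then show ?thesis using P by (auto simp: P_def)
  qed
  \<comment> \<open>Finite unions, so that the compact sets increase with \<open>m\<close> and
    monotone convergence applies.\<close>
  define K where "K m k = (\<Union>i\<le>m. C k i)" for m k
  have K: "compact (K m k)" "K m k \<subseteq> A k" for m k
    unfolding K_def using C AC by (auto intro!: compact_UN)
  have KU: "K m k \<subseteq> U" for m k
    using K(2)[of m k] by (auto simp: A_def)
  define s where "s m x = (\<Sum>k\<le>n. ennreal (dens (u k) x) * indicator (K m k) x)" for m x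
  have s_le: "(\<integral>\<^sup>+x. s m x \<partial>M) \<le> energy G q \<Omega> \<phi> (\<phi> ` U)" for m
  proof -
    have disjK: "K m k \<inter> K m l = {}" if "k \<le> n" "l \<le> n" "k \<noteq> l" for k l
      using disjA[OF that] K(2)[of m k] K(2)[of m l] by blast
    have "\<exists>v. v \<in> Lip1 \<and> 0 < set_edist (spt v) (UNIV - \<phi> ` U) \<and>
        (\<forall>k\<le>n. AE x\<in>K m k in M. hgrad v x = hgrad (u k) x)"
      by (rule glue[OF u K(1) KU disjK U])
    then obtain v where v: "v \<in> Lip1" "0 < set_edist (spt v) (UNIV - \<phi> ` U)"
      "\<forall>k\<le>n. AE x\<in>K m k in M. hgrad v x = hgrad (u k) x"
      by (elim exE conjE) (rule that)
    have "AE x in M. \<forall>k\<in>{..n}. x \<in> K m k \<longrightarrow> hgrad v x = hgrad (u k) x"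
      using v(3) by (intro AE_finite_allI) auto
    then have "AE x in M. s m x \<le> ennreal (dens v x) * indicator \<Omega> x"
    proof eventually_elim
      case (elim x)
      show ?case
      proof (cases "\<exists>k\<le>n. x \<in> K m k")
        case True
        then obtain k where k: "k \<le> n" "x \<in> K m k" by blast
        have "x \<notin> K m l" if "l \<le> n" "l \<noteq> k" for l
          using disjK[OF k(1) that(1)] that(2) k(2) by blast
        then have "s m x = ennreal (dens (u k) x)"
          unfolding s_def using k
            sum.mono_neutral_right[of "{..n}" "{k}" "\<lambda>k. ennreal (dens (u k) x) * indicator (K m k) x"] by auto
        then show ?thesis
          using elim k KU[of m k] U(2) by auto
      next
        case False
        then have "s m x = 0"
          unfolding s_def by (intro sum.neutral) auto
        then show ?thesis by simp
      qed
    qed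
    then have "(\<integral>\<^sup>+x. s m x \<partial>M) \<le> (\<integral>\<^sup>+x\<in>\<Omega>. ennreal (dens v x) \<partial>M)"
      by (rule nn_integral_mono_AE)
    also have "\<dots> \<le> energy G q \<Omega> \<phi> (\<phi> ` U)"
      unfolding energy_def using v(1,2) by (intro SUP_upper) (auto simp: Lip1_def)
    finally show ?thesis .
  qed
  have "AE x in lebesgue. \<forall>k\<in>{..n}. x \<notin> Z k"
    using Z by (intro AE_finite_allI AE_not_in) (auto simp: negligible_iff_null_sets)
  then have "AE x in M. \<forall>k\<in>{..n}. x \<notin> Z k"
    by (rule AE_M_I)
  then have "AE x in M. (SUP k\<in>{..n}. ennreal (dens (u k) x)) * indicator U x \<le> (SUP m. s m x)"
  proof eventually_elim
    case (elim x)
    show ?case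
    proof (cases "x \<in> U")
      case True
      obtain k where k: "k \<le> n" "x \<in> A k" using coverA[OF True] by blast
      then obtain i where i: "x \<in> C k i"
        using elim AC[of k] by auto
      have x\<Omega>: "x \<in> \<Omega>" using True U(2) by blast
      have "(SUP k\<in>{..n}. ennreal (dens (u k) x)) \<le> ennreal (dens (u k) x)"
        using k(2) x\<Omega> by (intro SUP_least ennreal_leI) (auto simp: A_def d_def)
      also have "\<dots> = ennreal (dens (u k) x) * indicator (K i k) x"
      proof -
        have "x \<in> K i k" using i by (auto simp: K_def)
        then show ?thesis by simp
      qed
      also have "\<dots> \<le> s i x"
        unfolding s_def using k(1) by (intro member_le_sum) auto
      also have "\<dots> \<le> (SUP m. s m x)"
        by (rule SUP_upper) simp
      finally show ?thesis using True by simp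
    qed simp
  qed
  then have "(\<integral>\<^sup>+x\<in>U. (SUP k\<in>{..n::nat}. ennreal (dens (u k) x)) \<partial>M) \<le> (\<integral>\<^sup>+x. (SUP m. s m x) \<partial>M)"
    by (rule nn_integral_mono_AE)
  also have "\<dots> = (SUP m. \<integral>\<^sup>+x. s m x \<partial>M)"
  proof (rule nn_integral_monotone_convergence_SUP)
    show "incseq s"
      unfolding s_def incseq_def le_fun_def
      by (intro allI impI sum_mono mult_left_mono) (auto simp: K_def indicator_def)
    show "s m \<in> borel_measurable M" for m
      unfolding s_def[abs_def] using K(1) subset_trans[OF KU U(2)] u
      by (intro borel_measurable_sum dens_ennreal_measurable) (auto intro: Lip1_Lip simp: lmeasurable_compact fmeasurableD)
  qed
  also have "\<dots> \<le> energy G q \<Omega> \<phi> (\<phi> ` U)"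
    using s_le by (rule SUP_least)
  finally show ?thesis .
qed

lemma energy_ge:
  assumes u: "\<And>k::nat. u k \<in> Lip1" and U: "open U" "U \<subseteq> \<Omega>"
  shows "(\<integral>\<^sup>+x\<in>U. (SUP k. ennreal (dens (u k) x)) \<partial>M) \<le> energy G q \<Omega> \<phi> (\<phi> ` U)"
proof -
  let ?F = "\<lambda>n x. (SUP k\<in>{..n}. ennreal (dens (u k) x)) * indicator U x"
  have "(SUP k. ennreal (dens (u k) x)) * indicator U x = (SUP n. ?F n x)" for x
  proof (cases "x \<in> U")
    case True
    have "(SUP k. ennreal (dens (u k) x)) = (SUP n. SUP k\<in>{..n}. ennreal (dens (u k) x))"
      by (intro antisym SUP_least) (auto intro: SUP_upper2 SUP_upper)
    then show ?thesis using True by simp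
  qed simp
  then have "(\<integral>\<^sup>+x\<in>U. (SUP k. ennreal (dens (u k) x)) \<partial>M) = (\<integral>\<^sup>+x. (SUP n. ?F n x) \<partial>M)"
    by simp
  also have "\<dots> = (SUP n. \<integral>\<^sup>+x. ?F n x \<partial>M)"
  proof (rule nn_integral_monotone_convergence_SUP)
    show "incseq ?F"
      by (auto simp: incseq_def le_fun_def indicator_def intro!: SUP_subset_mono)
    show "?F n \<in> borel_measurable M" for n
    proof -
      have "?F n x = (SUP k\<in>{..n}. ennreal (dens (u k) x) * indicator U x)" for x
        by (cases "x \<in> U") auto
      moreover have "(\<lambda>x. SUP k\<in>{..n}. ennreal (dens (u k) x) * indicator U x) \<in> borel_measurable M"
        using u U by (intro borel_measurable_SUP dens_ennreal_measurable) (auto intro: Lip1_Lip)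
      ultimately show ?thesis by simp
    qed
  qed
  also have "\<dots> \<le> energy G q \<Omega> \<phi> (\<phi> ` U)"
    by (intro SUP_least energy_ge_finite u U)
  finally show ?thesis .
qed

text \<open>The support of a competitor is contained in the image of \<open>U\<close>, so its
  composition is zero on an open set containing the rest of \<Omega>, and by
  \<open>hgrad_affine\<close> its gradient vanishes almost everywhere there.\<close>

lemma energy_le:
  assumes H: "\<And>u. u \<in> Lip1 \<Longrightarrow> AE x\<in>\<Omega> in M. ennreal (dens u x) \<le> H x" and U: "open U" "U \<subseteq> \<Omega>"
  shows "energy G q \<Omega> \<phi> (\<phi> ` U) \<le> (\<integral>\<^sup>+x\<in>U. H x \<partial>M)"
  unfolding energy_def
proof (rule SUP_least)
  fix u :: "'y \<Rightarrow> real"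
  assume "u \<in> {u \<in> Lip. lip_const u \<le> 1 \<and> 0 < set_edist (spt u) (UNIV - \<phi> ` U)}"
  then have u: "u \<in> Lip" "u \<in> Lip1" "0 < set_edist (spt u) (UNIV - \<phi> ` U)"
    by (auto simp: Lip1_def)
  have spt: "spt u \<subseteq> \<phi> ` U"
  proof
    fix y
    assume y: "y \<in> spt u"
    show "y \<in> \<phi> ` U"
    proof (rule ccontr)
      assume "y \<notin> \<phi> ` U"
      then have "set_edist (spt u) (UNIV - \<phi> ` U) \<le> ennreal (dist y y)"
        unfolding set_edist_def using y by (intro INF_lower2[of "(y, y)"]) auto
      then show False using u(3) by simp
    qed
  qed
  define W where "W = \<Omega> \<inter> \<phi> -` (- spt u)"
  have "open W"
    unfolding W_def spt_def by (intro continuous_open_preimage continuous_\<phi> open_\<Omega>) auto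
  \<comment> \<open>Written in the shape of \<open>hgrad_affine\<close>, with slope 0 and the zero
    function as second function.\<close>
  moreover have "u (\<phi> x) = 0 * 0 + 0" if "x \<in> W" for x
    using that closure_subset[of "{y. u y \<noteq> 0}"] by (auto simp: W_def spt_def)
  ultimately have "AE x\<in>W in M. hgrad u x = \<bar>0\<bar> * hgrad (\<lambda>_. 0) x"
    by (intro hgrad_affine u(1) const_Lip) (auto simp: W_def)
  with H[OF u(2)] have "AE x in M. ennreal (dens u x) * indicator \<Omega> x \<le> H x * indicator U x"
  proof eventually_elim
    case (elim x)
    show ?case
    proof (cases "x \<in> \<Omega> \<and> x \<notin> U")
      case True
      then have "\<phi> x \<notin> \<phi> ` U"
        using U(2) \<psi>_\<phi> by (metis image_iff subsetD)
      then have "x \<in> W"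
        using True spt by (auto simp: W_def)
      then have "hgrad u x = 0"
        using elim(2) by simp
      then show ?thesis using q_ge_1 by simp
    next
      case False
      then show ?thesis
        using elim(1) U(2) by (auto simp: indicator_def)
    qed
  qed
  then show "(\<integral>\<^sup>+x\<in>\<Omega>. ennreal (hgrad_norm G \<Omega> (u \<circ> \<phi>) x powr q) \<partial>M) \<le> (\<integral>\<^sup>+x\<in>U. H x \<partial>M)"
    by (rule nn_integral_mono_AE)
qed

section \<open>A countable family attaining the essential supremum of the gradients\<close>

lemma image_\<phi>_\<Omega>: "\<phi> ` \<Omega> = UNIV"
  using homeo by (simp add: homeomorphism_def)

lemma energy_UNIV_le: "energy G q \<Omega> \<phi> UNIV \<le> ennreal (bound powr q)"
  unfolding energy_def by (rule SUP_least) (use nn_integral_dens_le in \<open>auto simp: Lip1_def\<close>)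

lemma SUP_dens_measurable:
  assumes "\<And>k::nat. f k \<in> Lip1"
  shows "(\<lambda>x. (SUP k. ennreal (dens (f k) x)) * indicator \<Omega> x) \<in> borel_measurable M"
proof -
  have "(SUP k. ennreal (dens (f k) x)) * indicator \<Omega> x = (SUP k. ennreal (dens (f k) x) * indicator \<Omega> x)" for x
    by (cases "x \<in> \<Omega>") auto
  moreover have "(\<lambda>x. SUP k. ennreal (dens (f k) x) * indicator \<Omega> x) \<in> borel_measurable M"
    using assms open_\<Omega> by (intro borel_measurable_SUP dens_ennreal_measurable) (auto intro: Lip1_Lip)
  ultimately show ?thesis by simp
qed

text \<open>Each single competitor is controlled by the operator bound; the step from there to the
  supremum is \<open>energy_ge\<close>, that is, the gluing.\<close>

lemma SUP_dens_finite:
  assumes "\<And>k::nat. f k \<in> Lip1"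
  shows "(\<integral>\<^sup>+x. (SUP k. ennreal (dens (f k) x)) * indicator \<Omega> x \<partial>M) < \<infinity>"
proof -
  have "(\<integral>\<^sup>+x. (SUP k. ennreal (dens (f k) x)) * indicator \<Omega> x \<partial>M) \<le> energy G q \<Omega> \<phi> (\<phi> ` \<Omega>)"
    using assms by (intro energy_ge open_\<Omega>) auto
  also have "\<dots> \<le> ennreal (bound powr q)"
    unfolding image_\<phi>_\<Omega> by (rule energy_UNIV_le)
  finally show ?thesis
    by (simp add: order.strict_trans1)
qed

text \<open>Among countable families one maximises the integral of the supremum, since countably
  many families can be merged into one. Adding a further \<open>u\<close> cannot raise that finite
  integral, so \<open>u\<close> is dominated almost everywhere.\<close>

lemma exists_maximal_family:
  obtains f :: "nat \<Rightarrow> 'y \<Rightarrow> real" where "\<And>k. f k \<in> Lip1"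
    "\<And>u. u \<in> Lip1 \<Longrightarrow> AE x\<in>\<Omega> in M. ennreal (dens u x) \<le> (SUP k. ennreal (dens (f k) x))"
proof -
  let ?\<F> = "{f :: nat \<Rightarrow> 'y \<Rightarrow> real. \<forall>k. f k \<in> Lip1}"
  let ?H = "\<lambda>f x. (SUP k. ennreal (dens (f k) x)) * indicator \<Omega> x"
  let ?I = "\<lambda>f. \<integral>\<^sup>+x. ?H f x \<partial>M"
  have H_meas: "?H f \<in> borel_measurable M" and I_fin: "?I f < \<infinity>" if "f \<in> ?\<F>" for f
    using SUP_dens_measurable[of f] SUP_dens_finite[of f] that by blast+
  have "(\<lambda>_ _. 0) \<in> ?\<F>"
    by (simp add: Lip1_iff)
  then have "?\<F> \<noteq> {}" by (metis (no_types) empty_iff)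
  from ennreal_SUP_countable_SUP[OF this, of ?I] obtain I :: "nat \<Rightarrow> ennreal"
    where I: "range I \<subseteq> ?I ` ?\<F>" "Sup (?I ` ?\<F>) = Sup (range I)" by blast
  then have "\<forall>i. \<exists>f\<in>?\<F>. I i = ?I f" by blast
  then have "\<exists>F. \<forall>i. F i \<in> ?\<F> \<and> I i = ?I (F i)"
    unfolding Bex_def by (rule choice)
  then obtain F where F: "\<And>i. F i \<in> ?\<F>" "\<And>i. I i = ?I (F i)" by blast
  \<comment> \<open>The pairing function merges a sequence of families into a single
    sequence.\<close>
  define f where "f n = F (fst (prod_decode n)) (snd (prod_decode n))" for n
  have f: "f \<in> ?\<F>"
    using F(1) by (auto simp: f_def)
  have "?I (F i) \<le> ?I f" for i
  proof (intro nn_integral_mono mult_right_mono SUP_least)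
    fix x k
    have "F i k = f (prod_encode (i, k))" by (simp add: f_def)
    then show "ennreal (dens (F i k) x) \<le> (SUP k. ennreal (dens (f k) x))"
      using SUP_upper[of "prod_encode (i, k)" UNIV "\<lambda>k. ennreal (dens (f k) x)"] by simp
  qed simp
  then have Sup_le: "Sup (?I ` ?\<F>) \<le> ?I f"
    unfolding I(2) using F(2) by (auto intro!: SUP_least)
  have max: "?I g \<le> ?I f" if "g \<in> ?\<F>" for g
    by (rule order_trans[OF SUP_upper[OF that, of ?I] Sup_le])
  have "AE x\<in>\<Omega> in M. ennreal (dens u x) \<le> (SUP k. ennreal (dens (f k) x))" if u: "u \<in> Lip1" for u
  proof -
    define g where "g = case_nat u f"
    have g: "g \<in> ?\<F>"
      using u f by (auto simp: g_def split: nat.split)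
    have le: "?H f x \<le> ?H g x" for x
    proof (intro mult_right_mono SUP_least)
      fix k
      have "f k = g (Suc k)" by (simp add: g_def)
      then show "ennreal (dens (f k) x) \<le> (SUP k. ennreal (dens (g k) x))"
        using SUP_upper[of "Suc k" UNIV "\<lambda>k. ennreal (dens (g k) x)"] by simp
    qed simp
    have "(\<integral>\<^sup>+x. ?H g x - ?H f x \<partial>M) = ?I g - ?I f"
      using H_meas[OF g] H_meas[OF f] I_fin[OF f] le by (intro nn_integral_diff) auto
    also have "\<dots> = 0"
      using max[OF g] I_fin[OF g] by (simp add: diff_eq_0_ennreal)
    finally have "AE x in M. ?H g x - ?H f x = 0"
      using H_meas[OF g] H_meas[OF f] by (subst (asm) nn_integral_0_iff_AE) auto
    moreover have "AE x in M. ?H g x \<noteq> \<infinity>"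
      using I_fin[OF g] H_meas[OF g] by (intro nn_integral_PInf_AE) auto
    ultimately show ?thesis
    proof eventually_elim
      case (elim x)
      show ?case
      proof
        assume x: "x \<in> \<Omega>"
        have "ennreal (dens u x) = ennreal (dens (g 0) x)" by (simp add: g_def)
        also have "\<dots> \<le> (SUP k. ennreal (dens (g k) x))" by (rule SUP_upper) simp
        also have "\<dots> \<le> (SUP k. ennreal (dens (f k) x))"
          using elim x by (simp add: ennreal_minus_eq_0)
        finally show "ennreal (dens u x) \<le> (SUP k. ennreal (dens (f k) x))" .
      qed
    qed
  qed
  then show ?thesis
    using that[of f] f by blast
qed

end

section \<open>The minimal gradient\<close>

context lip_composition
begin

text \<open>The distance to the empty set is infinite, so the support condition is void for the
  whole space.\<close>

lemma energy_eq_SUP: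
  "energy G q \<Omega> \<phi> UNIV = (SUP u\<in>Lip1. \<integral>\<^sup>+x\<in>\<Omega>. ennreal (dens u x) \<partial>M)"
proof -
  have "set_edist A {} = \<infinity>" for A :: "'y set"
    by (simp add: set_edist_def)
  then have "{u. u \<in> Lip \<and> lip_const u \<le> 1 \<and> 0 < set_edist (spt u) (UNIV - UNIV)} = (Lip1 :: ('y \<Rightarrow> real) set)"
    by (auto simp: Lip1_def)
  then show ?thesis
    by (simp only: energy_def)
qed

lemma exists_two_points: obtains x1 x2 where "x1 \<in> \<Omega>" "x2 \<in> \<Omega>" "\<phi> x1 \<noteq> \<phi> x2"
proof -
  obtain x1 where x1: "x1 \<in> \<Omega>" using nonempty_\<Omega> by blast
  have "\<Omega> \<noteq> {x1}" using open_\<Omega> not_open_singleton by metis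
  then obtain x2 where "x2 \<in> \<Omega>" "x2 \<noteq> x1" using x1 by blast
  then show ?thesis
    using that[of x1 x2] x1 \<psi>_\<phi> by metis
qed

text \<open>Nonnegativity is not part of \<open>admissible\<close>. It follows by testing with the
  distance from a point, whose Lipschitz constant is positive because the target has two
  points.\<close>

lemma admissible_nonneg:
  assumes g: "admissible G q \<Omega> \<phi> g"
  shows "AE x\<in>\<Omega> in M. 0 \<le> g x"
proof -
  obtain x1 x2 where x: "x1 \<in> \<Omega>" "x2 \<in> \<Omega>" "\<phi> x1 \<noteq> \<phi> x2"
    by (rule exists_two_points)
  define u where "u y = dist (\<phi> x1) y" for y
  have u: "u \<in> Lip1"
    by (auto simp: Lip1_iff u_def abs_le_iff dist_commute) (smt (verit) dist_triangle dist_commute)+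
  have "0 < \<bar>u (\<phi> x1) - u (\<phi> x2)\<bar>"
    using x(3) by (simp add: u_def)
  also have "\<dots> \<le> lip_const u * dist (\<phi> x1) (\<phi> x2)"
    by (rule Lip_bound(1)[OF Lip1_Lip[OF u]])
  finally have L: "0 < lip_const u"
    using x(3) by (simp add: zero_less_mult_iff)
  have "AE x\<in>\<Omega> in M. hgrad u x \<le> lip_const u * g x"
    using g Lip1_Lip[OF u] by (simp add: admissible_def)
  then show ?thesis
  proof eventually_elim
    case (elim x)
    show ?case
    proof
      assume "x \<in> \<Omega>"
      then have "0 \<le> lip_const u * g x"
        using elim hgrad_nonneg[of u x] by linarith
      then show "0 \<le> g x"
        using L by (simp add: zero_le_mult_iff)
    qed
  qed
qed

lemma admissible_dens:
  assumes g: "admissible G q \<Omega> \<phi> g" and u: "u \<in> Lip1"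
  shows "AE x\<in>\<Omega> in M. dens u x \<le> g x powr q"
proof -
  have "AE x\<in>\<Omega> in M. hgrad u x \<le> lip_const u * g x"
    using g Lip1_Lip[OF u] by (simp add: admissible_def)
  with admissible_nonneg[OF g] show ?thesis
  proof eventually_elim
    case (elim x)
    show ?case
    proof
      assume x: "x \<in> \<Omega>"
      have "lip_const u * g x \<le> 1 * g x"
        using u elim(1) x by (intro mult_right_mono) (auto simp: Lip1_def)
      then have "hgrad u x \<le> g x"
        using elim(2) x by linarith
      then show "dens u x \<le> g x powr q"
        using hgrad_nonneg q_ge_1 by (intro powr_mono2) auto
    qed
  qed
qed

lemma powr_q_le_imp: "a powr q \<le> b powr q \<Longrightarrow> 0 \<le> a \<Longrightarrow> 0 \<le> b \<Longrightarrow> a \<le> b"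
  using powr_less_mono2[of q b a] q_ge_1 by linarith

text \<open>The minimal function is the \<open>q\<close>-th root of the supremum over a maximal
  family. Maximality, after normalising the Lipschitz constant, makes it admissible; any other
  admissible function dominates each member of the family and hence the supremum.\<close>

lemma exists_minimal:
  obtains g f where "admissible G q \<Omega> \<phi> g" "\<And>h. admissible G q \<Omega> \<phi> h \<Longrightarrow> AE x\<in>\<Omega> in M. g x \<le> h x"
    "\<And>k::nat. f k \<in> Lip1" "AE x\<in>\<Omega> in M. ennreal (g x powr q) = (SUP k. ennreal (dens (f k) x))"
proof -
  obtain f :: "nat \<Rightarrow> 'y \<Rightarrow> real" where f: "\<And>k. f k \<in> Lip1"
    and max: "\<And>u. u \<in> Lip1 \<Longrightarrow> AE x\<in>\<Omega> in M. ennreal (dens u x) \<le> (SUP k. ennreal (dens (f k) x))"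
    by (rule exists_maximal_family) blast
  define H where "H x = (SUP k. ennreal (dens (f k) x)) * indicator \<Omega> x" for x
  have H_meas: "H \<in> borel_measurable M"
    unfolding H_def[abs_def] by (rule SUP_dens_measurable[OF f])
  have H_fin: "(\<integral>\<^sup>+x. H x \<partial>M) < \<infinity>"
    unfolding H_def by (rule SUP_dens_finite[OF f])
  then have "AE x in M. H x \<noteq> \<infinity>"
    using H_meas by (intro nn_integral_PInf_AE) auto
  \<comment> \<open>\<open>enn2real\<close> sends infinity to 0, which changes the function on a
    null set only.\<close>
  define g where "g x = enn2real (H x) powr (1 / q)" for x
  have g_nonneg: "0 \<le> g x" for x
    by (simp add: g_def)
  have g_powr: "g x powr q = enn2real (H x)" for x
    using q_ge_1 by (simp add: g_def powr_powr)
  have g_H: "AE x\<in>\<Omega> in M. ennreal (g x powr q) = (SUP k. ennreal (dens (f k) x))"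
    using \<open>AE x in M. H x \<noteq> \<infinity>\<close>
  proof eventually_elim
    case (elim x)
    then have "ennreal (enn2real (H x)) = H x"
      by (simp add: less_top)
    moreover have "H x = (SUP k. ennreal (dens (f k) x))" if "x \<in> \<Omega>"
      using that by (simp add: H_def)
    ultimately show ?case
      unfolding g_powr by (intro impI) (rule trans)
  qed
  have "g \<in> borel_measurable lebesgue"
    using H_meas unfolding g_def[abs_def] borel_measurable_M by measurable
  then have "g \<in> borel_measurable (lebesgue_on \<Omega>)"
    by (rule measurable_restrict_space1)
  moreover have "set_integrable M \<Omega> (\<lambda>x. \<bar>g x\<bar> powr q)"
  proof -
    have "integrable M (\<lambda>x. enn2real (H x))"
    proof (rule integrableI_nonneg)
      show "(\<lambda>x. enn2real (H x)) \<in> borel_measurable M"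
        using H_meas by measurable
      have "ennreal (enn2real a) \<le> a" for a
        by (cases a) auto
      then have "(\<integral>\<^sup>+x. ennreal (enn2real (H x)) \<partial>M) \<le> (\<integral>\<^sup>+x. H x \<partial>M)"
        by (intro nn_integral_mono)
      then show "(\<integral>\<^sup>+x. ennreal (enn2real (H x)) \<partial>M) < \<infinity>"
        using H_fin by (rule order.strict_trans1)
    qed simp
    moreover have "indicator \<Omega> x *\<^sub>R \<bar>g x\<bar> powr q = enn2real (H x)" for x
      using g_nonneg[of x] g_powr[of x] by (cases "x \<in> \<Omega>") (simp_all add: H_def)
    ultimately show ?thesis
      unfolding set_integrable_def by simp
  qed
  ultimately have g_Lq: "g \<in> Lq G q \<Omega>"
    by (simp add: Lq_def)
  have g_adm: "AE x\<in>\<Omega> in M. hgrad u x \<le> lip_const u * g x" if u: "u \<in> Lip" for u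
  proof (cases "lip_const u = 0")
    case True
    have const: "u y = u z" for y z
      using Lip_bound(1)[OF u, of y z] True by simp
    \<comment> \<open>\<open>undefined\<close> names some point of the target at which the constant
      value of \<open>u\<close> is read off.\<close>
    have "u (\<phi> x) = 0 * u (\<phi> x) + u undefined" for x
      using const[of "\<phi> x" undefined] by simp
    then have "AE x\<in>\<Omega> in M. hgrad u x = \<bar>0\<bar> * hgrad u x"
      by (intro hgrad_affine[OF u u open_\<Omega> order_refl])
    then show ?thesis
      by eventually_elim (use True in simp)
  next
    case False
    then have L: "0 < lip_const u"
      using Lip_bound(2)[OF u] by linarith
    define v where "v y = u y / lip_const u" for y
    have v: "v \<in> Lip1"
      unfolding Lip1_iff
    proof (intro allI)
      fix y z
      have "\<bar>v y - v z\<bar> = \<bar>u y - u z\<bar> / lip_const u"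
        using L by (simp add: v_def diff_divide_distrib[symmetric])
      then show "\<bar>v y - v z\<bar> \<le> dist y z"
        using Lip_bound(1)[OF u, of y z] L by (simp add: pos_divide_le_eq mult.commute)
    qed
    have "AE x\<in>\<Omega> in M. hgrad v x = \<bar>1 / lip_const u\<bar> * hgrad u x"
      by (rule hgrad_affine[OF Lip1_Lip[OF v] u open_\<Omega> order_refl, of _ 0]) (simp add: v_def)
    with max[OF v] g_H show ?thesis
    proof eventually_elim
      case (elim x)
      show ?case
      proof
        assume x: "x \<in> \<Omega>"
        have "ennreal (dens v x) \<le> ennreal (g x powr q)"
          using elim(1,2) x by simp
        then have "dens v x \<le> g x powr q"
          by simp
        then have "hgrad v x \<le> g x"
          by (rule powr_q_le_imp[OF _ hgrad_nonneg g_nonneg])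
        then show "hgrad u x \<le> lip_const u * g x"
          using elim(3) x L by (simp add: pos_divide_le_eq mult.commute)
      qed
    qed
  qed
  have adm: "admissible G q \<Omega> \<phi> g"
    using g_Lq g_adm by (simp add: admissible_def)
  have minimal: "AE x\<in>\<Omega> in M. g x \<le> h x" if h: "admissible G q \<Omega> \<phi> h" for h
  proof -
    have "AE x in M. \<forall>k. x \<in> \<Omega> \<longrightarrow> dens (f k) x \<le> h x powr q"
      using admissible_dens[OF h f] by (intro AE_all_countable[THEN iffD2] allI)
    with g_H admissible_nonneg[OF h] show ?thesis
    proof eventually_elim
      case (elim x)
      show ?case
      proof
        assume x: "x \<in> \<Omega>"
        have "ennreal (g x powr q) \<le> ennreal (h x powr q)"
          using elim(1,3) x by (simp add: SUP_le_iff)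
        then have "g x powr q \<le> h x powr q"
          by simp
        then show "g x \<le> h x"
          by (rule powr_q_le_imp[OF _ g_nonneg]) (use elim(2) x in blast)
      qed
    qed
  qed
  show ?thesis
    by (rule that[OF adm minimal f g_H])
qed

abbreviation grad :: "'a \<Rightarrow> real" where
  "grad \<equiv> min_grad G q \<Omega> \<phi>"

text \<open>\<open>min_grad\<close> is a choice, but any two minimal functions bound each other
  almost everywhere. It therefore inherits the representation as a supremum from
  \<open>exists_minimal\<close>.\<close>

lemma admissible_grad: "admissible G q \<Omega> \<phi> grad"
  and exists_grad_family: "\<exists>f. (\<forall>k::nat. f k \<in> Lip1) \<and>
    (AE x\<in>\<Omega> in M. ennreal (grad x powr q) = (SUP k. ennreal (dens (f k) x)))"
proof -
  obtain g f where g: "admissible G q \<Omega> \<phi> g" "\<And>h. admissible G q \<Omega> \<phi> h \<Longrightarrow> AE x\<in>\<Omega> in M. g x \<le> h x"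
    and f: "\<And>k::nat. f k \<in> Lip1" "AE x\<in>\<Omega> in M. ennreal (g x powr q) = (SUP k. ennreal (dens (f k) x))"
    by (rule exists_minimal) blast
  have "admissible G q \<Omega> \<phi> g \<and> (\<forall>h. admissible G q \<Omega> \<phi> h \<longrightarrow> (AE x\<in>\<Omega> in M. g x \<le> h x))"
    using g by blast
  then have grad: "admissible G q \<Omega> \<phi> grad \<and> (\<forall>h. admissible G q \<Omega> \<phi> h \<longrightarrow> (AE x\<in>\<Omega> in M. grad x \<le> h x))"
    unfolding min_grad_def by (rule someI[of "\<lambda>g. admissible G q \<Omega> \<phi> g \<and> (\<forall>h. admissible G q \<Omega> \<phi> h \<longrightarrow> (AE x\<in>\<Omega> in M. g x \<le> h x))"])
  then show adm: "admissible G q \<Omega> \<phi> grad" by blast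
  have "AE x\<in>\<Omega> in M. grad x \<le> g x"
    using grad g(1) by blast
  with g(2)[OF adm] f(2) have "AE x\<in>\<Omega> in M. ennreal (grad x powr q) = (SUP k. ennreal (dens (f k) x))"
    by eventually_elim (metis order.antisym)
  then show "\<exists>f. (\<forall>k::nat. f k \<in> Lip1) \<and>
      (AE x\<in>\<Omega> in M. ennreal (grad x powr q) = (SUP k. ennreal (dens (f k) x)))"
    using f(1) by (intro exI[of _ f]) simp
qed

lemma integral_grad:
  assumes U: "open U" "U \<subseteq> \<Omega>"
  shows "(\<integral>\<^sup>+x\<in>U. ennreal (grad x powr q) \<partial>M) = energy G q \<Omega> \<phi> (\<phi> ` U)"
proof (rule antisym)
  obtain f where f: "\<And>k::nat. f k \<in> Lip1"
    and eq: "AE x\<in>\<Omega> in M. ennreal (grad x powr q) = (SUP k. ennreal (dens (f k) x))"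
    using exists_grad_family by blast
  have "(\<integral>\<^sup>+x\<in>U. ennreal (grad x powr q) \<partial>M) = (\<integral>\<^sup>+x\<in>U. (SUP k. ennreal (dens (f k) x)) \<partial>M)"
    using eq U(2) by (intro nn_integral_cong_AE) (auto elim!: eventually_mono simp: indicator_def)
  also have "\<dots> \<le> energy G q \<Omega> \<phi> (\<phi> ` U)"
    by (rule energy_ge[OF f U])
  finally show "(\<integral>\<^sup>+x\<in>U. ennreal (grad x powr q) \<partial>M) \<le> energy G q \<Omega> \<phi> (\<phi> ` U)" .
  have "AE x\<in>\<Omega> in M. ennreal (dens u x) \<le> ennreal (grad x powr q)" if "u \<in> Lip1" for u
    using admissible_dens[OF admissible_grad that] by eventually_elim (auto intro: ennreal_leI)
  then show "energy G q \<Omega> \<phi> (\<phi> ` U) \<le> (\<integral>\<^sup>+x\<in>U. ennreal (grad x powr q) \<partial>M)"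
    using U by (rule energy_le)
qed

lemma reshetnyak_\<phi>: "\<phi> \<in> reshetnyak G q \<Omega>"
proof -
  have "\<phi> \<in> borel_measurable (lebesgue_on \<Omega>)"
  proof (rule borel_measurableI)
    fix S :: "'y set"
    assume "open S"
    then have "open (\<Omega> \<inter> \<phi> -` S)"
      by (rule continuous_open_preimage[OF continuous_\<phi> open_\<Omega>])
    then show "\<phi> -` S \<inter> space (lebesgue_on \<Omega>) \<in> sets (lebesgue_on \<Omega>)"
      using open_\<Omega> by (simp add: sets_restrict_space_iff Int_commute)
  qed
  then show ?thesis
    using comp_L1q admissible_grad by (auto simp: reshetnyak_def)
qed

text \<open>Integrating the pointwise bound shows that the norm of \<open>grad\<close> is a feasible
  constant. It is the least one because its \<open>q\<close>-th power is the energy of the whole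
  space, a supremum of \<open>q\<close>-th powers of seminorms over \<open>Lip1\<close>.\<close>

lemma Lq_norm_grad: "Lq_norm G q \<Omega> grad = composition_norm G q \<Omega> \<phi>"
proof -
  let ?I = "LINT x|M. indicator \<Omega> x * \<bar>grad x\<bar> powr q"
  have norm: "Lq_norm G q \<Omega> grad = ?I powr (1 / q)"
    by (simp add: Lq_norm_def set_lebesgue_integral_def)
  have I_nonneg: "0 \<le> ?I"
    by (intro Bochner_Integration.integral_nonneg) simp
  have int: "integrable M (\<lambda>x. indicator \<Omega> x * \<bar>grad x\<bar> powr q)"
    using admissible_grad by (auto simp: admissible_def Lq_def set_integrable_def)
  have feasible: "L1q_seminorm G q \<Omega> (u \<circ> \<phi>) \<le> Lq_norm G q \<Omega> grad * lip_const u" if u: "u \<in> Lip" for u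
  proof -
    note L = Lip_bound(2)[OF u]
    have "AE x\<in>\<Omega> in M. hgrad u x \<le> lip_const u * grad x"
      using admissible_grad u by (simp add: admissible_def)
    then have "AE x in M. indicator \<Omega> x * dens u x \<le> lip_const u powr q * (indicator \<Omega> x * \<bar>grad x\<bar> powr q)"
    proof eventually_elim
      case (elim x)
      show ?case
      proof (cases "x \<in> \<Omega>")
        case True
        have "hgrad u x \<le> lip_const u * \<bar>grad x\<bar>"
          using elim True mult_left_mono[OF abs_ge_self[of "grad x"] L] by linarith
        then have "dens u x \<le> (lip_const u * \<bar>grad x\<bar>) powr q"
          using hgrad_nonneg q_ge_1 by (intro powr_mono2) auto
        then show ?thesis
          using True L by (simp add: powr_mult)
      qed simp
    qed
    then have "(LINT x|M. indicator \<Omega> x * dens u x) \<le> (LINT x|M. lip_const u powr q * (indicator \<Omega> x * \<bar>grad x\<bar> powr q))"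
      by (intro integral_mono_AE dens_integrable u integrable_mult_right int)
    then have "(LINT x|M. indicator \<Omega> x * dens u x) \<le> lip_const u powr q * ?I"
      by simp
    moreover have "0 \<le> (LINT x|M. indicator \<Omega> x * dens u x)"
      by (intro Bochner_Integration.integral_nonneg) simp
    ultimately have "L1q_seminorm G q \<Omega> (u \<circ> \<phi>) \<le> (lip_const u powr q * ?I) powr (1 / q)"
      unfolding seminorm_eq using q_ge_1 by (intro powr_mono2) auto
    also have "\<dots> = Lq_norm G q \<Omega> grad * lip_const u"
      unfolding norm using L I_nonneg q_ge_1 by (simp add: powr_mult powr_powr)
    finally show ?thesis .
  qed
  have optimal: "Lq_norm G q \<Omega> grad \<le> C"
    if C: "0 \<le> C" "\<And>u. u \<in> Lip \<Longrightarrow> L1q_seminorm G q \<Omega> (u \<circ> \<phi>) \<le> C * lip_const u" for C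
  proof -
    have "ennreal ?I = (\<integral>\<^sup>+x. ennreal (indicator \<Omega> x * \<bar>grad x\<bar> powr q) \<partial>M)"
      by (rule nn_integral_eq_integral[OF int, symmetric]) simp
    also have "\<dots> = (\<integral>\<^sup>+x\<in>\<Omega>. ennreal (grad x powr q) \<partial>M)"
      using admissible_nonneg[OF admissible_grad]
      by (intro nn_integral_cong_AE) (auto elim!: eventually_mono simp: indicator_def)
    also have "\<dots> = energy G q \<Omega> \<phi> UNIV"
      using integral_grad[OF open_\<Omega>] by (simp add: image_\<phi>_\<Omega>)
    also have "\<dots> \<le> ennreal (C powr q)"
      unfolding energy_eq_SUP
    proof (rule SUP_least)
      fix u :: "'y \<Rightarrow> real"
      assume u: "u \<in> Lip1"
      have "L1q_seminorm G q \<Omega> (u \<circ> \<phi>) \<le> C * 1"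
        using C(2)[OF Lip1_Lip[OF u]] u C(1) mult_left_mono[of "lip_const u" 1 C] by (auto simp: Lip1_def)
      then have "L1q_seminorm G q \<Omega> (u \<circ> \<phi>) powr q \<le> C powr q"
        using q_ge_1 by (intro powr_mono2) (auto simp: seminorm_eq)
      then show "(\<integral>\<^sup>+x\<in>\<Omega>. ennreal (dens u x) \<partial>M) \<le> ennreal (C powr q)"
        unfolding nn_integral_dens[OF Lip1_Lip[OF u]] by (rule ennreal_leI)
    qed
    finally have "?I \<le> C powr q"
      by simp
    then have "?I powr (1 / q) \<le> (C powr q) powr (1 / q)"
      using I_nonneg q_ge_1 by (intro powr_mono2) auto
    then show ?thesis
      unfolding norm using C(1) q_ge_1 by (simp add: powr_powr)
  qed
  have "Inf {C. 0 \<le> C \<and> (\<forall>u\<in>Lip. L1q_seminorm G q \<Omega> (u \<circ> \<phi>) \<le> C * lip_const u)} = Lq_norm G q \<Omega> grad"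
  proof (rule cInf_eq_minimum)
    show "Lq_norm G q \<Omega> grad \<in> {C. 0 \<le> C \<and> (\<forall>u\<in>Lip. L1q_seminorm G q \<Omega> (u \<circ> \<phi>) \<le> C * lip_const u)}"
      using feasible by (simp add: norm)
  qed (use optimal in blast)
  then show ?thesis
    by (simp add: composition_norm_def)
qed

end

section \<open>The derivative of the energy\<close>

lemma eventually_balls_at:
  assumes "0 < r" "\<And>z \<delta>. 0 < \<delta> \<Longrightarrow> \<delta> < r \<Longrightarrow> x \<in> cc_ball G z \<delta> \<Longrightarrow> cc_ball G z \<delta> \<subseteq> \<Omega> \<Longrightarrow> P (cc_ball G z \<delta>)"
  shows "\<forall>\<^sub>F B in balls_at G \<Omega> x. P B"
  unfolding balls_at_def using assms by (intro eventually_INF1[of r]) (auto simp: eventually_principal)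

context lip_composition
begin

lemma has_set_derivative_energy:
  "AE x\<in>\<Omega> in M. has_set_derivative G \<Omega> (\<lambda>B. energy G q \<Omega> \<phi> (\<phi> ` B)) (ennreal (grad x powr q)) x"
proof (cases "c = 0")
  case True
  then show ?thesis by (simp add: AE_M)
next
  case False
  then have c: "0 < c" using c_nonneg by simp
  \<comment> \<open>A reciprocal that is positive and finite excludes the values infinity and 0 for
    the measure of the unit ball.\<close>
  interpret ball: carnot_group_ball G
    by unfold_locales (use haar_const c in auto)
  \<comment> \<open>Extended by zero, since the differentiation theorem is stated on the whole
    space.\<close>
  define F where "F x = indicator \<Omega> x * grad x powr q" for x
  let ?J = "\<lambda>B. \<integral>\<^sup>+x\<in>B. ennreal (F x) \<partial>lebesgue" and ?m = "measure lebesgue"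
  have F_nonneg: "0 \<le> F x" for x
    by (simp add: F_def)
  have F_meas: "F \<in> borel_measurable lebesgue"
  proof -
    have "grad \<in> borel_measurable (lebesgue_on \<Omega>)"
      using admissible_grad by (simp add: admissible_def Lq_def)
    then have "(\<lambda>x. indicator \<Omega> x * grad x) \<in> borel_measurable lebesgue"
      using open_\<Omega> by (subst (asm) borel_measurable_restrict_space_iff) auto
    then have "(\<lambda>x. (indicator \<Omega> x * grad x) powr q) \<in> borel_measurable lebesgue"
      by measurable
    moreover have "F x = (indicator \<Omega> x * grad x) powr q" for x
      by (simp add: F_def indicator_def)
    ultimately show ?thesis
      by (simp add: fun_eq_iff[symmetric] cong: measurable_cong)
  qed
  have FU_meas: "(\<lambda>x. ennreal (F x) * indicator U x) \<in> borel_measurable lebesgue" if "open U" for U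
  proof -
    have [measurable]: "F \<in> borel_measurable lebesgue" "U \<in> sets lebesgue"
      using F_meas that by simp_all
    show ?thesis by measurable
  qed
  have J: "energy G q \<Omega> \<phi> (\<phi> ` U) = ennreal c * ?J U" if U: "open U" "U \<subseteq> \<Omega>" for U
  proof -
    have "energy G q \<Omega> \<phi> (\<phi> ` U) = (\<integral>\<^sup>+x\<in>U. ennreal (grad x powr q) \<partial>M)"
      using integral_grad[OF U] by simp
    also have "\<dots> = (\<integral>\<^sup>+x\<in>U. ennreal (F x) \<partial>M)"
      using U(2) by (intro nn_integral_cong) (auto simp: F_def indicator_def)
    also have "\<dots> = (\<integral>\<^sup>+x. ennreal c * (ennreal (F x) * indicator U x) \<partial>lebesgue)"
      unfolding haar_eq by (intro nn_integral_density FU_meas U(1)) simp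
    also have "\<dots> = ennreal c * ?J U"
      by (intro nn_integral_cmult FU_meas U(1))
    finally show ?thesis .
  qed
  have "(\<integral>\<^sup>+x. ennreal (F x) \<partial>lebesgue) = ?J \<Omega>"
    by (intro nn_integral_cong) (auto simp: F_def indicator_def)
  moreover have "ennreal c * ?J \<Omega> < \<infinity>"
    using J[OF open_\<Omega>] energy_UNIV_le image_\<phi>_\<Omega> by (simp add: order.strict_trans1)
  ultimately have fin: "(\<integral>\<^sup>+x. ennreal (F x) \<partial>lebesgue) < \<infinity>"
    using c by (auto simp: ennreal_mult_less_top)
  have J_fin: "?J B < \<infinity>" for B
  proof -
    have "?J B \<le> (\<integral>\<^sup>+x. ennreal (F x) \<partial>lebesgue)"
      by (intro nn_integral_mono) (auto simp: indicator_def)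
    then show ?thesis using fin by (rule order.strict_trans1)
  qed
  \<comment> \<open>The density \<open>c\<close> enters the energy and the measure of the ball alike
    and cancels.\<close>
  have ratio: "energy G q \<Omega> \<phi> (\<phi> ` cc_ball G z \<delta>) / emeasure M (cc_ball G z \<delta>) =
      ennreal (enn2real (?J (cc_ball G z \<delta>)) / ?m (cc_ball G z \<delta>))"
    if B: "0 < \<delta>" "cc_ball G z \<delta> \<subseteq> \<Omega>" for z \<delta>
  proof -
    let ?B = "cc_ball G z \<delta>"
    have m: "?B \<in> lmeasurable" "0 < ?m ?B"
      using ball.cc_ball_lmeasurable ball.measure_cc_ball_pos B(1) by auto
    have "emeasure M ?B = ennreal c * emeasure lebesgue ?B"
      unfolding haar_eq using m(1) by (intro emeasure_density_const) auto
    also have "\<dots> = ennreal (c * ?m ?B)"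
      using m c by (simp add: emeasure_eq_measure2 ennreal_mult)
    finally have "emeasure M ?B = ennreal (c * ?m ?B)" .
    moreover have "energy G q \<Omega> \<phi> (\<phi> ` ?B) = ennreal (c * enn2real (?J ?B))"
      using J[OF ball.open_cc_ball B(2)] J_fin[of ?B] c by (simp add: ennreal_mult less_top)
    ultimately show ?thesis
      using m(2) c by (simp add: divide_ennreal)
  qed
  have "AE x in lebesgue. \<forall>e>0. \<exists>r>0. \<forall>z \<delta>. 0 < \<delta> \<longrightarrow> \<delta> < r \<longrightarrow> x \<in> cc_ball G z \<delta> \<longrightarrow>
      \<bar>enn2real (?J (cc_ball G z \<delta>)) - F x * ?m (cc_ball G z \<delta>)\<bar> \<le> e * ?m (cc_ball G z \<delta>)"
    by (rule ball.Lebesgue_differentiation[OF F_meas F_nonneg fin])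
  then have "AE x in M. \<forall>e>0. \<exists>r>0. \<forall>z \<delta>. 0 < \<delta> \<longrightarrow> \<delta> < r \<longrightarrow> x \<in> cc_ball G z \<delta> \<longrightarrow>
      \<bar>enn2real (?J (cc_ball G z \<delta>)) - F x * ?m (cc_ball G z \<delta>)\<bar> \<le> e * ?m (cc_ball G z \<delta>)"
    by (rule AE_M_I)
  then show ?thesis
  proof eventually_elim
    case (elim x)
    show ?case
    proof
      assume x: "x \<in> \<Omega>"
      have "((\<lambda>B. enn2real (?J B) / ?m B) \<longlongrightarrow> F x) (balls_at G \<Omega> x)"
      proof (rule tendstoI)
        fix e :: real
        assume e: "0 < e"
        then obtain r where r: "0 < r" "\<And>z \<delta>. 0 < \<delta> \<Longrightarrow> \<delta> < r \<Longrightarrow> x \<in> cc_ball G z \<delta> \<Longrightarrow>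
            \<bar>enn2real (?J (cc_ball G z \<delta>)) - F x * ?m (cc_ball G z \<delta>)\<bar> \<le> (e / 2) * ?m (cc_ball G z \<delta>)"
          using elim by (meson half_gt_zero)
        show "\<forall>\<^sub>F B in balls_at G \<Omega> x. dist (enn2real (?J B) / ?m B) (F x) < e"
        proof (rule eventually_balls_at[OF r(1)])
          fix z \<delta>
          assume z: "0 < \<delta>" "\<delta> < r" "x \<in> cc_ball G z \<delta>"
          let ?B = "cc_ball G z \<delta>"
          have m: "0 < ?m ?B"
            using ball.measure_cc_ball_pos z(1) .
          have "\<bar>enn2real (?J ?B) / ?m ?B - F x\<bar> = \<bar>enn2real (?J ?B) - F x * ?m ?B\<bar> / ?m ?B"
          proof -
            have "enn2real (?J ?B) / ?m ?B - F x = (enn2real (?J ?B) - F x * ?m ?B) / ?m ?B"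
              using m by (simp add: diff_divide_distrib)
            then show ?thesis
              using m by (simp only: abs_divide abs_of_pos)
          qed
          also have "\<dots> \<le> e / 2"
            using r(2)[OF z] m by (simp add: pos_divide_le_eq)
          finally show "dist (enn2real (?J ?B) / ?m ?B) (F x) < e"
            using e by (simp add: dist_real_def)
        qed
      qed
      then have "((\<lambda>B. ennreal (enn2real (?J B) / ?m B)) \<longlongrightarrow> ennreal (F x)) (balls_at G \<Omega> x)"
        by (rule tendsto_ennrealI)
      then have "((\<lambda>B. energy G q \<Omega> \<phi> (\<phi> ` B) / emeasure M B) \<longlongrightarrow> ennreal (F x)) (balls_at G \<Omega> x)"
        by (rule Lim_transform_eventually) (rule eventually_balls_at[OF zero_less_one], simp only: ratio)
      then show "has_set_derivative G \<Omega> (\<lambda>B. energy G q \<Omega> \<phi> (\<phi> ` B)) (ennreal (grad x powr q)) x"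
        using x by (simp add: has_set_derivative_def F_def)
    qed
  qed
qed

end

theorem theorem4p1:
  fixes G :: "'a::euclidean_space carnot_data"
    and \<Omega> :: "'a set"
    and q :: real
    and \<phi> :: "'a \<Rightarrow> 'y::metric_space"
  assumes "carnot_group G"
    and "open \<Omega>" and "connected \<Omega>" and "\<Omega> \<noteq> {}"
    and "1 \<le> q"
    and "\<exists>\<psi>. homeomorphism \<Omega> UNIV \<phi> \<psi>"
    and "bounded_composition G q \<Omega> \<phi>"
  shows "\<phi> \<in> reshetnyak G q \<Omega> \<and>
    (\<forall>U. open U \<longrightarrow> U \<subseteq> \<Omega> \<longrightarrow>
      (\<integral>\<^sup>+x\<in>U. ennreal (min_grad G q \<Omega> \<phi> x powr q) \<partial>haar G) = energy G q \<Omega> \<phi> (\<phi> ` U)) \<and>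
    (AE x\<in>\<Omega> in haar G. has_set_derivative G \<Omega> (\<lambda>B. energy G q \<Omega> \<phi> (\<phi> ` B))
      (ennreal (min_grad G q \<Omega> \<phi> x powr q)) x) \<and>
    Lq_norm G q \<Omega> (min_grad G q \<Omega> \<phi>) = composition_norm G q \<Omega> \<phi>"
proof -
  let ?c = "inverse (emeasure lebesgue (cc_ball G 0 1))"
  \<comment> \<open>If the unit ball had measure 0, every Euclidean ball would have infinite Haar
    measure; but constants are Lipschitz, so they belong to the Sobolev class and are integrable
    over compact subsets of \<Omega>.\<close>
  have "?c \<noteq> \<infinity>"
  proof
    assume c: "?c = \<infinity>"
    obtain x e where x: "0 < e" "cball x e \<subseteq> \<Omega>"
      using assms(2,4) open_contains_cball by (metis ex_in_conv)
    have "(\<lambda>_::'y. 1) \<in> Lip"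
      using lip_const_le(1)[of 0 "\<lambda>_. 1"] by simp
    then have "(\<lambda>_. 1 :: real) \<circ> \<phi> \<in> L1q G q \<Omega>"
      using assms(7) unfolding bounded_composition_def by blast
    then have "set_integrable (haar G) (cball x e) ((\<lambda>_. 1 :: real) \<circ> \<phi>)"
      using x(2) compact_cball unfolding L1q_def L1_loc_def by blast
    then have "integrable (haar G) (indicator (cball x e) :: 'a \<Rightarrow> real)"
      by (simp add: set_integrable_def comp_def)
    then have "emeasure (haar G) (cball x e) < \<infinity>"
      by (simp add: integrable_indicator_iff haar_def)
    moreover have "emeasure (haar G) (cball x e) = \<infinity> * emeasure lebesgue (cball x e)"
      unfolding haar_def c by (intro emeasure_density_const) auto
    moreover have "emeasure lebesgue (cball x e) \<noteq> 0"
    proof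
      assume "emeasure lebesgue (cball x e) = 0"
      then have "negligible (cball x e)"
        by (simp add: negligible_iff_emeasure0)
      then have "negligible (ball x e)"
        by (rule negligible_subset) (rule ball_subset_cball)
      then show False
        using open_not_negligible[of "ball x e"] x(1) by simp
    qed
    ultimately show False
      by (simp add: ennreal_top_mult)
  qed
  then obtain c where c: "0 \<le> c" "?c = ennreal c"
    by (cases ?c rule: ennreal_cases) auto
  obtain \<psi> where "homeomorphism \<Omega> UNIV \<phi> \<psi>"
    using assms(6) by blast
  then interpret lip_composition G \<Omega> q \<phi> \<psi> c
    using assms c by (intro lip_composition.intro lip_composition_axioms.intro) auto
  show ?thesis
    using reshetnyak_\<phi> integral_grad has_set_derivative_energy Lq_norm_grad by blast
qed

end
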